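(* Let $\mathcal{C}$ be a spherical fusion category over $\mathbb{C}$, let $a\in\mathcal{C}$ be an object and $b\in\mathrm{Irr}(Z(\mathcal{C}))$ a simple object of the Drinfel'd center with twist scalar $\theta_b$. Let $n\in\mathbb{N}$, and fix an $n$-th root $\theta_b^{1/n}$ of $\theta_b$, writing $\theta_b^{j/n}:=(\theta_b^{1/n})^j$ for $j\in\mathbb{Z}$. Then for every integer $k$ with $1\le k\le n-1$, $$\nu^{b}_{n,k}(a)=\theta_b^{-\frac{k}{n}}\;\alpha_{\frac{k}{g},\frac{n}{g}}\!\left(\theta_b^{\frac{g}{n}}\;\nu^{b}_{\frac{n}{g},1}(a^{g})\right),\qquad g=\mathrm{GCD}(k,n),$$ where, for coprime $j,m$, $\alpha_{j,m}$ denotes the Galois automorphism of the cyclotomic field $\mathbb{Q}(\zeta_m)$ ($\zeta_m$ a primitive $m$-th root of unity) determined by $\zeta_m\mapsto\zeta_m^{j}$, and $a^g=a^{\otimes g}$.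
   Context: A fusion category is a finite semisimple rigid $\mathbb{C}$-linear monoidal category with finite-dimensional Hom spaces, finitely many simple objects up to isomorphism and simple unit $\mathbb{1}$ with $\mathrm{End}(\mathbb{1})=\mathbb{C}$. It is taken to be strict and strictly pivotal: each object $a$ has a dual $\overline a$, with $\overline{\overline a}=a$, and morphisms $\mathrm{ev}_a:\overline a\otimes a\to\mathbb{1}$, $\mathrm{coev}_a:\mathbb{1}\to a\otimes\overline a$, $\mathrm{ev}_{\overline a}: a\otimes\overline a\to\mathbb{1}$, $\mathrm{coev}_{\overline a}:\mathbb{1}\to\overline a\otimes a$ satisfying the zig-zag equations for both dualities. It is spherical if the left and right traces of every endomorphism $f:a\to a$, namely $\mathrm{ev}_a\circ(1_{\overline a}\otimes f)\circ\mathrm{coev}_{\overline a}$ and $\mathrm{ev}_{\overline a}\circ(f\otimes 1_{\overline a})\circ\mathrm{coev}_a$, agree. The Drinfel'd center $Z(\mathcal{C})$ has as objects pairs $(b,e_{b,\cdot})$ with $b\in\mathcal{C}$ and $e_{b,x}:b\otimes x\to x\otimes b$ a half-braiding (natural in $x$, with $e_{b,x\otimes y}=(1_x\otimes e_{b,y})(e_{b,x}\otimes 1_y)$); it is a ribbon fusion category with braiding $e_{b,b'}:b\otimes b'\to b'\otimes b$, and twist $\theta_b=(1_b\otimes\mathrm{ev}_{\overline b})\circ(e_{b,b}\otimes 1_{\overline b})\circ(1_b\otimes\mathrm{coev}_b)$, which for simple $b$ is identified with a scalar. $\mathrm{Irr}$ denotes a set of representatives of simple objects. In $\mathrm{Hom}_{\mathcal{C}}(b,\cdot)$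 the object $b\in Z(\mathcal{C})$ is viewed in $\mathcal{C}$ by forgetting the half-braiding. For $a\in\mathcal{C}$, $b\in Z(\mathcal{C})$, $n\ge1$, the generalized rotation operator on $\mathrm{Hom}_{\mathcal{C}}(b,a^{\otimes n})$ is $$\rho^b_{n,a}(f)=(\mathrm{ev}_a\otimes 1_{a^{\otimes n}})\circ(1_{\overline a}\otimes f\otimes 1_a)\circ(e_{b,\overline a}\otimes 1_a)\circ(1_b\otimes\mathrm{coev}_{\overline a}).$$ For $k\in\mathbb{Z}$, the generalized Frobenius-Schur indicator is $\nu^b_{n,k}(a):=\mathrm{Tr}((\rho^b_{n,a})^k)$, where $\mathrm{Tr}$ is the ordinary trace of a linear map. Part of the meaning of the formula is that the argument of $\alpha_{k/g,n/g}$ lies in $\mathbb{Q}(\zeta_{n/g})$.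
   Formalization: "Strictly pivotal" is taken in its usual full sense: besides the zig-zag equations, the left and right dual functors must coincide as monoidal functors (on morphisms, tensor products and the unit); with the zig-zag equations alone the formula can fail by a sign. *)

theory Defs
  imports Complex_Main "HOL-Library.FuncSet"
begin

section \<open>Complex-linear categories\<close>

text \<open>
  All morphisms live in one ambient complex vector space (e.g. the direct sum of all Hom spaces),
  of which the individual Hom spaces are subspaces. Hom spaces of different pairs of objects are
  not required to meet trivially, so that a category whose objects carry extra structure
  (such as the Drinfel'd center) can reuse the morphisms of the underlying category.
  Axioms only constrain composition of composable morphisms between members of \<open>Ob\<close>.
\<close>

record ('o, 'm) lincat =
  Ob :: "'o set"
  Hom :: "'o \<Rightarrow> 'o \<Rightarrow> 'm set"
  idm :: "'o \<Rightarrow> 'm"  (\<open>\<I>\<index>\<close>)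
  cmp :: "'m \<Rightarrow> 'm \<Rightarrow> 'm"  (infixr \<open>\<cdot>\<index>\<close> 65)
  smult :: "complex \<Rightarrow> 'm \<Rightarrow> 'm"

locale linear_category = vector_space "smult C"
  for C :: "('o, 'm::ab_group_add, 'x) lincat_scheme" (structure) +
  assumes subspace_Hom: "\<lbrakk>a \<in> Ob C; b \<in> Ob C\<rbrakk> \<Longrightarrow> subspace (Hom C a b)"
    and id_Hom: "a \<in> Ob C \<Longrightarrow> \<I> a \<in> Hom C a a"
    and cmp_Hom: "\<lbrakk>a \<in> Ob C; b \<in> Ob C; c \<in> Ob C; f \<in> Hom C a b; g \<in> Hom C b c\<rbrakk>
      \<Longrightarrow> g \<cdot> f \<in> Hom C a c"
    and cmp_assoc: "\<lbrakk>a \<in> Ob C; b \<in> Ob C; c \<in> Ob C; d \<in> Ob C;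
        f \<in> Hom C a b; g \<in> Hom C b c; h \<in> Hom C c d\<rbrakk>
      \<Longrightarrow> (h \<cdot> g) \<cdot> f = h \<cdot> (g \<cdot> f)"
    and cmp_id_right: "\<lbrakk>a \<in> Ob C; b \<in> Ob C; f \<in> Hom C a b\<rbrakk> \<Longrightarrow> f \<cdot> \<I> a = f"
    and cmp_id_left: "\<lbrakk>a \<in> Ob C; b \<in> Ob C; f \<in> Hom C a b\<rbrakk> \<Longrightarrow> \<I> b \<cdot> f = f"
    and cmp_add_right: "\<lbrakk>a \<in> Ob C; b \<in> Ob C; c \<in> Ob C;
        f \<in> Hom C a b; f' \<in> Hom C a b; g \<in> Hom C b c\<rbrakk>
      \<Longrightarrow> g \<cdot> (f + f') = (g \<cdot> f) + (g \<cdot> f')"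
    and cmp_add_left: "\<lbrakk>a \<in> Ob C; b \<in> Ob C; c \<in> Ob C;
        f \<in> Hom C a b; g \<in> Hom C b c; g' \<in> Hom C b c\<rbrakk>
      \<Longrightarrow> (g + g') \<cdot> f = (g \<cdot> f) + (g' \<cdot> f)"
    and cmp_smult_right: "\<lbrakk>a \<in> Ob C; b \<in> Ob C; c \<in> Ob C; f \<in> Hom C a b; g \<in> Hom C b c\<rbrakk>
      \<Longrightarrow> g \<cdot> smult C r f = smult C r (g \<cdot> f)"
    and cmp_smult_left: "\<lbrakk>a \<in> Ob C; b \<in> Ob C; c \<in> Ob C; f \<in> Hom C a b; g \<in> Hom C b c\<rbrakk>
      \<Longrightarrow> smult C r g \<cdot> f = smult C r (g \<cdot> f)"

definition is_iso :: "('o, 'm, 'x) lincat_scheme \<Rightarrow> 'o \<Rightarrow> 'o \<Rightarrow> 'm \<Rightarrow> bool" where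
  "is_iso C a b f \<longleftrightarrow> f \<in> Hom C a b \<and>
     (\<exists>g \<in> Hom C b a. g \<cdot>\<^bsub>C\<^esub> f = \<I>\<^bsub>C\<^esub> a \<and> f \<cdot>\<^bsub>C\<^esub> g = \<I>\<^bsub>C\<^esub> b)"

definition isomorphic :: "('o, 'm, 'x) lincat_scheme \<Rightarrow> 'o \<Rightarrow> 'o \<Rightarrow> bool" where
  "isomorphic C a b \<longleftrightarrow> (\<exists>f. is_iso C a b f)"

definition is_mono :: "('o, 'm, 'x) lincat_scheme \<Rightarrow> 'o \<Rightarrow> 'o \<Rightarrow> 'm \<Rightarrow> bool" where
  "is_mono C a b f \<longleftrightarrow> f \<in> Hom C a b \<and>
     (\<forall>x \<in> Ob C. \<forall>g \<in> Hom C x a. \<forall>h \<in> Hom C x a. f \<cdot>\<^bsub>C\<^esub> g = f \<cdot>\<^bsub>C\<^esub> h \<longrightarrow> g = h)"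

definition is_epi :: "('o, 'm, 'x) lincat_scheme \<Rightarrow> 'o \<Rightarrow> 'o \<Rightarrow> 'm \<Rightarrow> bool" where
  "is_epi C a b f \<longleftrightarrow> f \<in> Hom C a b \<and>
     (\<forall>x \<in> Ob C. \<forall>g \<in> Hom C b x. \<forall>h \<in> Hom C b x. g \<cdot>\<^bsub>C\<^esub> f = h \<cdot>\<^bsub>C\<^esub> f \<longrightarrow> g = h)"

definition zero_object :: "('o, 'm::zero, 'x) lincat_scheme \<Rightarrow> 'o \<Rightarrow> bool" where
  "zero_object C z \<longleftrightarrow> z \<in> Ob C \<and> (\<forall>x \<in> Ob C. Hom C z x = {0} \<and> Hom C x z = {0})"

definition simple_object :: "('o, 'm::zero, 'x) lincat_scheme \<Rightarrow> 'o \<Rightarrow> bool" where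
  "simple_object C x \<longleftrightarrow> x \<in> Ob C \<and> \<not> zero_object C x \<and>
     (\<forall>y \<in> Ob C. \<forall>f. is_mono C y x f \<longrightarrow> zero_object C y \<or> is_iso C y x f)"

definition is_kernel :: "('o, 'm::zero, 'x) lincat_scheme \<Rightarrow> 'o \<Rightarrow> 'o \<Rightarrow> 'm \<Rightarrow> 'o \<Rightarrow> 'm \<Rightarrow> bool" where
  "is_kernel C a b f k i \<longleftrightarrow> k \<in> Ob C \<and> i \<in> Hom C k a \<and> f \<cdot>\<^bsub>C\<^esub> i = 0 \<and>
     (\<forall>x \<in> Ob C. \<forall>g \<in> Hom C x a. f \<cdot>\<^bsub>C\<^esub> g = 0 \<longrightarrow> (\<exists>!h. h \<in> Hom C x k \<and> i \<cdot>\<^bsub>C\<^esub> h = g))"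

definition is_cokernel :: "('o, 'm::zero, 'x) lincat_scheme \<Rightarrow> 'o \<Rightarrow> 'o \<Rightarrow> 'm \<Rightarrow> 'o \<Rightarrow> 'm \<Rightarrow> bool" where
  "is_cokernel C a b f q p \<longleftrightarrow> q \<in> Ob C \<and> p \<in> Hom C b q \<and> p \<cdot>\<^bsub>C\<^esub> f = 0 \<and>
     (\<forall>x \<in> Ob C. \<forall>g \<in> Hom C b x. g \<cdot>\<^bsub>C\<^esub> f = 0 \<longrightarrow> (\<exists>!h. h \<in> Hom C q x \<and> h \<cdot>\<^bsub>C\<^esub> p = g))"

definition is_direct_sum ::
    "('o, 'm::comm_monoid_add, 'x) lincat_scheme \<Rightarrow> nat \<Rightarrow> (nat \<Rightarrow> 'o) \<Rightarrow> 'o \<Rightarrow> bool" where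
  "is_direct_sum C n s x \<longleftrightarrow> (\<exists>\<iota> \<pi>.
     (\<forall>j<n. \<iota> j \<in> Hom C (s j) x \<and> \<pi> j \<in> Hom C x (s j)) \<and>
     (\<forall>j<n. \<forall>l<n. \<pi> j \<cdot>\<^bsub>C\<^esub> \<iota> l = (if j = l then \<I>\<^bsub>C\<^esub> (s j) else 0)) \<and>
     (\<Sum>j<n. \<iota> j \<cdot>\<^bsub>C\<^esub> \<pi> j) = \<I>\<^bsub>C\<^esub> x)"

text \<open>The case \<open>n = 0\<close> of \<open>direct_sums\<close> provides a zero object.\<close>

locale abelian_category = linear_category +
  assumes direct_sums: "(\<And>j. j < n \<Longrightarrow> s j \<in> Ob C) \<Longrightarrow> \<exists>x \<in> Ob C. is_direct_sum C n s x"
    and kernels: "\<lbrakk>a \<in> Ob C; b \<in> Ob C; f \<in> Hom C a b\<rbrakk> \<Longrightarrow> \<exists>k i. is_kernel C a b f k i"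
    and cokernels: "\<lbrakk>a \<in> Ob C; b \<in> Ob C; f \<in> Hom C a b\<rbrakk> \<Longrightarrow> \<exists>q p. is_cokernel C a b f q p"
    and mono_normal: "\<lbrakk>k \<in> Ob C; a \<in> Ob C; is_mono C k a i\<rbrakk>
      \<Longrightarrow> \<exists>b \<in> Ob C. \<exists>f \<in> Hom C a b. is_kernel C a b f k i"
    and epi_normal: "\<lbrakk>b \<in> Ob C; q \<in> Ob C; is_epi C b q p\<rbrakk>
      \<Longrightarrow> \<exists>a \<in> Ob C. \<exists>f \<in> Hom C a b. is_cokernel C a b f q p"

locale finite_semisimple_category = abelian_category +
  assumes finite_dim_Hom: "\<lbrakk>a \<in> Ob C; b \<in> Ob C\<rbrakk> \<Longrightarrow> \<exists>B. finite B \<and> span B = Hom C a b"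
    and semisimple: "x \<in> Ob C \<Longrightarrow>
      \<exists>n s. (\<forall>j<n. simple_object C (s j)) \<and> is_direct_sum C n s x"
    and finitely_many_simples:
      "\<exists>S. finite S \<and> S \<subseteq> Ob C \<and> (\<forall>x. simple_object C x \<longrightarrow> (\<exists>y \<in> S. isomorphic C x y))"


section \<open>Strict spherical fusion categories\<close>

record ('o, 'm) pivcat = "('o, 'm) lincat" +
  unit :: 'o  (\<open>\<u>\<index>\<close>)
  tensO :: "'o \<Rightarrow> 'o \<Rightarrow> 'o"  (infixr \<open>\<odot>\<index>\<close> 75)
  tensM :: "'m \<Rightarrow> 'm \<Rightarrow> 'm"  (infixr \<open>\<boxtimes>\<index>\<close> 70)
  dual :: "'o \<Rightarrow> 'o"
  ev :: "'o \<Rightarrow> 'm"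
  coev :: "'o \<Rightarrow> 'm"

locale strict_monoidal_category = linear_category C
  for C :: "('o, 'm::ab_group_add, 'x) pivcat_scheme" (structure) +
  assumes unit_Ob: "\<u> \<in> Ob C"
    and tensO_Ob: "\<lbrakk>a \<in> Ob C; b \<in> Ob C\<rbrakk> \<Longrightarrow> a \<odot> b \<in> Ob C"
    and tensO_assoc: "\<lbrakk>a \<in> Ob C; b \<in> Ob C; c \<in> Ob C\<rbrakk> \<Longrightarrow> (a \<odot> b) \<odot> c = a \<odot> (b \<odot> c)"
    and tensO_unit_left: "a \<in> Ob C \<Longrightarrow> \<u> \<odot> a = a"
    and tensO_unit_right: "a \<in> Ob C \<Longrightarrow> a \<odot> \<u> = a"
    and tensM_Hom: "\<lbrakk>a \<in> Ob C; b \<in> Ob C; c \<in> Ob C; d \<in> Ob C; f \<in> Hom C a b; g \<in> Hom C c d\<rbrakk>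
      \<Longrightarrow> f \<boxtimes> g \<in> Hom C (a \<odot> c) (b \<odot> d)"
    and tensM_id: "\<lbrakk>a \<in> Ob C; b \<in> Ob C\<rbrakk> \<Longrightarrow> \<I> a \<boxtimes> \<I> b = \<I> (a \<odot> b)"
    and tensM_cmp: "\<lbrakk>a \<in> Ob C; b \<in> Ob C; c \<in> Ob C; a' \<in> Ob C; b' \<in> Ob C; c' \<in> Ob C;
        f \<in> Hom C a b; g \<in> Hom C b c; f' \<in> Hom C a' b'; g' \<in> Hom C b' c'\<rbrakk>
      \<Longrightarrow> (g \<cdot> f) \<boxtimes> (g' \<cdot> f') = (g \<boxtimes> g') \<cdot> (f \<boxtimes> f')"
    and tensM_assoc: "\<lbrakk>a \<in> Ob C; b \<in> Ob C; c \<in> Ob C; a' \<in> Ob C; b' \<in> Ob C; c' \<in> Ob C;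
        f \<in> Hom C a a'; g \<in> Hom C b b'; h \<in> Hom C c c'\<rbrakk>
      \<Longrightarrow> (f \<boxtimes> g) \<boxtimes> h = f \<boxtimes> (g \<boxtimes> h)"
    and tensM_unit_left: "\<lbrakk>a \<in> Ob C; b \<in> Ob C; f \<in> Hom C a b\<rbrakk> \<Longrightarrow> \<I> \<u> \<boxtimes> f = f"
    and tensM_unit_right: "\<lbrakk>a \<in> Ob C; b \<in> Ob C; f \<in> Hom C a b\<rbrakk> \<Longrightarrow> f \<boxtimes> \<I> \<u> = f"
    and tensM_add_right: "\<lbrakk>a \<in> Ob C; b \<in> Ob C; c \<in> Ob C; d \<in> Ob C;
        f \<in> Hom C a b; g \<in> Hom C c d; g' \<in> Hom C c d\<rbrakk>
      \<Longrightarrow> f \<boxtimes> (g + g') = (f \<boxtimes> g) + (f \<boxtimes> g')"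
    and tensM_add_left: "\<lbrakk>a \<in> Ob C; b \<in> Ob C; c \<in> Ob C; d \<in> Ob C;
        f \<in> Hom C a b; f' \<in> Hom C a b; g \<in> Hom C c d\<rbrakk>
      \<Longrightarrow> (f + f') \<boxtimes> g = (f \<boxtimes> g) + (f' \<boxtimes> g)"
    and tensM_smult_right: "\<lbrakk>a \<in> Ob C; b \<in> Ob C; c \<in> Ob C; d \<in> Ob C;
        f \<in> Hom C a b; g \<in> Hom C c d\<rbrakk> \<Longrightarrow> f \<boxtimes> smult C r g = smult C r (f \<boxtimes> g)"
    and tensM_smult_left: "\<lbrakk>a \<in> Ob C; b \<in> Ob C; c \<in> Ob C; d \<in> Ob C;
        f \<in> Hom C a b; g \<in> Hom C c d\<rbrakk> \<Longrightarrow> smult C r f \<boxtimes> g = smult C r (f \<boxtimes> g)"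

text \<open>
  Since double duals are equal to the original objects, the single family \<open>ev\<close>, \<open>coev\<close> provides
  both the left and the right duality: \<open>ev (dual a)\<close> is a map from \<open>a \<odot> dual a\<close> to the unit, and
  the zig-zag equations at \<open>dual a\<close> are those of the second duality.

  The last three axioms express that the identities from \<open>a\<close> to its double dual form a pivotal
  structure, i.e. that the left and the right dual functor coincide as monoidal functors: on
  morphisms, in the canonical map from \<open>dual b \<odot> dual a\<close> to \<open>dual (a \<odot> b)\<close>, and in the
  canonical map from the unit to its dual. The duals of tensor products are not required to be
  equal to the tensor products of the duals.
\<close>

locale strict_pivotal_category = strict_monoidal_category +
  assumes dual_Ob: "a \<in> Ob C \<Longrightarrow> dual C a \<in> Ob C"
    and dual_dual: "a \<in> Ob C \<Longrightarrow> dual C (dual C a) = a"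
    and ev_Hom: "a \<in> Ob C \<Longrightarrow> ev C a \<in> Hom C (dual C a \<odot> a) \<u>"
    and coev_Hom: "a \<in> Ob C \<Longrightarrow> coev C a \<in> Hom C \<u> (a \<odot> dual C a)"
    and zigzag: "a \<in> Ob C \<Longrightarrow> (\<I> a \<boxtimes> ev C a) \<cdot> (coev C a \<boxtimes> \<I> a) = \<I> a"
    and zigzag_dual: "a \<in> Ob C \<Longrightarrow>
      (ev C a \<boxtimes> \<I> (dual C a)) \<cdot> (\<I> (dual C a) \<boxtimes> coev C a) = \<I> (dual C a)"
    and pivotal_natural: "\<lbrakk>a \<in> Ob C; b \<in> Ob C; f \<in> Hom C a b\<rbrakk> \<Longrightarrow>
      (ev C b \<boxtimes> \<I> (dual C a)) \<cdot> (\<I> (dual C b) \<boxtimes> f \<boxtimes> \<I> (dual C a)) \<cdot> (\<I> (dual C b) \<boxtimes> coev C a)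
      = (\<I> (dual C a) \<boxtimes> ev C (dual C b)) \<cdot> (\<I> (dual C a) \<boxtimes> f \<boxtimes> \<I> (dual C b))
          \<cdot> (coev C (dual C a) \<boxtimes> \<I> (dual C b))"
    and pivotal_monoidal: "\<lbrakk>a \<in> Ob C; b \<in> Ob C\<rbrakk> \<Longrightarrow>
      ((ev C b \<cdot> (\<I> (dual C b) \<boxtimes> ev C a \<boxtimes> \<I> b)) \<boxtimes> \<I> (dual C (a \<odot> b)))
          \<cdot> (\<I> (dual C b \<odot> dual C a) \<boxtimes> coev C (a \<odot> b))
      = (\<I> (dual C (a \<odot> b)) \<boxtimes> (ev C (dual C a) \<cdot> (\<I> a \<boxtimes> ev C (dual C b) \<boxtimes> \<I> (dual C a))))
          \<cdot> (coev C (dual C (a \<odot> b)) \<boxtimes> \<I> (dual C b \<odot> dual C a))"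
    and pivotal_unit: "coev C \<u> = coev C (dual C \<u>)"

locale spherical_fusion_category =
  strict_pivotal_category C + finite_semisimple_category C
  for C :: "('o, 'm::ab_group_add, 'x) pivcat_scheme" (structure) +
  assumes simple_unit: "simple_object C \<u>"
    and End_unit: "Hom C \<u> \<u> = {smult C r (\<I> \<u>) | r. True}"
    and spherical: "\<lbrakk>a \<in> Ob C; f \<in> Hom C a a\<rbrakk> \<Longrightarrow>
      ev C a \<cdot> (\<I> (dual C a) \<boxtimes> f) \<cdot> coev C (dual C a)
      = ev C (dual C a) \<cdot> (f \<boxtimes> \<I> (dual C a)) \<cdot> coev C a"

primrec tpow :: "('o, 'm, 'x) pivcat_scheme \<Rightarrow> 'o \<Rightarrow> nat \<Rightarrow> 'o" where
  "tpow C a 0 = \<u>\<^bsub>C\<^esub>"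
| "tpow C a (Suc n) = a \<odot>\<^bsub>C\<^esub> tpow C a n"


section \<open>The Drinfel'd center\<close>

text \<open>
  The components of a half-braiding are isomorphisms. Being \<open>extensional\<close> fixes the irrelevant
  values outside \<open>Ob C\<close>.
\<close>

definition half_braiding :: "('o, 'm, 'x) pivcat_scheme \<Rightarrow> 'o \<Rightarrow> ('o \<Rightarrow> 'm) \<Rightarrow> bool" where
  "half_braiding C b e \<longleftrightarrow> e \<in> extensional (Ob C) \<and>
     (\<forall>x \<in> Ob C. is_iso C (b \<odot>\<^bsub>C\<^esub> x) (x \<odot>\<^bsub>C\<^esub> b) (e x)) \<and>
     (\<forall>x \<in> Ob C. \<forall>y \<in> Ob C. \<forall>f \<in> Hom C x y.
        e y \<cdot>\<^bsub>C\<^esub> (\<I>\<^bsub>C\<^esub> b \<boxtimes>\<^bsub>C\<^esub> f) = (f \<boxtimes>\<^bsub>C\<^esub> \<I>\<^bsub>C\<^esub> b) \<cdot>\<^bsub>C\<^esub> e x) \<and>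
     (\<forall>x \<in> Ob C. \<forall>y \<in> Ob C.
        e (x \<odot>\<^bsub>C\<^esub> y) = (\<I>\<^bsub>C\<^esub> x \<boxtimes>\<^bsub>C\<^esub> e y) \<cdot>\<^bsub>C\<^esub> (e x \<boxtimes>\<^bsub>C\<^esub> \<I>\<^bsub>C\<^esub> y))"

definition drinfeld_center :: "('o, 'm, 'x) pivcat_scheme \<Rightarrow> ('o \<times> ('o \<Rightarrow> 'm), 'm) lincat" where
  "drinfeld_center C =
    \<lparr> Ob = {(b, e). b \<in> Ob C \<and> half_braiding C b e},
      Hom = (\<lambda>(b, e) (b', e'). {f \<in> Hom C b b'. \<forall>x \<in> Ob C.
        (\<I>\<^bsub>C\<^esub> x \<boxtimes>\<^bsub>C\<^esub> f) \<cdot>\<^bsub>C\<^esub> e x = e' x \<cdot>\<^bsub>C\<^esub> (f \<boxtimes>\<^bsub>C\<^esub> \<I>\<^bsub>C\<^esub> x)}),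
      idm = (\<lambda>(b, e). \<I>\<^bsub>C\<^esub> b),
      cmp = cmp C,
      smult = smult C \<rparr>"

definition twist :: "('o, 'm, 'x) pivcat_scheme \<Rightarrow> 'o \<times> ('o \<Rightarrow> 'm) \<Rightarrow> 'm" where
  "twist C = (\<lambda>(b, e).
     (\<I>\<^bsub>C\<^esub> b \<boxtimes>\<^bsub>C\<^esub> ev C (dual C b)) \<cdot>\<^bsub>C\<^esub> (e b \<boxtimes>\<^bsub>C\<^esub> \<I>\<^bsub>C\<^esub> (dual C b)) \<cdot>\<^bsub>C\<^esub> (\<I>\<^bsub>C\<^esub> b \<boxtimes>\<^bsub>C\<^esub> coev C b))"

text \<open>Meaningful when \<open>z\<close> is a simple object of the center.\<close>

definition twist_scalar :: "('o, 'm, 'x) pivcat_scheme \<Rightarrow> 'o \<times> ('o \<Rightarrow> 'm) \<Rightarrow> complex" where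
  "twist_scalar C z = (THE r. twist C z = smult C r (idm (drinfeld_center C) z))"


section \<open>Generalized Frobenius-Schur indicators\<close>

definition rotation ::
    "('o, 'm, 'x) pivcat_scheme \<Rightarrow> 'o \<times> ('o \<Rightarrow> 'm) \<Rightarrow> nat \<Rightarrow> 'o \<Rightarrow> 'm \<Rightarrow> 'm" where
  "rotation C = (\<lambda>(b, e) n a f.
     (ev C a \<boxtimes>\<^bsub>C\<^esub> \<I>\<^bsub>C\<^esub> (tpow C a n)) \<cdot>\<^bsub>C\<^esub> (\<I>\<^bsub>C\<^esub> (dual C a) \<boxtimes>\<^bsub>C\<^esub> f \<boxtimes>\<^bsub>C\<^esub> \<I>\<^bsub>C\<^esub> a)
       \<cdot>\<^bsub>C\<^esub> (e (dual C a) \<boxtimes>\<^bsub>C\<^esub> \<I>\<^bsub>C\<^esub> a) \<cdot>\<^bsub>C\<^esub> (\<I>\<^bsub>C\<^esub> b \<boxtimes>\<^bsub>C\<^esub> coev C (dual C a)))"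

text \<open>
  The trace of a linear endomorphism \<open>T\<close> of a finite-dimensional subspace \<open>V\<close>, computed in an
  arbitrary basis of \<open>V\<close>.
\<close>

definition (in vector_space) trace_on :: "'b set \<Rightarrow> ('b \<Rightarrow> 'b) \<Rightarrow> 'a" where
  "trace_on V T = (let B = (SOME B. independent B \<and> span B = V)
     in \<Sum>v\<in>B. representation B (T v) v)"

definition int_power_on :: "'v set \<Rightarrow> ('v \<Rightarrow> 'v) \<Rightarrow> int \<Rightarrow> 'v \<Rightarrow> 'v" where
  "int_power_on V T k = (if k \<ge> 0 then T ^^ nat k else inv_into V T ^^ nat (- k))"

definition fs_indicator ::
    "('o, 'm::ab_group_add, 'x) pivcat_scheme \<Rightarrow> 'o \<times> ('o \<Rightarrow> 'm) \<Rightarrow> nat \<Rightarrow> int \<Rightarrow> 'o \<Rightarrow> complex" where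
  "fs_indicator C z n k a = (let V = Hom C (fst z) (tpow C a n)
     in vector_space.trace_on (smult C) V (int_power_on V (rotation C z n a) k))"


section \<open>Galois automorphisms of cyclotomic fields\<close>

definition complex_subfield :: "complex set \<Rightarrow> bool" where
  "complex_subfield K \<longleftrightarrow> 1 \<in> K \<and>
     (\<forall>x \<in> K. \<forall>y \<in> K. x - y \<in> K \<and> x * y \<in> K) \<and> (\<forall>x \<in> K. inverse x \<in> K)"

definition zeta :: "nat \<Rightarrow> complex" where
  "zeta m = cis (2 * pi / real m)"

definition cyclotomic_field :: "nat \<Rightarrow> complex set" where
  "cyclotomic_field m = \<Inter> {K. complex_subfield K \<and> zeta m \<in> K}"

definition field_automorphism_on :: "complex set \<Rightarrow> (complex \<Rightarrow> complex) \<Rightarrow> bool" where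
  "field_automorphism_on K \<sigma> \<longleftrightarrow> bij_betw \<sigma> K K \<and>
     (\<forall>x \<in> K. \<forall>y \<in> K. \<sigma> (x + y) = \<sigma> x + \<sigma> y \<and> \<sigma> (x * y) = \<sigma> x * \<sigma> y)"

definition cyclotomic_aut :: "nat \<Rightarrow> nat \<Rightarrow> complex \<Rightarrow> complex" where
  "cyclotomic_aut j m = (THE \<sigma>. \<sigma> \<in> extensional (cyclotomic_field m) \<and>
     field_automorphism_on (cyclotomic_field m) \<sigma> \<and> \<sigma> (zeta m) = zeta m ^ j)"

end

theory Submission
  imports Defs "Jordan_Normal_Form.Char_Poly" "HOL-Number_Theory.Cong"
    "HOL-Computational_Algebra.Fundamental_Theorem_Algebra"
begin

text \<open>
  Rotating a map \<open>b \<rightarrow> x \<odot> y\<close> by a whole block \<open>x\<close> is multiplicative in \<open>x\<close>. Hence the \<open>g\<close>-th power of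
  the rotation on \<open>Hom(b, a\<^sup>n)\<close> is the rotation for \<open>a\<^sup>g\<close> on the same space, and its \<open>n\<close>-th power is the
  full rotation, which by pivotality is precomposition with an endomorphism of \<open>b\<close> that is central
  and inverse to the twist. By Schur's lemma in the center this endomorphism is the scalar
  \<open>1 / \<theta>\<^sub>b\<close>, so \<open>t\<close> times the rotation has order dividing \<open>n\<close> and is diagonalisable with roots of
  unity as eigenvalues. Both sides of the formula are then sums of powers of \<open>n/g\<close>-th roots of
  unity, and the Galois automorphism raises each of these to the power \<open>k/g\<close>. That such an
  automorphism exists (the conjugacy of all primitive roots of unity) follows from the Frobenius
  congruence \<open>f(x\<^sup>p) \<equiv> f(x)\<^sup>p\<close> modulo large primes \<open>p\<close>.
\<close>

section \<open>Galois automorphisms of cyclotomic fields\<close>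

text \<open>The factors of the formula come from eigenvalues: if \<mu> runs over the eigenvalues of
  the \<open>g\<close>-th power of the rotation, the numbers \<open>t ^ g\<close> times \<mu> are
  \<open>n/g\<close>-th roots of unity, and their sum is the argument of the automorphism. Raising
  each to the power \<open>k/g\<close> produces a factor \<open>t ^ k\<close>, which
  \<open>t powi (- int k)\<close> cancels. Three obstacles shape the rest. The dual of
  \<open>x \<odot> y\<close> can only be compared with \<open>dual C y \<odot> dual C x\<close>, so
  multiplicativity of the rotation has to move a comparison map through the diagram. No kernels are
  available in the center beforehand, so for Schur's lemma the kernel of a central endomorphism is
  taken in \<open>C\<close> and receives a half-braiding by hand. The automorphism has to send a
  value of \<open>f\<close> at \<open>zeta m\<close> to its value at \<open>zeta m ^ j\<close>;
  independence of the choice of \<open>f\<close> is the arithmetic content, and integer polynomials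
  with a separate integer denominator make reduction modulo a prime available.\<close>

definition ipoly_at :: "int poly \<Rightarrow> complex \<Rightarrow> complex" where
  "ipoly_at f x = poly (map_poly of_int f) x"

lemma ipoly_at_simps [simp]:
  "ipoly_at 0 x = 0" "ipoly_at 1 x = 1"
  "ipoly_at (pCons c f) x = of_int c + x * ipoly_at f x"
  "ipoly_at (f + g) x = ipoly_at f x + ipoly_at g x"
  "ipoly_at (f - g) x = ipoly_at f x - ipoly_at g x"
  "ipoly_at (- f) x = - ipoly_at f x"
  "ipoly_at (f * g) x = ipoly_at f x * ipoly_at g x"
  "ipoly_at (Polynomial.smult c f) x = of_int c * ipoly_at f x"
  "ipoly_at (f ^ n) x = ipoly_at f x ^ n"
  by (simp_all add: ipoly_at_def hom_distribs)

lemma ipoly_at_pcompose [simp]: "ipoly_at (pcompose f g) x = ipoly_at f (ipoly_at g x)"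
  by (induction f) (simp_all add: pcompose_pCons)

lemma ipoly_at_monom [simp]: "ipoly_at (monom c n) x = of_int c * x ^ n"
  by (simp add: ipoly_at_def map_poly_monom poly_monom)

lemma ipoly_at_altdef: "ipoly_at f x = (\<Sum>k\<le>degree f. of_int (coeff f k) * x ^ k)"
  by (simp add: ipoly_at_def poly_altdef)

text \<open>Exponents of \<open>x\<close> reduce modulo \<open>m\<close>, so multiplication by the
  value acts on the powers of \<open>x\<close> by an integer matrix. The value is an eigenvalue of
  that matrix, hence a root of its monic characteristic polynomial.\<close>

lemma algebraic_int_ipoly_at:
  assumes m: "m > 0" and x: "x ^ m = 1"
  shows "algebraic_int (ipoly_at f x)"
proof -
  \<comment> \<open>Row \<open>i\<close> expands the value times \<open>x ^ i\<close> in the powers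
    \<open>x ^ j\<close> with \<open>j < m\<close>.\<close>
  define A :: "int mat" where
    "A = mat m m (\<lambda>(i, j). \<Sum>k | k \<le> degree f \<and> (k + i) mod m = j. coeff f k)"
  define B :: "complex mat" where "B = map_mat of_int A"
  define v where "v = vec m (\<lambda>j. x ^ j)"
  have A: "A \<in> carrier_mat m m" and B: "B \<in> carrier_mat m m"
    by (simp_all add: A_def B_def)
  have pow: "x ^ (l mod m) = x ^ l" for l
    using x by (metis mult.right_neutral power_add power_mult mod_mult_div_eq power_one)
  have "B *\<^sub>v v = ipoly_at f x \<cdot>\<^sub>v v"
  proof (rule eq_vecI)
    fix i assume "i < dim_vec (ipoly_at f x \<cdot>\<^sub>v v)"
    then have i: "i < m"
      by (simp add: v_def)
    have "(B *\<^sub>v v) $ i = (\<Sum>j<m. of_int (\<Sum>k | k \<le> degree f \<and> (k + i) mod m = j. coeff f k) * x ^ j)"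
      using i by (simp add: B_def A_def v_def scalar_prod_def lessThan_atLeast0)
    also have "\<dots> = (\<Sum>j<m. \<Sum>k | k \<in> {..degree f} \<and> (k + i) mod m = j.
        of_int (coeff f k) * x ^ ((k + i) mod m))"
      by (simp add: sum_distrib_right)
    also have "\<dots> = (\<Sum>k\<le>degree f. of_int (coeff f k) * x ^ ((k + i) mod m))"
      using m by (intro sum.group) auto
    also have "\<dots> = ipoly_at f x * x ^ i"
      by (simp add: pow ipoly_at_altdef sum_distrib_right power_add mult.assoc)
    finally show "(B *\<^sub>v v) $ i = (ipoly_at f x \<cdot>\<^sub>v v) $ i"
      using i by (simp add: v_def)
  qed (simp add: B_def A_def v_def)
  moreover have "v \<noteq> 0\<^sub>v m"
  proof
    assume "v = 0\<^sub>v m"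
    then have "v $ 0 = 0"
      using m by simp
    then show False
      using m by (simp add: v_def)
  qed
  ultimately have "eigenvalue B (ipoly_at f x)"
    unfolding eigenvalue_def eigenvector_def using B by (intro exI[of _ v]) (simp add: v_def)
  then have "poly (map_poly of_int (char_poly A)) (ipoly_at f x) = 0"
    using eigenvalue_root_char_poly[OF B, of "ipoly_at f x"]
    unfolding B_def of_int_hom.char_poly_hom[OF A] by simp
  moreover have "lead_coeff (char_poly A) = 1"
    using degree_monic_char_poly[OF A] by simp
  ultimately show ?thesis
    unfolding algebraic_int_altdef_ipoly by blast
qed

text \<open>A substitute for the norm: in an integer relation of least degree the constant term is
  nonzero, since otherwise the nonzero value could be cancelled. Moving that term to the other side
  exhibits the value as a divisor of an integer. This supplies inverses in the cyclotomic field and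
  bounds the primes that can divide the value.\<close>

lemma ipoly_at_divides_int:
  assumes m: "m > 0" and x: "x ^ m = 1" and f: "ipoly_at f x \<noteq> 0"
  obtains h D where "D \<noteq> 0" "ipoly_at f x * ipoly_at h x = of_int D"
proof -
  let ?\<alpha> = "ipoly_at f x"
  obtain p0 where "ipoly_at p0 ?\<alpha> = 0" "lead_coeff p0 = 1"
    using algebraic_int_ipoly_at[OF m x, of f] unfolding algebraic_int_altdef_ipoly
    by (auto simp: ipoly_at_def)
  then have "\<exists>p. p \<noteq> 0 \<and> ipoly_at p ?\<alpha> = 0"
    by (intro exI[of _ p0]) auto
  then obtain p where p: "p \<noteq> 0" "ipoly_at p ?\<alpha> = 0"
    and min: "\<And>q. q \<noteq> 0 \<and> ipoly_at q ?\<alpha> = 0 \<Longrightarrow> degree p \<le> degree q"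
    using ex_has_least_nat[of "\<lambda>p. p \<noteq> 0 \<and> ipoly_at p ?\<alpha> = 0" _ degree] by blast
  obtain c q where q: "p = pCons c q"
    by (cases p)
  have "c \<noteq> 0"
  proof
    assume "c = 0"
    then have "q \<noteq> 0" "ipoly_at q ?\<alpha> = 0" "degree q < degree p"
      using p f by (auto simp: q)
    then show False
      using min[of q] by simp
  qed
  moreover have "?\<alpha> * ipoly_at (- pcompose q f) x = of_int c"
    using p(2) by (simp add: q add_eq_0_iff)
  ultimately show ?thesis
    using that by blast
qed

section \<open>Frobenius congruence and conjugacy of roots of unity\<close>

lemma prime_dvd_binomial_defect:
  fixes u v :: "'a::comm_ring_1"
  assumes p: "prime p"
  shows "of_nat p dvd (u + v) ^ p - u ^ p - v ^ p"
proof -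
  let ?t = "\<lambda>k. of_nat (p choose k) * u ^ k * v ^ (p - k)"
  have "p > 0"
    using p prime_gt_0_nat by blast
  then have "{..p} = insert 0 (insert p {1..<p})"
    by auto
  then have "(u + v) ^ p = v ^ p + (u ^ p + (\<Sum>k\<in>{1..<p}. ?t k))"
    using \<open>p > 0\<close> by (simp add: binomial_ring)
  moreover have "of_nat p dvd (\<Sum>k\<in>{1..<p}. ?t k)"
  proof (rule dvd_sum)
    fix k assume "k \<in> {1..<p}"
    then have "p dvd p choose k"
      using p by (intro dvd_choose_prime) auto
    then show "of_nat p dvd ?t k"
      by (auto simp: mult.assoc elim!: dvdE)
  qed
  ultimately show ?thesis
    by simp
qed

lemma fermat_dvd:
  fixes a :: int
  assumes p: "prime p"
  shows "int p dvd a ^ p - a"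
proof -
  have *: "int p dvd int n ^ p - int n" for n
  proof (induction n)
    case 0
    show ?case using prime_gt_0_nat[OF p] by (simp add: power_0_left)
  next
    case (Suc n)
    have "int p dvd ((int n + 1) ^ p - int n ^ p - 1 ^ p) + (int n ^ p - int n)"
      using prime_dvd_binomial_defect[OF p, of "int n" 1] Suc by (intro dvd_add) auto
    then show ?case
      by (simp add: algebra_simps)
  qed
  have "p > 0"
    using p prime_gt_0_nat by blast
  then have "int p dvd (a mod int p) ^ p - a mod int p"
    using *[of "nat (a mod int p)"] by simp
  then show ?thesis
    by (simp add: mod_eq_dvd_iff[symmetric] power_mod)
qed

lemma frobenius_poly:
  fixes f :: "int poly"
  assumes p: "prime p"
  shows "of_nat p dvd pcompose f (monom 1 p) - f ^ p"
proof (induction f)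
  case 0
  show ?case using prime_gt_0_nat[OF p] by (simp add: power_0_left)
next
  case (pCons a f)
  let ?X = "monom 1 p :: int poly"
  have *: "pCons a f = [:a:] + monom 1 1 * f"
    by (simp add: monom_Suc)
  have "of_nat p dvd [:a ^ p - a:]"
    using fermat_dvd[OF p, of a] by (auto simp: of_nat_poly elim!: dvdE)
  \<comment> \<open>The wanted difference splits into \<open>?X\<close> times the induction
    hypothesis, the Fermat defect of the coefficient \<open>a\<close>, and the binomial defect of
    the sum of \<open>[:a:]\<close> and \<open>monom 1 1 * f\<close>.\<close>
  then have "of_nat p dvd ?X * (pcompose f ?X - f ^ p) - [:a ^ p - a:]
      - (([:a:] + monom 1 1 * f) ^ p - [:a:] ^ p - (monom 1 1 * f) ^ p)"
    using pCons(2) prime_dvd_binomial_defect[OF p, of "[:a:]" "monom 1 1 * f"]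
    by (intro dvd_diff[OF dvd_diff[OF dvd_mult]])
  also have "[:a:] ^ p = [:a ^ p:]"
    by (simp add: poly_const_pow)
  also have "?X * (pcompose f ?X - f ^ p) - [:a ^ p - a:]
      - (([:a:] + monom 1 1 * f) ^ p - [:a ^ p:] - (monom 1 1 * f) ^ p)
      = pcompose (pCons a f) ?X - (pCons a f) ^ p"
  proof -
    have "pcompose (pCons a f) ?X = [:a:] + ?X * pcompose f ?X"
      by (simp add: pcompose_pCons)
    moreover have "[:a ^ p - a:] = [:a ^ p:] - [:a:]"
      by simp
    moreover have "(monom 1 1 * f) ^ p = ?X * f ^ p"
      by (simp add: power_mult_distrib monom_power)
    ultimately show ?thesis
      unfolding * by (simp only:) (simp only: algebra_simps)
  qed
  finally show ?case .
qed

text \<open>With \<open>y = x ^ p\<close>, the Frobenius congruence makes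
  \<open>ipoly_at f y\<close> equal to \<open>p\<close> times an algebraic integer. If it is
  nonzero, it divides a nonzero integer \<open>D y\<close>, so \<open>p\<close> divides
  \<open>D y\<close>, which is impossible for large \<open>p\<close>. Only finitely many
  \<open>y\<close> occur, hence one bound \<open>N\<close> for all of them.\<close>

lemma root_of_unity_large_prime:
  assumes m: "m > 0"
  obtains N where "\<And>x p. \<lbrakk>x ^ m = 1; ipoly_at f x = 0; prime p; p > N\<rbrakk> \<Longrightarrow> ipoly_at f (x ^ p) = 0"
proof -
  let ?R = "{x :: complex. x ^ m = 1}"
  have "\<exists>D h. D \<noteq> 0 \<and> ipoly_at f x * ipoly_at h x = of_int D"
    if "x \<in> ?R" "ipoly_at f x \<noteq> 0" for x
    using ipoly_at_divides_int[OF m _ that(2)] that(1) by (metis mem_Collect_eq)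
  then obtain D h where D: "\<And>x. \<lbrakk>x \<in> ?R; ipoly_at f x \<noteq> 0\<rbrakk> \<Longrightarrow>
      D x \<noteq> 0 \<and> ipoly_at f x * ipoly_at (h x) x = of_int (D x)"
    by metis
  have fin: "finite ?R"
    using m by (intro finite_roots_unity) simp
  define N where "N = Max (insert 0 ((\<lambda>x. nat \<bar>D x\<bar>) ` ?R))"
  show ?thesis
  proof (rule that[of N])
    fix x p assume x: "x ^ m = 1" "ipoly_at f x = 0" and p: "prime p" "p > N"
    define y where "y = x ^ p"
    show "ipoly_at f (x ^ p) = 0"
    proof (rule ccontr)
      assume "ipoly_at f (x ^ p) \<noteq> 0"
      then have y: "y \<in> ?R" "ipoly_at f y \<noteq> 0"
        using x(1) by (auto simp: y_def power_mult[symmetric] mult.commute[of p]) (simp add: power_mult)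
      obtain q where q: "pcompose f (monom 1 p) - f ^ p = of_nat p * q"
        using frobenius_poly[OF p(1), of f] by (elim dvdE)
      have p0: "p > 0"
        using p prime_gt_0_nat by blast
      have "ipoly_at (pcompose f (monom 1 p) - f ^ p) x = ipoly_at (of_nat p * q) x"
        by (simp only: q)
      then have "ipoly_at f y = of_nat p * ipoly_at q x"
        using x(2) p0 by (simp add: y_def of_nat_poly power_0_left)
      then have "of_int (D y) = of_nat p * ipoly_at (q * pcompose (h y) (monom 1 p)) x"
        using D[OF y] by (simp add: y_def mult.assoc)
      then have eq: "of_int (D y) / of_nat p = ipoly_at (q * pcompose (h y) (monom 1 p)) x"
        using p0 by (simp add: field_simps)
      \<comment> \<open>The quotient is rational and, by \<open>eq\<close>, an algebraic
        integer.\<close>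
      have "(of_int (D y) / of_nat p :: complex) \<in> \<int>"
        using algebraic_int_ipoly_at[OF m x(1), of "q * pcompose (h y) (monom 1 p)"]
        by (intro rational_algebraic_int_is_int) (simp add: eq, simp)
      then obtain k where "(of_int (D y) / of_nat p :: complex) = of_int k"
        by (elim Ints_cases)
      then have "(of_int (D y) :: complex) = of_int (k * int p)"
        using p0 by (simp add: field_simps)
      then have "D y = k * int p"
        by (simp only: of_int_eq_iff)
      then have "p \<le> nat \<bar>D y\<bar>"
        using D[OF y] dvd_imp_le_int[of "D y" "int p"] by simp
      also have "\<dots> \<le> N"
        unfolding N_def using fin y by (intro Max_ge) auto
      finally show False
        using p by simp
    qed
  qed
qed

text \<open>
  The exponent \<open>j\<close> may be replaced by \<open>j + m * t\<close>; for \<open>t\<close> the product of the small primes not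
  dividing \<open>j\<close> this has only large prime factors.
\<close>

lemma root_of_unity_conjugate:
  assumes m: "m > 0" and x: "x ^ m = 1" "ipoly_at f x = 0" and j: "coprime j m"
  shows "ipoly_at f (x ^ j) = 0"
proof -
  obtain N where N: "\<And>x p. \<lbrakk>x ^ m = 1; ipoly_at f x = 0; prime p; p > N\<rbrakk> \<Longrightarrow> ipoly_at f (x ^ p) = 0"
    using root_of_unity_large_prime[OF m, of f] by blast
  \<comment> \<open>One prime factor of \<open>i\<close> is removed at a time; \<open>y ^ p\<close>
    is again an \<open>m\<close>-th root of unity and a root of \<open>f\<close>, which is why
    \<open>N\<close> must not depend on the root.\<close>
  have large: "ipoly_at f (y ^ i) = 0"
    if "y ^ m = 1" "ipoly_at f y = 0" "i > 0" "\<And>p. \<lbrakk>prime p; p dvd i\<rbrakk> \<Longrightarrow> p > N" for y and i :: nat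
    using that
  proof (induction i arbitrary: y rule: less_induct)
    case (less i)
    show ?case
    proof (cases "i = 1")
      case False
      then obtain p where p: "prime p" "p dvd i"
        using prime_factor_nat by blast
      then obtain i' where i': "i = p * i'"
        by (elim dvdE)
      have "ipoly_at f ((y ^ p) ^ i') = 0"
      proof (rule less.IH)
        show "i' < i"
          using less.prems(3) prime_gt_1_nat[OF p(1)] by (simp add: i')
        show "(y ^ p) ^ m = 1"
          using less.prems(1) by (metis mult.commute power_mult power_one)
        show "ipoly_at f (y ^ p) = 0"
          using N less.prems p by blast
      qed (use less.prems in \<open>auto simp: i'\<close>)
      then show ?thesis
        by (simp add: i' power_mult)
    qed (use less.prems in simp)
  qed
  define t where "t = \<Prod>{p. prime p \<and> p \<le> N \<and> \<not> p dvd j}"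
  have fin: "finite {p. prime p \<and> p \<le> N \<and> \<not> p dvd j}"
    by (rule finite_subset[of _ "{..N}"]) auto
  have t0: "t > 0"
    unfolding t_def by (intro prod_pos) (auto simp: prime_gt_0_nat)
  have "p > N" if p: "prime p" "p dvd j + m * t" for p
  proof (rule ccontr)
    assume "\<not> p > N"
    show False
    proof (cases "p dvd j")
      case True
      then have "p dvd m * t"
        using p(2) by (simp add: dvd_add_right_iff)
      moreover have "\<not> p dvd m"
        using True j p(1) by (meson coprime_common_divisor not_prime_unit)
      ultimately have "p dvd t"
        using p(1) by (simp add: prime_dvd_mult_iff)
      then obtain q where "prime q" "\<not> q dvd j" "p dvd q"
        using prime_dvd_prod_iff[OF fin p(1), of "\<lambda>x. x"] by (auto simp: t_def)
      then show False
        using True p(1) primes_dvd_imp_eq by blast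
    next
      case False
      then have "p dvd t"
        unfolding t_def using p(1) \<open>\<not> p > N\<close> by (intro dvd_prodI[OF fin, of p "\<lambda>x. x"]) auto
      then show False
        using p(2) False by (simp add: dvd_add_left_iff)
    qed
  qed
  then have "ipoly_at f (x ^ (j + m * t)) = 0"
    using large[OF x, of "j + m * t"] m t0 by simp
  then show ?thesis
    using x(1) by (simp add: power_add power_mult)
qed


section \<open>The cyclotomic field and its automorphisms\<close>

lemma zeta_power [simp]: "m > 0 \<Longrightarrow> zeta m ^ m = 1"
  by (simp add: zeta_def DeMoivre)

lemma root_of_unity_eq_zeta_power:
  assumes m: "m > 0" and x: "x ^ m = 1"
  obtains i where "x = zeta m ^ i"
proof -
  have "x \<in> (\<lambda>k. cis (2 * pi * real k / real m)) ` {..<m}"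
    using bij_betw_roots_unity[OF m] x unfolding bij_betw_def by blast
  then obtain k where "x = cis (2 * pi * real k / real m)"
    by blast
  then show ?thesis
    by (intro that[of k]) (simp add: zeta_def DeMoivre mult.commute)
qed

text \<open>This makes the automorphism well defined: the image of a value does not depend on the
  polynomial that represents it.\<close>

lemma zeta_conjugate:
  assumes "m > 0" "coprime j m" "ipoly_at f (zeta m) = ipoly_at g (zeta m)"
  shows "ipoly_at f (zeta m ^ j) = ipoly_at g (zeta m ^ j)"
  using root_of_unity_conjugate[of m "zeta m" "f - g" j] assms by simp

text \<open>An integer denominator suffices even for inverses: a nonzero value at
  \<open>zeta m\<close> times another such value is a nonzero integer, so the inverse is the
  cofactor over that integer.\<close>

lemma cyclotomic_field_eq:
  assumes m: "m > 0"
  shows "cyclotomic_field m = {ipoly_at f (zeta m) / of_int d | f d. d \<noteq> 0}" (is "_ = ?K")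
proof
  have "complex_subfield ?K"
    unfolding complex_subfield_def
  proof (intro conjI ballI)
    show "1 \<in> ?K"
      by (intro CollectI exI[of _ 1] conjI) auto
  next
    fix x y assume "x \<in> ?K" "y \<in> ?K"
    then obtain f d g e where x: "x = ipoly_at f (zeta m) / of_int d" "d \<noteq> 0"
      and y: "y = ipoly_at g (zeta m) / of_int e" "e \<noteq> 0"
      by blast
    show "x - y \<in> ?K"
      by (intro CollectI exI[of _ "Polynomial.smult e f - Polynomial.smult d g"] exI[of _ "d * e"])
        (use x(2) y(2) in \<open>simp add: x(1) y(1) field_simps\<close>)
    show "x * y \<in> ?K"
      by (intro CollectI exI[of _ "f * g"] exI[of _ "d * e"]) (use x y in simp)
  next
    fix x assume "x \<in> ?K"
    then obtain f d where x: "x = ipoly_at f (zeta m) / of_int d" "d \<noteq> 0"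
      by blast
    show "inverse x \<in> ?K"
    proof (cases "ipoly_at f (zeta m) = 0")
      case True
      then show ?thesis
        using x by (intro CollectI exI[of _ 0] exI[of _ 1]) auto
    next
      case False
      obtain h D where h: "D \<noteq> 0" "ipoly_at f (zeta m) * ipoly_at h (zeta m) = of_int D"
        using ipoly_at_divides_int[OF m zeta_power[OF m] False] by blast
      then have "ipoly_at h (zeta m) = of_int D / ipoly_at f (zeta m)"
        using False by (simp add: field_simps)
      then show ?thesis
        using x h(1) False
        by (intro CollectI exI[of _ "Polynomial.smult d h"] exI[of _ D]) simp
    qed
  qed
  moreover have "zeta m \<in> ?K"
    by (intro CollectI exI[of _ "monom 1 1"] exI[of _ 1]) simp
  ultimately show "cyclotomic_field m \<subseteq> ?K"
    unfolding cyclotomic_field_def by blast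
next
  show "?K \<subseteq> cyclotomic_field m"
    unfolding cyclotomic_field_def
  proof (intro subsetI InterI)
    fix x L assume x: "x \<in> ?K" and "L \<in> {K. complex_subfield K \<and> zeta m \<in> K}"
    then have L: "complex_subfield L" and z: "zeta m \<in> L"
      by auto
    have diff: "u - v \<in> L" and mult: "u * v \<in> L" and inv: "inverse u \<in> L" and one: "1 \<in> L"
      if "u \<in> L" "v \<in> L" for u v
      using L that unfolding complex_subfield_def by auto
    have zero: "0 \<in> L"
      using diff[OF z z] by simp
    have add: "u + v \<in> L" if "u \<in> L" "v \<in> L" for u v
      using diff[OF that(1) diff[OF zero that(2)]] by simp
    have nat: "of_nat n \<in> L" for n
      by (induction n) (auto intro: zero add one[OF z z])
    have int: "of_int d \<in> L" for d
      by (cases d) (use nat diff[OF zero nat] in \<open>auto simp del: of_nat_Suc\<close>)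
    have "ipoly_at f (zeta m) \<in> L" for f
      by (induction f) (auto intro: zero add mult int z)
    then show "x \<in> L"
      using x by (auto simp: divide_inverse intro!: mult inv int)
  qed
qed

lemma complex_subfield_cyclotomic: "complex_subfield (cyclotomic_field m)"
  unfolding cyclotomic_field_def complex_subfield_def by blast

text \<open>The set where the two maps agree is a subfield containing \<open>zeta m\<close>, and the
  cyclotomic field is the least such subfield.\<close>

lemma field_automorphism_unique:
  assumes s: "field_automorphism_on (cyclotomic_field m) s"
    and t: "field_automorphism_on (cyclotomic_field m) t"
    and eq: "s (zeta m) = t (zeta m)" and x: "x \<in> cyclotomic_field m"
  shows "s x = t x"
proof -
  let ?K = "cyclotomic_field m"
  define L where "L = {x \<in> ?K. s x = t x}"
  have K0: "1 \<in> ?K" "\<And>u v. \<lbrakk>u \<in> ?K; v \<in> ?K\<rbrakk> \<Longrightarrow> u - v \<in> ?K \<and> u * v \<in> ?K"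
    "\<And>u. u \<in> ?K \<Longrightarrow> inverse u \<in> ?K"
    using complex_subfield_cyclotomic[of m] unfolding complex_subfield_def
    by auto
  have K: "1 \<in> ?K" "0 \<in> ?K" "\<And>u v. \<lbrakk>u \<in> ?K; v \<in> ?K\<rbrakk> \<Longrightarrow> u - v \<in> ?K \<and> u * v \<in> ?K"
    "\<And>u. u \<in> ?K \<Longrightarrow> inverse u \<in> ?K"
    using K0 K0(2)[OF K0(1) K0(1)] by auto
  have hom: "r 1 = 1 \<and> (\<forall>u\<in>?K. \<forall>v\<in>?K. r (u - v) = r u - r v \<and> r (u * v) = r u * r v)
      \<and> (\<forall>u\<in>?K. r (inverse u) = inverse (r u))" if r: "field_automorphism_on ?K r" for r
  proof -
    have inj: "inj_on r ?K" and add: "\<And>u v. \<lbrakk>u \<in> ?K; v \<in> ?K\<rbrakk> \<Longrightarrow> r (u + v) = r u + r v"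
      and mult: "\<And>u v. \<lbrakk>u \<in> ?K; v \<in> ?K\<rbrakk> \<Longrightarrow> r (u * v) = r u * r v"
      using r unfolding field_automorphism_on_def bij_betw_def by auto
    have r0: "r 0 = 0"
      using add[OF K(2) K(2)] by simp
    \<comment> \<open>\<open>field_automorphism_on\<close> does not list \<open>r 1 = 1\<close>; it
      follows because \<open>r 1\<close> is idempotent and, by injectivity, nonzero.\<close>
    have "r 1 \<noteq> r 0"
      using inj_onD[OF inj _ K(1) K(2)] by auto
    moreover have "r 1 * r 1 = r 1"
      using mult[OF K(1) K(1)] by simp
    ultimately have r1: "r 1 = 1"
      using r0 by simp
    have diff: "r (u - v) = r u - r v" if "u \<in> ?K" "v \<in> ?K" for u v
      using add[of "u - v" v] K(3) that by (simp add: eq_diff_eq)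
    have "r (inverse u) = inverse (r u)" if u: "u \<in> ?K" for u
    proof (cases "u = 0")
      case False
      then have "r u * r (inverse u) = 1"
        using mult[OF u K(4)[OF u]] r1 by simp
      then show ?thesis
        by (metis inverse_unique)
    qed (simp add: r0)
    with r1 diff mult show ?thesis
      by blast
  qed
  have "complex_subfield L"
    unfolding complex_subfield_def L_def using K hom[OF s] hom[OF t] by auto
  moreover have "zeta m \<in> L"
    using eq unfolding L_def cyclotomic_field_def by blast
  ultimately have "?K \<subseteq> L"
    unfolding cyclotomic_field_def by blast
  then show ?thesis
    using x by (auto simp: L_def)
qed

text \<open>The values on all fractions are recorded, not only the one at \<open>zeta m\<close>:
  they define the map, and they evaluate it on sums of roots of unity.\<close>

lemma zeta_automorphism_exists:
  assumes m: "m > 0" and j: "coprime j m"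
  shows "\<exists>\<sigma>. \<sigma> \<in> extensional (cyclotomic_field m) \<and> field_automorphism_on (cyclotomic_field m) \<sigma>
    \<and> (\<forall>f d. d \<noteq> 0 \<longrightarrow> \<sigma> (ipoly_at f (zeta m) / of_int d) = ipoly_at f (zeta m ^ j) / of_int d)"
proof -
  let ?K = "cyclotomic_field m" and ?z = "zeta m"
  \<comment> \<open>The graph of the map; after clearing denominators, \<open>zeta_conjugate\<close>
    shows that it is single valued.\<close>
  define P where "P x y \<longleftrightarrow> (\<exists>f d. d \<noteq> 0 \<and> x = ipoly_at f ?z / of_int d \<and> y = ipoly_at f (?z ^ j) / of_int d)"
    for x y
  define \<sigma> where "\<sigma> x = (if x \<in> ?K then THE y. P x y else undefined)" for x
  have \<sigma>: "\<sigma> (ipoly_at f ?z / of_int d) = ipoly_at f (?z ^ j) / of_int d" if d: "d \<noteq> 0" for f d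
  proof -
    have "(THE y. P (ipoly_at f ?z / of_int d) y) = ipoly_at f (?z ^ j) / of_int d"
    proof (rule the_equality)
      show "P (ipoly_at f ?z / of_int d) (ipoly_at f (?z ^ j) / of_int d)"
        unfolding P_def using d by blast
    next
      fix y assume "P (ipoly_at f ?z / of_int d) y"
      then obtain g e where e: "e \<noteq> 0" and eq: "ipoly_at f ?z / of_int d = ipoly_at g ?z / of_int e"
        and y: "y = ipoly_at g (?z ^ j) / of_int e"
        unfolding P_def by blast
      have "ipoly_at (Polynomial.smult e f) ?z = ipoly_at (Polynomial.smult d g) ?z"
        using d e eq by (simp add: field_simps)
      from zeta_conjugate[OF m j this] show "y = ipoly_at f (?z ^ j) / of_int d"
        using d e by (simp add: y field_simps)
    qed
    moreover have "ipoly_at f ?z / of_int d \<in> ?K"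
      unfolding cyclotomic_field_eq[OF m] using d by blast
    ultimately show ?thesis
      by (simp add: \<sigma>_def)
  qed
  have elem: thesis if "x \<in> ?K" "\<And>f d. \<lbrakk>d \<noteq> 0; x = ipoly_at f ?z / of_int d\<rbrakk> \<Longrightarrow> thesis" for x thesis
    using that unfolding cyclotomic_field_eq[OF m] by blast
  have zj: "?z ^ j = ipoly_at (monom 1 j) ?z"
    by simp
  have into: "\<sigma> x \<in> ?K" if x: "x \<in> ?K" for x
  proof (rule elem[OF x])
    fix f d assume d: "(d :: int) \<noteq> 0" "x = ipoly_at f ?z / of_int d"
    then have "\<sigma> x = ipoly_at (pcompose f (monom 1 j)) ?z / of_int d"
      by (simp add: \<sigma>)
    then show ?thesis
      unfolding cyclotomic_field_eq[OF m] using d by blast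
  qed
  have add: "\<sigma> (x + y) = \<sigma> x + \<sigma> y" and mult: "\<sigma> (x * y) = \<sigma> x * \<sigma> y" if x: "x \<in> ?K" and y: "y \<in> ?K" for x y
  proof -
    obtain f d where f: "d \<noteq> 0" "x = ipoly_at f ?z / of_int d"
      using elem[OF x] by blast
    obtain g e where g: "e \<noteq> 0" "y = ipoly_at g ?z / of_int e"
      using elem[OF y] by blast
    have eq: "ipoly_at f w / of_int d + ipoly_at g w / of_int e
        = ipoly_at (Polynomial.smult e f + Polynomial.smult d g) w / of_int (d * e)" for w
      using f g by (simp add: field_simps)
    have "d * e \<noteq> 0"
      using f g by simp
    then show "\<sigma> (x + y) = \<sigma> x + \<sigma> y"
      unfolding f(2) g(2) \<sigma>[OF f(1)] \<sigma>[OF g(1)] eq by (rule \<sigma>)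
    have "x * y = ipoly_at (f * g) ?z / of_int (d * e)"
      using f g by simp
    then show "\<sigma> (x * y) = \<sigma> x * \<sigma> y"
      using \<sigma>[of "d * e" "f * g"] \<sigma>[of d f] \<sigma>[of e g] f g by simp
  qed
  have K: "1 \<in> ?K" "\<And>u v. \<lbrakk>u \<in> ?K; v \<in> ?K\<rbrakk> \<Longrightarrow> u - v \<in> ?K" "\<And>u. u \<in> ?K \<Longrightarrow> inverse u \<in> ?K"
    using complex_subfield_cyclotomic[of m] unfolding complex_subfield_def by auto
  have one: "\<sigma> 1 = 1"
    using \<sigma>[of 1 1] by simp
  have inj: "inj_on \<sigma> ?K"
  proof (rule inj_onI)
    fix x y assume x: "x \<in> ?K" and y: "y \<in> ?K" and eq: "\<sigma> x = \<sigma> y"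
    have "\<sigma> (x - y) = 0"
      using add[OF K(2)[OF x y] y] eq by simp
    then have "\<sigma> ((x - y) * inverse (x - y)) = 0"
      using mult[OF K(2)[OF x y] K(3)[OF K(2)[OF x y]]] by simp
    then show "x = y"
      using one by (cases "x = y") auto
  qed
  \<comment> \<open>Surjectivity uses an exponent inverse to \<open>j\<close> modulo
    \<open>m\<close>: replacing \<open>zeta m\<close> by \<open>zeta m ^ i\<close> in a fraction
    gives a preimage.\<close>
  obtain i where i: "[j * i = 1] (mod m)"
    using cong_solve_coprime_nat[OF j] by auto
  have zji: "(?z ^ j) ^ i = ?z"
  proof -
    have "?z ^ (j * i) = ?z ^ ((j * i) mod m)"
      using zeta_power[OF m] by (metis mod_mult_div_eq mult.right_neutral power_add power_mult power_one)
    also have "\<dots> = ?z ^ (1 mod m)"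
      using i by (simp add: cong_def)
    \<comment> \<open>For \<open>m = 1\<close> the exponent \<open>1 mod m\<close> is 0, and then
      \<open>zeta m\<close> itself is 1.\<close>
    also have "\<dots> = ?z"
      using zeta_power[OF m] m by (cases "m = 1") auto
    finally show ?thesis
      by (simp add: power_mult)
  qed
  have "?K \<subseteq> \<sigma> ` ?K"
  proof
    fix x assume "x \<in> ?K"
    then show "x \<in> \<sigma> ` ?K"
    proof (rule elem)
      fix f d assume d: "(d :: int) \<noteq> 0" "x = ipoly_at f ?z / of_int d"
      have "x = \<sigma> (ipoly_at (pcompose f (monom 1 i)) ?z / of_int d)"
        unfolding \<sigma>[OF d(1)] using d(2) by (simp add: zji)
      moreover have "ipoly_at (pcompose f (monom 1 i)) ?z / of_int d \<in> ?K"
        unfolding cyclotomic_field_eq[OF m] using d(1) by blast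
      ultimately show ?thesis
        by blast
    qed
  qed
  then have "bij_betw \<sigma> ?K ?K"
    unfolding bij_betw_def using inj into by blast
  then have "field_automorphism_on ?K \<sigma>"
    unfolding field_automorphism_on_def using add mult by blast
  moreover have "\<sigma> \<in> extensional ?K"
    by (simp add: extensional_def \<sigma>_def)
  ultimately show ?thesis
    using \<sigma> by blast
qed

text \<open>Existence and uniqueness make the description in \<open>cyclotomic_aut\<close> proper;
  extensionality upgrades agreement on the field to equality of functions.\<close>

lemma cyclotomic_aut_ipoly_at:
  assumes m: "m > 0" and j: "coprime j m" and d: "d \<noteq> 0"
  shows "cyclotomic_aut j m (ipoly_at f (zeta m) / of_int d) = ipoly_at f (zeta m ^ j) / of_int d"
proof -
  let ?K = "cyclotomic_field m" and ?z = "zeta m"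
  obtain \<sigma> where \<sigma>: "\<sigma> \<in> extensional ?K" "field_automorphism_on ?K \<sigma>"
    "\<And>f d. d \<noteq> 0 \<Longrightarrow> \<sigma> (ipoly_at f ?z / of_int d) = ipoly_at f (?z ^ j) / of_int d"
    using zeta_automorphism_exists[OF m j] by blast
  have \<sigma>z: "\<sigma> ?z = ?z ^ j"
    using \<sigma>(3)[of 1 "monom 1 1"] by simp
  have "cyclotomic_aut j m = \<sigma>"
    unfolding cyclotomic_aut_def
  proof (rule the_equality)
    fix \<tau> assume \<tau>: "\<tau> \<in> extensional ?K \<and> field_automorphism_on ?K \<tau> \<and> \<tau> ?z = ?z ^ j"
    show "\<tau> = \<sigma>"
    proof
      fix x show "\<tau> x = \<sigma> x"
        using field_automorphism_unique[of m \<tau> \<sigma> x] \<tau> \<sigma> \<sigma>z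
        by (cases "x \<in> ?K") (auto simp: extensional_def)
    qed
  qed (use \<sigma> \<sigma>z in blast)
  then show ?thesis
    using \<sigma>(3)[OF d] by simp
qed

text \<open>Each root of unity is a power of \<open>zeta m\<close>, so the sum is the value at
  \<open>zeta m\<close> of a sum of monomials. Summing over an index set \<open>B\<close> allows
  repeated roots, as eigenvalues with multiplicity require.\<close>

lemma cyclotomic_aut_sum_roots:
  assumes m: "m > 0" and j: "coprime j m"
    and B: "finite B" "\<And>v. v \<in> B \<Longrightarrow> l v ^ m = 1"
  shows "(\<Sum>v\<in>B. l v) \<in> cyclotomic_field m"
    and "cyclotomic_aut j m (\<Sum>v\<in>B. l v) = (\<Sum>v\<in>B. l v ^ j)"
proof -
  have "\<forall>v\<in>B. \<exists>i. l v = zeta m ^ i"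
    using root_of_unity_eq_zeta_power[OF m B(2)] by blast
  then obtain i where i: "\<And>v. v \<in> B \<Longrightarrow> l v = zeta m ^ i v"
    by metis
  define f :: "int poly" where "f = (\<Sum>v\<in>B. monom 1 (i v))"
  have f: "ipoly_at f x = (\<Sum>v\<in>B. x ^ i v)" for x
    unfolding f_def by (induction B rule: infinite_finite_induct) auto
  have eq: "(\<Sum>v\<in>B. l v) = ipoly_at f (zeta m) / of_int 1"
    by (simp add: f i)
  show "(\<Sum>v\<in>B. l v) \<in> cyclotomic_field m"
    unfolding eq cyclotomic_field_eq[OF m] by (rule CollectI, rule exI, rule exI) (rule conjI[OF refl], simp)
  show "cyclotomic_aut j m (\<Sum>v\<in>B. l v) = (\<Sum>v\<in>B. l v ^ j)"
    unfolding eq by (subst cyclotomic_aut_ipoly_at[OF m j])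
      (auto simp: f i power_mult[symmetric] mult.commute intro!: sum.cong)
qed

section \<open>Traces and eigenvectors\<close>

text \<open>Orthogonality of the characters of a cyclic group; in
  \<open>trace_funpow_finite_order\<close> it shows that the spectral components of a vector add up
  to a multiple of it.\<close>

lemma sum_root_of_unity:
  assumes "m > 0" "l < m"
  shows "(\<Sum>i<m. (cis (2 * pi / real m) ^ i) ^ l) = (if l = 0 then of_nat m else 0)"
proof (cases "l = 0")
  case False
  let ?z = "cis (2 * pi / real m)"
  have "?z ^ l \<noteq> 1"
  proof
    assume "?z ^ l = 1"
    then have "cis (real l * (2 * pi / real m)) = 1"
      by (simp add: DeMoivre)
    then have "cos (real l * (2 * pi / real m)) = 1"
      by (metis cis.sel(1) one_complex.sel(1))
    then obtain k :: int where "real l * (2 * pi / real m) = of_int k * 2 * pi"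
      using cos_one_2pi_int by blast
    then have "real l = of_int k * real m"
      using assms by (simp add: field_simps)
    then have "int l = k * int m"
      by (metis of_int_eq_iff of_int_mult of_int_of_nat_eq)
    then show False
      using assms False by (metis dvd_triv_right int_dvd_int_iff nat_dvd_not_less neq0_conv)
  qed
  moreover have "(?z ^ l) ^ m = 1"
  proof -
    have "?z ^ m = 1"
      using assms by (simp add: DeMoivre)
    then show ?thesis
      by (metis mult.commute power_mult power_one)
  qed
  ultimately show ?thesis
    using False geometric_sum[of "?z ^ l" m] by (simp add: power_mult[symmetric] mult.commute)
qed simp

locale complex_vector_space = vector_space scale
  for scale :: "complex \<Rightarrow> 'b::ab_group_add \<Rightarrow> 'b"
begin

text \<open>Linearity is asked on \<open>V\<close> only, because the category axioms say nothing
  about composing morphisms of the wrong type.\<close>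

definition lin_endo :: "'b set \<Rightarrow> ('b \<Rightarrow> 'b) \<Rightarrow> bool" where
  "lin_endo V T \<longleftrightarrow> (\<forall>x\<in>V. T x \<in> V) \<and> (\<forall>x\<in>V. \<forall>y\<in>V. T (x + y) = T x + T y)
    \<and> (\<forall>r. \<forall>x\<in>V. T (scale r x) = scale r (T x))"

lemma lin_endoD:
  assumes "lin_endo V T"
  shows "x \<in> V \<Longrightarrow> T x \<in> V" "\<lbrakk>x \<in> V; y \<in> V\<rbrakk> \<Longrightarrow> T (x + y) = T x + T y"
    "x \<in> V \<Longrightarrow> T (scale r x) = scale r (T x)"
  using assms by (auto simp: lin_endo_def)

lemma lin_endo_sum:
  assumes V: "subspace V" and T: "lin_endo V T" and "\<And>i. i \<in> I \<Longrightarrow> v i \<in> V"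
  shows "T (\<Sum>i\<in>I. scale (c i) (v i)) = (\<Sum>i\<in>I. scale (c i) (T (v i)))"
proof -
  have "T 0 = 0"
    using lin_endoD(3)[OF T subspace_0[OF V], of 0] by simp
  with assms(3) show ?thesis
  proof (induction I rule: infinite_finite_induct)
    case (insert i I)
    have "(\<Sum>i\<in>I. scale (c i) (v i)) \<in> V"
      using insert by (intro subspace_sum[OF V] subspace_scale[OF V]) auto
    then show ?case
      using insert subspace_scale[OF V] by (simp add: lin_endoD[OF T])
  qed auto
qed

lemma lin_endo_funpow:
  assumes "lin_endo V T"
  shows "lin_endo V (T ^^ n)"
proof (induction n)
  case 0
  show ?case by (simp add: lin_endo_def)
next
  case (Suc n)
  then show ?case
    using assms by (simp add: lin_endo_def)
qed

text \<open>This is \<open>tr (P Q) = tr (Q P)\<close>: expanding \<open>v\<close> in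
  \<open>B'\<close> on one side and \<open>T w\<close> in \<open>B\<close> on the other turns both
  sums into the same double sum.\<close>

lemma basis_trace_unique:
  assumes T: "lin_endo (span B) T" and B: "independent B" "finite B"
    and B': "independent B'" "finite B'" "span B' = span B"
  shows "(\<Sum>v\<in>B. representation B (T v) v) = (\<Sum>w\<in>B'. representation B' (T w) w)"
proof -
  have 1: "representation B (T v) v = (\<Sum>w\<in>B'. representation B' v w * representation B (T w) v)"
    if "v \<in> B" for v
  proof -
    have v: "v \<in> span B'"
      using that B' by (simp add: span_base)
    have "T v = T (\<Sum>w\<in>B'. scale (representation B' v w) w)"
      using sum_representation_eq[OF B'(1) v B'(2) order_refl] by simp
    also have "\<dots> = (\<Sum>w\<in>B'. scale (representation B' v w) (T w))"
      using span_base[of _ B'] B' by (intro lin_endo_sum[OF subspace_span T]) auto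
    finally show ?thesis
      using span_base[of _ B'] B' B
      by (simp add: representation_sum representation_scale lin_endoD(1)[OF T] span_scale)
  qed
  have 2: "representation B' (T w) w = (\<Sum>v\<in>B. representation B (T w) v * representation B' v w)"
    if "w \<in> B'" for w
  proof -
    have w: "T w \<in> span B"
      using that B' lin_endoD(1)[OF T] by (metis span_base)
    have "T w = (\<Sum>v\<in>B. scale (representation B (T w) v) v)"
      using sum_representation_eq[OF B(1) w B(2) order_refl] by simp
    then have "representation B' (T w) w
        = representation B' (\<Sum>v\<in>B. scale (representation B (T w) v) v) w"
      by simp
    also have "\<dots> = (\<Sum>v\<in>B. representation B (T w) v * representation B' v w)"
      using B' by (simp add: representation_sum representation_scale span_scale span_base)
    finally show ?thesis .
  qed
  have "(\<Sum>v\<in>B. representation B (T v) v)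
      = (\<Sum>v\<in>B. \<Sum>w\<in>B'. representation B' v w * representation B (T w) v)"
    by (simp add: 1)
  also have "\<dots> = (\<Sum>w\<in>B'. \<Sum>v\<in>B. representation B (T w) v * representation B' v w)"
    by (subst sum.swap) (simp add: mult.commute)
  finally show ?thesis
    by (simp add: 2)
qed

lemma trace_on_basis:
  assumes T: "lin_endo V T" and B: "independent B" "finite B" "span B = V"
  shows "trace_on V T = (\<Sum>v\<in>B. representation B (T v) v)"
proof -
  define B' where "B' = (SOME B. independent B \<and> span B = V)"
  have B': "independent B' \<and> span B' = V"
    unfolding B'_def by (rule someI[of _ B]) (use B in blast)
  moreover have "finite B'"
    using independent_span_bound[OF B(2), of B'] B' B(3) span_superset by blast
  ultimately show ?thesis
    using basis_trace_unique[of B T B'] T B by (simp add: trace_on_def B'_def[symmetric])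
qed

text \<open>The maps may differ outside \<open>V\<close>, so the basis chosen by
  \<open>trace_on\<close> must lie in \<open>V\<close>; a basis is produced first to know that the
  choice meets its specification.\<close>

lemma trace_on_cong:
  assumes fin: "finite B0" "span B0 = V" and "\<And>v. v \<in> V \<Longrightarrow> T v = S v"
  shows "trace_on V T = trace_on V S"
proof -
  obtain B1 where "B1 \<subseteq> V" "independent B1" "V \<subseteq> span B1"
    using maximal_independent_subset by blast
  then have "independent B1 \<and> span B1 = V"
    using fin(2) by (metis span_mono span_span subset_antisym)
  then have "span (SOME B. independent B \<and> span B = V) = V"
    using someI[of "\<lambda>B. independent B \<and> span B = V"] by blast
  then have "v \<in> V" if "v \<in> (SOME B. independent B \<and> span B = V)" for v
    using span_base[OF that] by simp
  then show ?thesis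
    using assms(3) unfolding trace_on_def Let_def by (intro sum.cong refl) simp
qed

lemma trace_on_eigenbasis:
  assumes T: "lin_endo V T" and B: "independent B" "finite B" "span B = V"
    and eig: "\<And>v. v \<in> B \<Longrightarrow> T v = scale (\<mu> v) v"
  shows "trace_on V (T ^^ j) = (\<Sum>v\<in>B. \<mu> v ^ j)"
proof -
  have "(T ^^ j) v = scale (\<mu> v ^ j) v" if "v \<in> B" for v
    using that B span_base[of v B]
    by (induction j) (auto simp: lin_endoD(3)[OF T] eig mult.commute)
  then show ?thesis
    using B span_base[of _ B]
    by (simp add: trace_on_basis[OF lin_endo_funpow[OF T] B] representation_scale
        representation_basis)
qed

lemma eigenbasis_exists:
  assumes V: "finite B0" "span B0 = V"
    and E: "E \<subseteq> V" "V \<subseteq> span E"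
  obtains B where "B \<subseteq> E" "independent B" "finite B" "span B = V"
proof -
  obtain B where B: "B \<subseteq> E" "independent B" "E \<subseteq> span B"
    using maximal_independent_subset[of E] by blast
  have "span B = V"
    using B E V by (metis span_mono span_span subset_antisym)
  moreover have "finite B"
    using independent_span_bound[OF V(1) B(2)] B E V by blast
  ultimately show ?thesis
    using that B by blast
qed

lemma span_image_finite:
  assumes "x \<in> span (f ` I)" and I: "finite I"
  shows "\<exists>c. x = (\<Sum>i\<in>I. scale (c i) (f i))"
  using assms(1)
proof (induction rule: span_induct_alt)
  case base
  show ?case by (rule exI[of _ "\<lambda>_. 0"]) simp
next
  case (step a y z)
  then obtain i c where i: "i \<in> I" "y = f i" and c: "z = (\<Sum>i\<in>I. scale (c i) (f i))"
    by auto
  have "scale a y + z = (\<Sum>j\<in>I. scale ((if j = i then a else 0) + c j) (f j))"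
    using i I by (simp add: c scale_left_distrib sum.distrib if_distrib[of "\<lambda>u. scale u _"] sum.delta cong: if_cong)
  then show ?case
    by (rule exI[of _ "\<lambda>j. (if j = i then a else 0) + c j"])
qed

lemma finite_dim_relation:
  fixes f :: "nat \<Rightarrow> 'b"
  assumes B0: "finite B0" "span B0 = V" and f: "\<And>i. f i \<in> V"
  shows "\<exists>k. f k \<in> span (f ` {..<k})"
proof (rule ccontr)
  assume "\<nexists>k. f k \<in> span (f ` {..<k})"
  then have no: "f k \<notin> span (f ` {..<k})" for k
    by blast
  have ind: "independent (f ` {..<k}) \<and> card (f ` {..<k}) = k" for k
  proof (induction k)
    case 0
    show ?case by (simp add: independent_empty)
  next
    case (Suc k)
    have "f k \<notin> f ` {..<k}"
      using no[of k] span_base[of "f k" "f ` {..<k}"] by metis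
    moreover have "independent (insert (f k) (f ` {..<k}))"
      using Suc no[of k] by (intro independent_insertI) blast+
    ultimately show ?case
      using Suc unfolding lessThan_Suc image_insert by (simp del: independent_insert)
  qed
  have "card (f ` {..<Suc (card B0)}) \<le> card B0"
    using independent_span_bound[OF B0(1), of "f ` {..<Suc (card B0)}"] ind f B0(2) by blast
  then show False
    using ind[of "Suc (card B0)"] by simp
qed

text \<open>A nonzero polynomial of least degree annihilating \<open>v0\<close> has a root
  \<open>z\<close>. Dividing by the linear factor of \<open>z\<close> leaves a polynomial
  \<open>q\<close> that, by minimality, does not annihilate \<open>v0\<close>; applied to
  \<open>v0\<close> it gives the eigenvector.\<close>

lemma eigenvector_exists:
  assumes B0: "finite B0" "span B0 = V"
    and T: "lin_endo V T" and v0: "v0 \<in> V" "v0 \<noteq> 0"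
  shows "\<exists>z w. w \<in> V \<and> w \<noteq> 0 \<and> T w = scale z w"
proof -
  have V: "subspace V"
    using B0 subspace_span by blast
  have Tn: "(T ^^ i) v0 \<in> V" for i
    using lin_endoD(1)[OF lin_endo_funpow[OF T]] v0 by blast
  \<comment> \<open>\<open>P p\<close> is the polynomial \<open>p\<close> in the operator
    \<open>T\<close>, applied to \<open>v0\<close>; the next fact allows padding with zero
    coefficients.\<close>
  define P where "P p = (\<Sum>i\<le>degree p. scale (coeff p i) ((T ^^ i) v0))" for p
  have P: "P p = (\<Sum>i\<le>n. scale (coeff p i) ((T ^^ i) v0))" if "degree p \<le> n" for p n
    unfolding P_def using that by (intro sum.mono_neutral_left) (auto simp: coeff_eq_0)
  obtain k where "(T ^^ k) v0 \<in> span ((\<lambda>i. (T ^^ i) v0) ` {..<k})"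
    using finite_dim_relation[OF B0, of "\<lambda>i. (T ^^ i) v0"] Tn by blast
  then obtain c where c: "(T ^^ k) v0 = (\<Sum>i<k. scale (c i) ((T ^^ i) v0))"
    using span_image_finite[OF _ finite_lessThan] by blast
  define p where "p = monom 1 k - (\<Sum>i<k. monom (c i) i)"
  have cp: "coeff p i = (if i = k then 1 else if i < k then - c i else 0)" for i
    by (simp add: p_def coeff_sum sum.delta cong: if_cong)
  have "degree p \<le> k"
    by (rule degree_le) (simp add: cp)
  then have "P p = 0"
    using P[of p k] by (simp add: cp lessThan_Suc_atMost[symmetric] c sum_negf)
  moreover have "p \<noteq> 0"
    using cp[of k] by auto
  ultimately have "\<exists>p. p \<noteq> 0 \<and> P p = 0"
    by blast
  then obtain p where p: "p \<noteq> 0" "P p = 0" and min: "\<And>q. q \<noteq> 0 \<and> P q = 0 \<Longrightarrow> degree p \<le> degree q"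
    using ex_has_least_nat[of "\<lambda>p. p \<noteq> 0 \<and> P p = 0" _ degree] by blast
  have "degree p \<noteq> 0"
  proof
    assume "degree p = 0"
    then show False
      using p v0 leading_coeff_0_iff[of p] by (simp add: P_def)
  qed
  then have "\<not> constant (poly p)"
    by (simp add: constant_degree)
  then obtain z where "poly p z = 0"
    using fundamental_theorem_of_algebra by blast
  then obtain q where q: "p = [:-z, 1:] * q"
    by (metis dvdE poly_eq_0_iff_dvd)
  have q0: "q \<noteq> 0"
    using q p by auto
  have deg: "degree p = Suc (degree q)"
    unfolding q using q0 by (subst degree_mult_eq) auto
  define w where "w = P q"
  have "w \<noteq> 0"
    using min[of q] q0 deg by (auto simp: w_def)
  have wV: "w \<in> V"
    unfolding w_def P_def by (intro subspace_sum[OF V] subspace_scale[OF V] Tn)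
  have "T w = (\<Sum>i\<le>degree q. scale (coeff q i) (T ((T ^^ i) v0)))"
    unfolding w_def P_def by (rule lin_endo_sum[OF V T]) (rule Tn)
  also have "\<dots> = (\<Sum>i\<le>Suc (degree q). scale (coeff (pCons 0 q) i) ((T ^^ i) v0))"
    by (simp del: sum.atMost_Suc add: sum.atMost_Suc_shift)
  finally have Tw: "T w = (\<Sum>i\<le>Suc (degree q). scale (coeff (pCons 0 q) i) ((T ^^ i) v0))" .
  have w: "w = (\<Sum>i\<le>Suc (degree q). scale (coeff q i) ((T ^^ i) v0))"
    unfolding w_def by (rule P) simp
  have "T w - scale z w = (\<Sum>i\<le>Suc (degree q). scale (coeff (pCons 0 q - Polynomial.smult z q) i) ((T ^^ i) v0))"
    by (subst (2) w, subst Tw)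
      (simp only: scale_sum_right scale_scale sum_subtractf[symmetric] scale_left_diff_distrib[symmetric]
        coeff_diff coeff_smult)
  also have "pCons 0 q - Polynomial.smult z q = p"
    by (simp add: q)
  also have "(\<Sum>i\<le>Suc (degree q). scale (coeff p i) ((T ^^ i) v0)) = 0"
    using p(2) by (simp add: P_def deg)
  finally show ?thesis
    using wV \<open>w \<noteq> 0\<close> by (intro exI[of _ z] exI[of _ w]) simp
qed

text \<open>The operator \<open>s\<close> times \<open>S\<close> has order dividing
  \<open>m\<close>, so \<open>V\<close> splits into eigenspaces by discrete Fourier averaging. A
  single eigenbasis \<open>B\<close> gives the traces of all powers at once, which is what links the
  two sides of the Galois formula.\<close>

lemma trace_funpow_finite_order:
  assumes B0: "finite B0" "span B0 = V"
    and S: "lin_endo V S" and m: "m > 0"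
    and order: "\<And>v. v \<in> V \<Longrightarrow> scale (s ^ m) ((S ^^ m) v) = v" and s: "s \<noteq> 0"
  shows "\<exists>(B :: 'b set) \<mu>. finite B \<and> (\<forall>v\<in>B. (s * \<mu> v) ^ m = 1) \<and>
    (\<forall>j. trace_on V (S ^^ j) = (\<Sum>v\<in>B. \<mu> v ^ j))"
proof -
  have V: "subspace V"
    using B0 subspace_span by blast
  have Sn: "(S ^^ i) v \<in> V" if "v \<in> V" for i v
    using lin_endoD(1)[OF lin_endo_funpow[OF S]] that by blast
  define z where "z = cis (2 * pi / real m)"
  have zm: "z ^ m = 1" and z0: "z \<noteq> 0"
    using m by (auto simp: z_def DeMoivre)
  define E where "E = {v \<in> V. \<exists>\<mu>. S v = scale \<mu> v \<and> (s * \<mu>) ^ m = 1}"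
  have "V \<subseteq> span E"
  proof
    fix v assume v: "v \<in> V"
    \<comment> \<open>Up to the factor \<open>m\<close>, the sum \<open>w i\<close> of these terms
      is the component of \<open>v\<close> for the eigenvalue \<open>z ^ i / s\<close>.\<close>
    define f where "f i l = scale ((s / z ^ i) ^ l) ((S ^^ l) v)" for i l
    define w where "w i = (\<Sum>l<m. f i l)" for i
    have fV: "f i l \<in> V" for i l
      unfolding f_def by (intro subspace_scale[OF V] Sn v)
    have wV: "w i \<in> V" for i
      unfolding w_def by (intro subspace_sum[OF V] fV)
    have "w i \<in> E" for i
    proof -
      \<comment> \<open>The summands wrap around at \<open>l = m\<close>, so shifting the index
        leaves the sum unchanged.\<close>
      have "f i m = f i 0"
        using order[OF v] zm by (simp add: f_def power_divide power_mult[symmetric] mult.commute[of i])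
          (simp add: power_mult)
      then have "(\<Sum>l<m. f i (Suc l)) = w i"
        unfolding w_def using sum.lessThan_Suc_shift[of "f i" m] sum.lessThan_Suc[of "f i" m]
        by (metis add.commute add_left_cancel)
      moreover have "S (w i) = scale (z ^ i / s) (\<Sum>l<m. f i (Suc l))"
        unfolding w_def f_def scale_sum_right
        by (subst lin_endo_sum[OF V S]) (use s z0 Sn[OF v] in \<open>auto simp: field_simps\<close>)
      ultimately have "S (w i) = scale (z ^ i / s) (w i)"
        by simp
      moreover have "(s * (z ^ i / s)) ^ m = 1"
        using s zm by (simp add: power_mult[symmetric] mult.commute[of i]) (simp add: power_mult)
      ultimately show ?thesis
        using wV unfolding E_def by blast
    qed
    then have "(\<Sum>i<m. w i) \<in> span E"
      by (intro span_sum span_base)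
    also have "(\<Sum>i<m. w i) = (\<Sum>l<m. scale ((\<Sum>i<m. (1 / z ^ i) ^ l) * s ^ l) ((S ^^ l) v))"
      unfolding w_def f_def sum_distrib_right scale_sum_left
      by (subst sum.swap) (simp add: power_divide)
    also have "\<dots> = (\<Sum>l<m. if l = 0 then scale (of_nat m) v else 0)"
    proof (rule sum.cong[OF refl])
      fix l assume l: "l \<in> {..<m}"
      have "(\<Sum>i<m. (1 / z ^ i) ^ l) = cnj (\<Sum>i<m. (z ^ i) ^ l)"
      proof -
        have "1 / z = cnj z"
          by (simp add: z_def cis_cnj divide_inverse)
        then have "(1 / z ^ i) ^ l = cnj ((z ^ i) ^ l)" for i
          by (metis complex_cnj_power power_one_over)
        then show ?thesis
          by simp
      qed
      also have "\<dots> = (if l = 0 then of_nat m else 0)"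
        using sum_root_of_unity[OF m, of l] l by (simp add: z_def)
      finally show "scale ((\<Sum>i<m. (1 / z ^ i) ^ l) * s ^ l) ((S ^^ l) v)
          = (if l = 0 then scale (of_nat m) v else 0)"
        by simp
    qed
    also have "\<dots> = scale (of_nat m) v"
      using m by simp
    finally have "scale (1 / of_nat m) (scale (of_nat m) v) \<in> span E"
      by (rule span_scale)
    then show "v \<in> span E"
      using m by simp
  qed
  moreover have "E \<subseteq> V"
    by (auto simp: E_def)
  ultimately obtain B where B: "B \<subseteq> E" "independent B" "finite B" "span B = V"
    using eigenbasis_exists[OF B0] by metis
  then have "\<forall>v\<in>B. \<exists>\<mu>. S v = scale \<mu> v \<and> (s * \<mu>) ^ m = 1"
    unfolding E_def by blast
  then obtain \<mu> where \<mu>: "\<And>v. v \<in> B \<Longrightarrow> S v = scale (\<mu> v) v \<and> (s * \<mu> v) ^ m = 1"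
    by metis
  show ?thesis
    using trace_on_eigenbasis[OF S B(2-4)] \<mu> B(3) by (intro exI[of _ B] exI[of _ \<mu>]) auto
qed

end

section \<open>Diagram calculus in strict pivotal categories\<close>

text \<open>Hom spaces may overlap, so a bare morphism does not determine its source and target.
  Arrows carry both, which lets simplification check composability.\<close>

datatype ('o, 'm) arrow = Arrow (src: 'o) (mor: 'm) (tgt: 'o)

context strict_monoidal_category
begin

definition arr :: "('o, 'm) arrow \<Rightarrow> bool" where
  "arr f \<longleftrightarrow> src f \<in> Ob C \<and> tgt f \<in> Ob C \<and> mor f \<in> Hom C (src f) (tgt f)"

definition comp :: "('o, 'm) arrow \<Rightarrow> ('o, 'm) arrow \<Rightarrow> ('o, 'm) arrow" (infixr \<open>\<star>\<close> 55) where
  "g \<star> f = Arrow (src f) (mor g \<cdot> mor f) (tgt g)"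

definition ide :: "'o \<Rightarrow> ('o, 'm) arrow" where
  "ide x = Arrow x (\<I> x) x"

text \<open>Diagrams are written as composites of slices, each a single arrow between identity
  strands; a tensor product of two arrows becomes two slices.\<close>

definition whisk :: "'o \<Rightarrow> ('o, 'm) arrow \<Rightarrow> 'o \<Rightarrow> ('o, 'm) arrow" where
  "whisk x f y = Arrow (x \<odot> src f \<odot> y) (\<I> x \<boxtimes> mor f \<boxtimes> \<I> y) (x \<odot> tgt f \<odot> y)"

declare unit_Ob [simp] tensO_Ob [simp] tensO_unit_left [simp] tensO_unit_right [simp]
  tensO_assoc [simp]

lemma arr_Ob [simp]: "arr f \<Longrightarrow> src f \<in> Ob C" "arr f \<Longrightarrow> tgt f \<in> Ob C"
  by (auto simp: arr_def)

lemma arrow_proj [simp]: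
  "src (g \<star> f) = src f" "tgt (g \<star> f) = tgt g" "mor (g \<star> f) = mor g \<cdot> mor f"
  "src (ide x) = x" "tgt (ide x) = x" "mor (ide x) = \<I> x"
  "src (whisk x f y) = x \<odot> src f \<odot> y" "tgt (whisk x f y) = x \<odot> tgt f \<odot> y"
  by (auto simp: comp_def ide_def whisk_def)

lemma arr_comp [simp]: "\<lbrakk>arr g; arr f; src g = tgt f\<rbrakk> \<Longrightarrow> arr (g \<star> f)"
  unfolding arr_def by (simp, rule cmp_Hom[of _ "tgt f"]) auto

lemma arr_ide [simp]: "x \<in> Ob C \<Longrightarrow> arr (ide x)"
  by (simp add: arr_def id_Hom)

lemma arr_mor: "arr f \<Longrightarrow> mor f \<in> Hom C (src f) (tgt f)"
  unfolding arr_def by blast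

lemma tens_id_Hom:
  "\<lbrakk>arr f; y \<in> Ob C\<rbrakk> \<Longrightarrow> mor f \<boxtimes> \<I> y \<in> Hom C (src f \<odot> y) (tgt f \<odot> y)"
  by (rule tensM_Hom[OF _ _ _ _ arr_mor id_Hom]) simp_all

lemma id_tens_Hom:
  "\<lbrakk>arr f; x \<in> Ob C\<rbrakk> \<Longrightarrow> \<I> x \<boxtimes> mor f \<in> Hom C (x \<odot> src f) (x \<odot> tgt f)"
  by (rule tensM_Hom[OF _ _ _ _ id_Hom arr_mor]) simp_all

lemma arr_whisk [simp]:
  assumes "arr f" "x \<in> Ob C" "y \<in> Ob C"
  shows "arr (whisk x f y)"
  using assms tensM_Hom[OF _ _ _ _ id_Hom tens_id_Hom, of x f y] unfolding arr_def[of "whisk x f y"]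
  by (simp add: whisk_def)

lemma comp_ide [simp]:
  "\<lbrakk>arr f; src f = x\<rbrakk> \<Longrightarrow> f \<star> ide x = f" "\<lbrakk>arr f; tgt f = x\<rbrakk> \<Longrightarrow> ide x \<star> f = f"
  using cmp_id_right[OF _ _ arr_mor, of f] cmp_id_left[OF _ _ arr_mor, of f]
  by (auto intro: arrow.expand)

lemma arrow_comp_assoc [simp]:
  "\<lbrakk>arr h; arr g; arr f; src h = tgt g; src g = tgt f\<rbrakk> \<Longrightarrow> (h \<star> g) \<star> f = h \<star> g \<star> f"
  unfolding arr_def comp_def
  by (simp, rule cmp_assoc[of "src f" "tgt f" "tgt g" "tgt h"]) auto

text \<open>Composites are normalised to nest to the right, where \<open>g \<star> f\<close> is no
  longer a subterm once another arrow precedes it; this form of an equation has a tail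
  \<open>z\<close>.\<close>

lemma comp_reassoc:
  "\<lbrakk>g \<star> f = h; arr g; arr f; src g = tgt f; arr z; tgt z = src f\<rbrakk> \<Longrightarrow> g \<star> f \<star> z = h \<star> z"
  using arrow_comp_assoc[of g f z] by simp

lemma whisk_comp [simp]:
  assumes A: "arr g" "arr f" "src g = tgt f" and xy: "x \<in> Ob C" "y \<in> Ob C"
  shows "whisk x (g \<star> f) y = whisk x g y \<star> whisk x f y"
proof -
  have F: "mor f \<in> Hom C (src f) (src g)" "mor g \<in> Hom C (src g) (tgt g)"
    "src f \<in> Ob C" "src g \<in> Ob C" "tgt g \<in> Ob C"
    using arr_mor[of f] arr_mor[of g] A by simp_all
  have 1: "(mor g \<cdot> mor f) \<boxtimes> \<I> y = (mor g \<boxtimes> \<I> y) \<cdot> (mor f \<boxtimes> \<I> y)"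
    using tensM_cmp[OF F(3,4,5) xy(2,2,2) F(1,2) id_Hom id_Hom] xy
    by (simp add: cmp_id_left[OF _ _ id_Hom])
  have 2: "mor f \<boxtimes> \<I> y \<in> Hom C (src f \<odot> y) (src g \<odot> y)"
      "mor g \<boxtimes> \<I> y \<in> Hom C (src g \<odot> y) (tgt g \<odot> y)"
    using tens_id_Hom[of f y] tens_id_Hom[of g y] A xy by simp_all
  have "\<I> x \<boxtimes> ((mor g \<boxtimes> \<I> y) \<cdot> (mor f \<boxtimes> \<I> y))
    = (\<I> x \<boxtimes> mor g \<boxtimes> \<I> y) \<cdot> (\<I> x \<boxtimes> mor f \<boxtimes> \<I> y)"
    using tensM_cmp[OF xy(1,1,1) _ _ _ id_Hom id_Hom 2] xy F
    by (simp add: cmp_id_left[OF _ _ id_Hom])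
  then show ?thesis
    by (simp add: comp_def whisk_def 1)
qed

lemma whisk_whisk [simp]:
  assumes f: "arr f" and O: "x \<in> Ob C" "y \<in> Ob C" "x' \<in> Ob C" "y' \<in> Ob C"
  shows "whisk x (whisk x' f y') y = whisk (x \<odot> x') f (y' \<odot> y)"
proof -
  have "(\<I> x' \<boxtimes> mor f \<boxtimes> \<I> y') \<boxtimes> \<I> y = \<I> x' \<boxtimes> (mor f \<boxtimes> \<I> y') \<boxtimes> \<I> y"
    by (rule tensM_assoc[OF _ _ _ _ _ _ id_Hom tens_id_Hom id_Hom]) (use f O in simp_all)
  also have "(mor f \<boxtimes> \<I> y') \<boxtimes> \<I> y = mor f \<boxtimes> \<I> (y' \<odot> y)"
    using tensM_assoc[OF _ _ _ _ _ _ arr_mor id_Hom id_Hom, of f y' y] f O by (simp add: tensM_id)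
  finally have "\<I> x \<boxtimes> (\<I> x' \<boxtimes> mor f \<boxtimes> \<I> y') \<boxtimes> \<I> y = \<I> x \<boxtimes> \<I> x' \<boxtimes> mor f \<boxtimes> \<I> (y' \<odot> y)"
    by simp
  also have "\<dots> = (\<I> x \<boxtimes> \<I> x') \<boxtimes> mor f \<boxtimes> \<I> (y' \<odot> y)"
    by (rule tensM_assoc[OF _ _ _ _ _ _ id_Hom id_Hom tens_id_Hom, symmetric]) (use f O in simp_all)
  finally show ?thesis
    using f O by (simp add: whisk_def tensM_id)
qed

lemma mor_whisk:
  "mor (whisk x f y) = \<I> x \<boxtimes> mor f \<boxtimes> \<I> y"
  "\<lbrakk>arr f; x \<in> Ob C\<rbrakk> \<Longrightarrow> mor (whisk x f \<u>) = \<I> x \<boxtimes> mor f"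
  "\<lbrakk>arr f; y \<in> Ob C\<rbrakk> \<Longrightarrow> mor (whisk \<u> f y) = mor f \<boxtimes> \<I> y"
  using tensM_unit_left[OF _ _ tens_id_Hom, of f y] tensM_unit_right[OF _ _ arr_mor, of f]
  by (simp_all add: whisk_def)

lemma whisk_unit [simp]: "arr f \<Longrightarrow> whisk \<u> f \<u> = f"
  using tensM_unit_left[OF _ _ arr_mor, of f]
  by (intro arrow.expand) (simp add: mor_whisk(2))

lemma whisk_ide [simp]: "\<lbrakk>x \<in> Ob C; y \<in> Ob C; z \<in> Ob C\<rbrakk> \<Longrightarrow> whisk x (ide z) y = ide (x \<odot> z \<odot> y)"
  by (simp add: whisk_def ide_def tensM_id)

text \<open>Both composites are the tensor product of \<open>f\<close> with the whiskered
  \<open>g\<close>: disjoint strands may be processed in either order. The object \<open>z\<close>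
  is the strand between them.\<close>

lemma interchange:
  assumes f: "arr f" and g: "arr g" and x: "x \<in> Ob C" and z: "z \<in> Ob C" and y: "y \<in> Ob C"
  shows "whisk x f (z \<odot> tgt g \<odot> y) \<star> whisk (x \<odot> src f \<odot> z) g y
    = whisk (x \<odot> tgt f \<odot> z) g y \<star> whisk x f (z \<odot> src g \<odot> y)"
proof -
  define g' where "g' = whisk z g y"
  have g': "arr g'" "src g' = z \<odot> src g \<odot> y" "tgt g' = z \<odot> tgt g \<odot> y"
    using assms by (auto simp: g'_def)
  have *: "whisk \<u> f (tgt g') \<star> whisk (src f) g' \<u> = whisk (tgt f) g' \<u> \<star> whisk \<u> f (src g')"
  proof -
    have F: "mor f \<in> Hom C (src f) (tgt f)" "mor g' \<in> Hom C (src g') (tgt g')"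
      "src f \<in> Ob C" "tgt f \<in> Ob C" "src g' \<in> Ob C" "tgt g' \<in> Ob C"
      using arr_mor[OF f] arr_mor[OF g'(1)] f g'(1) by simp_all
    have "(mor f \<boxtimes> \<I> (tgt g')) \<cdot> (\<I> (src f) \<boxtimes> mor g')
      = (\<I> (tgt f) \<boxtimes> mor g') \<cdot> (mor f \<boxtimes> \<I> (src g'))"
      using tensM_cmp[OF F(3,3,4,5,6,6) id_Hom F(1,2) id_Hom]
        tensM_cmp[OF F(3,4,4,5,5,6) F(1) id_Hom id_Hom F(2)] F
      by (simp add: cmp_id_left[OF _ _ F(1)] cmp_id_left[OF _ _ F(2)] cmp_id_right[OF _ _ F(1)] cmp_id_right[OF _ _ F(2)])
    then show ?thesis
      using f g'(1) F(3-6) by (intro arrow.expand) (simp add: mor_whisk(2,3))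
  qed
  show ?thesis
    using arg_cong[OF *, of "\<lambda>h. whisk x h \<u>"] assms g' unfolding g'_def by simp
qed

end

context strict_pivotal_category
begin

declare dual_Ob [simp] dual_dual [simp]

definition EV :: "'a \<Rightarrow> ('a, 'b) arrow" where
  "EV x = Arrow (dual C x \<odot> x) (ev C x) \<u>"

definition COEV :: "'a \<Rightarrow> ('a, 'b) arrow" where
  "COEV x = Arrow \<u> (coev C x) (x \<odot> dual C x)"

lemma EV_proj [simp]:
  "src (EV x) = dual C x \<odot> x" "tgt (EV x) = \<u>" "mor (EV x) = ev C x"
  "src (COEV x) = \<u>" "tgt (COEV x) = x \<odot> dual C x" "mor (COEV x) = coev C x"
  by (simp_all add: EV_def COEV_def)

lemma arr_EV [simp]: "x \<in> Ob C \<Longrightarrow> arr (EV x)" "x \<in> Ob C \<Longrightarrow> arr (COEV x)"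
  unfolding arr_def by (simp_all add: ev_Hom coev_Hom)

lemma snake:
  assumes x: "x \<in> Ob C"
  shows "whisk x (EV x) \<u> \<star> whisk \<u> (COEV x) x = ide x"
    and "whisk \<u> (EV x) (dual C x) \<star> whisk (dual C x) (COEV x) \<u> = ide (dual C x)"
  using x by (auto intro!: arrow.expand simp: mor_whisk(2,3) zigzag zigzag_dual)

lemma snake_whisk:
  assumes x: "x \<in> Ob C" and pq: "p \<in> Ob C" "q \<in> Ob C"
  shows "whisk (p \<odot> x) (EV x) q \<star> whisk p (COEV x) (x \<odot> q) = ide (p \<odot> x \<odot> q)"
    and "whisk p (EV x) (dual C x \<odot> q) \<star> whisk (p \<odot> dual C x) (COEV x) q = ide (p \<odot> dual C x \<odot> q)"
    and "whisk (p \<odot> dual C x) (EV (dual C x)) q \<star> whisk p (COEV (dual C x)) (dual C x \<odot> q)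
      = ide (p \<odot> dual C x \<odot> q)"
    and "whisk p (EV (dual C x)) (x \<odot> q) \<star> whisk (p \<odot> x) (COEV (dual C x)) q = ide (p \<odot> x \<odot> q)"
  using snake[of x, THEN arg_cong, of "\<lambda>h. whisk p h q"]
    snake[of "dual C x", THEN arg_cong, of "\<lambda>h. whisk p h q"] assms by auto

text \<open>An arrow into the unit is recovered from its transpose by evaluation:
  \<open>EV b\<close> slides past \<open>M\<close>, and the remaining zigzag straightens.\<close>

lemma transpose_ev:
  assumes M: "arr M" "src M = p \<odot> b" "tgt M = \<u>" and O: "p \<in> Ob C" "b \<in> Ob C"
  shows "EV b \<star> whisk \<u> (whisk \<u> M (dual C b) \<star> whisk p (COEV b) \<u>) b = M"
proof -
  have 1: "EV b \<star> whisk \<u> M (dual C b \<odot> b) = M \<star> whisk (p \<odot> b) (EV b) \<u>"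
    using interchange[of M "EV b" \<u> \<u> \<u>] M O by simp
  have 2: "whisk (p \<odot> b) (EV b) \<u> \<star> whisk p (COEV b) b = ide (p \<odot> b)"
    using snake_whisk(1)[of b p \<u>] O by simp
  show ?thesis
    using M O by (simp add: 1 2 comp_reassoc[OF 1] comp_reassoc[OF 2])
qed

text \<open>The counterpart for the transpose on the other side, tested on a map \<open>K\<close>
  out of the unit, which slides past the coevaluation.\<close>

lemma transpose_coev:
  assumes M: "arr M" "src M = b \<odot> q" "tgt M = \<u>"
    and K: "arr K" "src K = \<u>" "tgt K = q \<odot> y"
    and O: "q \<in> Ob C" "b \<in> Ob C" "y \<in> Ob C"
  shows "whisk \<u> (whisk (dual C b) M \<u> \<star> whisk \<u> (COEV (dual C b)) q) y \<star> K
    = whisk (dual C b) (whisk \<u> M y \<star> whisk b K \<u>) \<u> \<star> COEV (dual C b)"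
proof -
  have 1: "whisk \<u> (COEV (dual C b)) (q \<odot> y) \<star> K
      = whisk (dual C b \<odot> b) K \<u> \<star> COEV (dual C b)"
    using interchange[of "COEV (dual C b)" K \<u> \<u> \<u>] K O by simp
  show ?thesis
    using M K O by (simp add: 1)
qed

text \<open>The canonical map \<open>u\<close> stands in for an equality between the dual of a
  tensor product and the product of the duals. Its definition as a left transpose gives the identity
  for \<open>EV\<close>; \<open>pivotal_monoidal\<close> rewrites it as a right transpose, and that
  gives the identity for \<open>COEV\<close>.\<close>

lemma dual_tensor_comparison:
  assumes O: "x \<in> Ob C" "y \<in> Ob C"
  obtains u where "arr u" "src u = dual C y \<odot> dual C x" "tgt u = dual C (x \<odot> y)"
    and "EV (x \<odot> y) \<star> whisk \<u> u (x \<odot> y) = EV y \<star> whisk (dual C y) (EV x) y"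
    and "whisk \<u> u (x \<odot> y) \<star> whisk (dual C y) (COEV (dual C x)) y \<star> COEV (dual C y)
      = COEV (dual C (x \<odot> y))"
proof -
  let ?x = "dual C x" and ?y = "dual C y" and ?d = "dual C (x \<odot> y)"
  define N where "N = EV y \<star> whisk ?y (EV x) y"
  define N' where "N' = EV ?x \<star> whisk x (EV ?y) ?x"
  define K where "K = whisk ?y (COEV ?x) y \<star> COEV ?y"
  have N: "arr N" "src N = (?y \<odot> ?x) \<odot> (x \<odot> y)" "tgt N = \<u>"
    and N': "arr N'" "src N' = (x \<odot> y) \<odot> (?y \<odot> ?x)" "tgt N' = \<u>"
    and K: "arr K" "src K = \<u>" "tgt K = (?y \<odot> ?x) \<odot> (x \<odot> y)"
    using O by (simp_all add: N_def N'_def K_def)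
  define u where "u = whisk \<u> N ?d \<star> whisk (?y \<odot> ?x) (COEV (x \<odot> y)) \<u>"
  have "mor (whisk \<u> N ?d) = (ev C y \<cdot> (\<I> ?y \<boxtimes> ev C x \<boxtimes> \<I> y)) \<boxtimes> \<I> ?d"
    using mor_whisk(3)[OF N(1), of ?d] O by (simp add: N_def mor_whisk(1))
  moreover have "mor (whisk ?d N' \<u>) = \<I> ?d \<boxtimes> (ev C ?x \<cdot> (\<I> x \<boxtimes> ev C ?y \<boxtimes> \<I> ?x))"
    using mor_whisk(2)[OF N'(1), of ?d] O by (simp add: N'_def mor_whisk(1))
  ultimately have u': "u = whisk ?d N' \<u> \<star> whisk \<u> (COEV ?d) (?y \<odot> ?x)"
    using pivotal_monoidal[OF O] O N N' unfolding u_def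
    by (intro arrow.expand) (simp add: mor_whisk(2)[of "COEV _"] mor_whisk(3)[of "COEV _"])
  have 1: "EV (x \<odot> y) \<star> whisk \<u> u (x \<odot> y) = N"
    unfolding u_def by (rule transpose_ev) (use N O in simp_all)
  have 2: "whisk x (EV ?y) (?x \<odot> x \<odot> y) \<star> whisk (x \<odot> y \<odot> ?y) (COEV ?x) y
      = whisk x (COEV ?x) y \<star> whisk x (EV ?y) y"
    using interchange[of "EV ?y" "COEV ?x" x \<u> y] O by simp
  have 3: "whisk x (EV ?y) y \<star> whisk (x \<odot> y) (COEV ?y) \<u> = ide (x \<odot> y)"
    using snake_whisk(4)[of y x \<u>] O by simp
  have 4: "whisk \<u> (EV ?x) (x \<odot> y) \<star> whisk x (COEV ?x) y = ide (x \<odot> y)"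
    using snake_whisk(4)[of x \<u> y] O by simp
  have "whisk \<u> N' (x \<odot> y) \<star> whisk (x \<odot> y) K \<u> = ide (x \<odot> y)"
    unfolding N'_def K_def using O by (simp add: comp_reassoc[OF 2] 3 4)
  then have 5: "whisk \<u> u (x \<odot> y) \<star> K = COEV ?d"
    using transpose_coev[OF N' K] O unfolding u' by simp
  show ?thesis
    by (rule that[of u]) (use 1 5 N O in \<open>simp_all add: u_def N_def K_def\<close>)
qed

text \<open>\<open>h\<close> is the dual morphism of \<open>f\<close>. One formula for it yields the
  identity with evaluations, the other the one with coevaluations, and
  \<open>pivotal_natural\<close> says that the two formulas agree.\<close>

lemma dual_arrow:
  assumes f: "arr f"
  obtains h where "arr h" "src h = dual C (tgt f)" "tgt h = dual C (src f)"
    and "EV (src f) \<star> whisk \<u> h (src f) = EV (tgt f) \<star> whisk (dual C (tgt f)) f \<u>"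
    and "whisk \<u> h (tgt f) \<star> COEV (dual C (tgt f)) = whisk (dual C (src f)) f \<u> \<star> COEV (dual C (src f))"
proof -
  define a b where ab: "a = src f" "b = tgt f"
  have f': "arr f" "src f = a" "tgt f = b" and O: "a \<in> Ob C" "b \<in> Ob C"
    using f by (auto simp: ab)
  let ?a = "dual C a" and ?b = "dual C b"
  define M where "M = EV b \<star> whisk ?b f \<u>"
  define M' where "M' = EV ?b \<star> whisk \<u> f ?b"
  define h where "h = whisk \<u> M ?a \<star> whisk ?b (COEV a) \<u>"
  have M: "arr M" "src M = ?b \<odot> a" "tgt M = \<u>" and M': "arr M'" "src M' = a \<odot> ?b" "tgt M' = \<u>"
    using f' O by (simp_all add: M_def M'_def)
  have "h = whisk \<u> (EV b) ?a \<star> whisk ?b f ?a \<star> whisk ?b (COEV a) \<u>"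
    using f' O by (simp add: h_def M_def)
  also have "\<dots> = whisk ?a (EV ?b) \<u> \<star> whisk ?a f ?b \<star> whisk \<u> (COEV ?a) ?b"
    using pivotal_natural[OF O, of "mor f"] f' O arr_mor[of f]
    by (intro arrow.expand)
      (simp add: mor_whisk(1)[of _ f] mor_whisk(2)[of "COEV _"] mor_whisk(3)[of "COEV _"]
        mor_whisk(2)[of "EV _"] mor_whisk(3)[of "EV _"])
  also have "\<dots> = whisk ?a M' \<u> \<star> whisk \<u> (COEV ?a) ?b"
    using f' O by (simp add: M'_def)
  finally have h': "h = whisk ?a M' \<u> \<star> whisk \<u> (COEV ?a) ?b" .
  have 1: "EV a \<star> whisk \<u> h a = M"
    unfolding h_def by (rule transpose_ev) (use M O in simp_all)
  have 2: "whisk \<u> f (?b \<odot> b) \<star> whisk a (COEV ?b) \<u> = whisk b (COEV ?b) \<u> \<star> f"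
    using interchange[of f "COEV ?b" \<u> \<u> \<u>] f' O by simp
  have 3: "whisk \<u> (EV ?b) b \<star> whisk b (COEV ?b) \<u> = ide b"
    using snake_whisk(4)[of b \<u> \<u>] O by simp
  have 4: "whisk \<u> M' b \<star> whisk a (COEV ?b) \<u> = f"
    using f' O by (simp add: M'_def 2 comp_reassoc[OF 3])
  have "whisk \<u> h b \<star> COEV ?b = whisk ?a f \<u> \<star> COEV ?a"
    unfolding h' using transpose_coev[OF M', of "COEV ?b" b] O M' f'
    by (simp only: 4 arr_EV EV_proj dual_Ob dual_dual)
  then show ?thesis
    by (intro that[of h]) (use 1 M f' O in \<open>simp_all add: h_def M_def\<close>)
qed

end

section \<open>Half-braidings as arrows\<close>

locale half_braided = strict_pivotal_category +
  fixes b :: 'a and e :: "'a \<Rightarrow> 'b"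
  assumes b_Ob [simp]: "b \<in> Ob C" and hb: "half_braiding C b e"
begin

definition BR :: "'a \<Rightarrow> ('a, 'b) arrow" where
  "BR x = Arrow (b \<odot> x) (e x) (x \<odot> b)"

lemma BR_proj [simp]: "src (BR x) = b \<odot> x" "tgt (BR x) = x \<odot> b" "mor (BR x) = e x"
  by (simp_all add: BR_def)

lemma arr_BR [simp]: "x \<in> Ob C \<Longrightarrow> arr (BR x)"
  using hb unfolding arr_def by (auto simp: half_braiding_def Defs.is_iso_def)

lemma BR_inverse:
  assumes "x \<in> Ob C"
  obtains g where "arr g" "src g = x \<odot> b" "tgt g = b \<odot> x"
    "g \<star> BR x = ide (b \<odot> x)" "BR x \<star> g = ide (x \<odot> b)"
proof -
  obtain m where m: "m \<in> Hom C (x \<odot> b) (b \<odot> x)" "m \<cdot> e x = \<I> (b \<odot> x)" "e x \<cdot> m = \<I> (x \<odot> b)"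
    using hb assms unfolding half_braiding_def Defs.is_iso_def by blast
  show ?thesis
  proof (rule that[of "Arrow (x \<odot> b) m (b \<odot> x)"])
    show "arr (Arrow (x \<odot> b) m (b \<odot> x))"
      unfolding arr_def using m assms by simp
  qed (use m in \<open>auto simp: comp_def ide_def BR_def\<close>)
qed

lemma BR_natural: 
  assumes "arr f" "src f = x" "tgt f = y"
  shows "BR y \<star> whisk b f \<u> = whisk \<u> f b \<star> BR x"
proof -
  have "e y \<cdot> (\<I> b \<boxtimes> mor f) = (mor f \<boxtimes> \<I> b) \<cdot> e x"
    using hb arr_mor[OF assms(1)] arr_Ob[OF assms(1)] assms unfolding half_braiding_def by auto
  then show ?thesis
    using assms by (intro arrow.expand) (auto simp: mor_whisk(2,3))
qed

lemma BR_tensor: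
  assumes "x \<in> Ob C" "y \<in> Ob C"
  shows "BR (x \<odot> y) = whisk x (BR y) \<u> \<star> whisk \<u> (BR x) y"
proof -
  have "e (x \<odot> y) = (\<I> x \<boxtimes> e y) \<cdot> (e x \<boxtimes> \<I> y)"
    using hb assms unfolding half_braiding_def by auto
  then show ?thesis
    using assms by (intro arrow.expand) (auto simp: mor_whisk(2,3))
qed

text \<open>The tensor axiom at the unit makes \<open>BR \<u>\<close> idempotent, and an invertible
  idempotent is the identity.\<close>

lemma BR_unit: "BR \<u> = ide b"
proof -
  obtain g where g: "arr g" "src g = b" "tgt g = b" "g \<star> BR \<u> = ide b"
    using BR_inverse[of \<u>] by auto
  have "BR \<u> = BR \<u> \<star> BR \<u>"
    using BR_tensor[of \<u> \<u>] by simp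
  then have "g \<star> BR \<u> = g \<star> BR \<u> \<star> BR \<u>"
    by simp
  then show ?thesis
    using g by (simp add: comp_reassoc[OF g(4)])
qed

end

section \<open>Generalized rotations\<close>

context half_braided
begin

text \<open>A whole leading block \<open>x\<close> of the target is carried around to the end. The
  rotation operator is the case where \<open>x\<close> is \<open>a\<close> and \<open>y\<close> is a
  tensor power of \<open>a\<close>.\<close>

definition rot :: "'a \<Rightarrow> 'a \<Rightarrow> ('a, 'b) arrow \<Rightarrow> ('a, 'b) arrow" where
  "rot x y f = whisk \<u> (EV x) (y \<odot> x) \<star> whisk (dual C x) f x \<star> whisk \<u> (BR (dual C x)) x
    \<star> whisk b (COEV (dual C x)) \<u>"

lemma rot_arr [simp]:
  assumes "x \<in> Ob C" "y \<in> Ob C" "arr f" "src f = b" "tgt f = x \<odot> y"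
  shows "arr (rot x y f)" "src (rot x y f) = b" "tgt (rot x y f) = y \<odot> x"
  using assms by (simp_all add: rot_def)

text \<open>The two half-braidings fuse by the tensor axiom. The nested evaluations are the
  evaluation of \<open>x \<odot> y\<close> up to the comparison map \<open>u\<close>, which then
  slides past \<open>f\<close> and the half-braiding and is absorbed by the coevaluations.\<close>

lemma rot_tensor:
  assumes O: "x \<in> Ob C" "y \<in> Ob C" "z \<in> Ob C"
    and f: "arr f" "src f = b" "tgt f = x \<odot> y \<odot> z"
  shows "rot (x \<odot> y) z f = rot y (z \<odot> x) (rot x (y \<odot> z) f)"
proof -
  let ?x = "dual C x" and ?y = "dual C y" and ?d = "dual C (x \<odot> y)"
  obtain u where u: "arr u" "src u = ?y \<odot> ?x" "tgt u = ?d"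
    and ev: "EV (x \<odot> y) \<star> whisk \<u> u (x \<odot> y) = EV y \<star> whisk ?y (EV x) y"
    and coev: "whisk \<u> u (x \<odot> y) \<star> whisk ?y (COEV ?x) y \<star> COEV ?y = COEV ?d"
    using dual_tensor_comparison[OF O(1,2)] .
  have 1: "whisk (?y \<odot> b) (COEV ?x) y \<star> whisk \<u> (BR ?y) y
      = whisk \<u> (BR ?y) (?x \<odot> x \<odot> y) \<star> whisk (b \<odot> ?y) (COEV ?x) y"
    using interchange[of "BR ?y" "COEV ?x" \<u> \<u> y] O by simp
  have 2: "whisk ?y (BR ?x) (x \<odot> y) \<star> whisk \<u> (BR ?y) (?x \<odot> x \<odot> y)
      = whisk \<u> (BR (?y \<odot> ?x)) (x \<odot> y)"
    using BR_tensor[of ?y ?x, THEN arg_cong, of "\<lambda>h. whisk \<u> h (x \<odot> y)"] O by simp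
  have 3: "whisk \<u> (EV y) (z \<odot> x \<odot> y) \<star> whisk ?y (EV x) (y \<odot> z \<odot> x \<odot> y)
      = whisk \<u> (EV (x \<odot> y)) (z \<odot> x \<odot> y) \<star> whisk \<u> u (x \<odot> y \<odot> z \<odot> x \<odot> y)"
    using ev[symmetric, THEN arg_cong, of "\<lambda>h. whisk \<u> h (z \<odot> x \<odot> y)"] O u by simp
  have 4: "whisk \<u> u (x \<odot> y \<odot> z \<odot> x \<odot> y) \<star> whisk (?y \<odot> ?x) f (x \<odot> y)
      = whisk ?d f (x \<odot> y) \<star> whisk \<u> u (b \<odot> x \<odot> y)"
    using interchange[of u f \<u> \<u> "x \<odot> y"] O u f by simp
  have 5: "whisk \<u> u (b \<odot> x \<odot> y) \<star> whisk \<u> (BR (?y \<odot> ?x)) (x \<odot> y)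
      = whisk \<u> (BR ?d) (x \<odot> y) \<star> whisk b u (x \<odot> y)"
    using BR_natural[OF u, THEN arg_cong, of "\<lambda>h. whisk \<u> h (x \<odot> y)"] O u by simp
  have 6: "whisk b u (x \<odot> y) \<star> whisk (b \<odot> ?y) (COEV ?x) y \<star> whisk b (COEV ?y) \<u>
      = whisk b (COEV ?d) \<u>"
    using coev[THEN arg_cong, of "\<lambda>h. whisk b h \<u>"] O u by simp
  have "rot y (z \<odot> x) (rot x (y \<odot> z) f)
    = whisk \<u> (EV y) (z \<odot> x \<odot> y) \<star> whisk ?y (EV x) (y \<odot> z \<odot> x \<odot> y) \<star> whisk (?y \<odot> ?x) f (x \<odot> y)
      \<star> whisk \<u> (BR (?y \<odot> ?x)) (x \<odot> y) \<star> whisk (b \<odot> ?y) (COEV ?x) y \<star> whisk b (COEV ?y) \<u>"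
    using O f by (simp add: rot_def comp_reassoc[OF 1] comp_reassoc[OF 2])
  also have "\<dots> = whisk \<u> (EV (x \<odot> y)) (z \<odot> x \<odot> y) \<star> whisk ?d f (x \<odot> y)
      \<star> whisk \<u> (BR ?d) (x \<odot> y) \<star> whisk b (COEV ?d) \<u>"
    using O f u by (simp add: comp_reassoc[OF 3] comp_reassoc[OF 4] comp_reassoc[OF 5] 6)
  finally show ?thesis
    using O f by (simp add: rot_def)
qed

definition inv_twist :: "('a, 'b) arrow" where
  "inv_twist = rot b \<u> (ide b)"

lemma inv_twist_arr [simp]: "arr inv_twist" "src inv_twist = b" "tgt inv_twist = b"
  using rot_arr[of b \<u> "ide b"] by (simp_all add: inv_twist_def)

text \<open>The arrow \<open>f\<close> travels around the loop: at the evaluation it becomes its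
  dual, passes the half-braiding by naturality, and turns back into \<open>f\<close> at the
  coevaluation, so that only a loop of \<open>b\<close> itself remains before it.\<close>

lemma rot_full:
  assumes f: "arr f" "src f = b" "tgt f = x"
  shows "rot x \<u> f = f \<star> inv_twist"
proof -
  let ?b = "dual C b" and ?x = "dual C x"
  have O: "x \<in> Ob C" using f by auto
  obtain h where h: "arr h" "src h = ?x" "tgt h = ?b"
    and ev: "EV b \<star> whisk \<u> h b = EV x \<star> whisk ?x f \<u>"
    and coev: "whisk \<u> h x \<star> COEV ?x = whisk ?b f \<u> \<star> COEV ?b"
    using dual_arrow[OF f(1)] f by metis
  have 1: "whisk \<u> (EV x) x \<star> whisk ?x f x = whisk \<u> (EV b) x \<star> whisk \<u> h (b \<odot> x)"
    using ev[symmetric, THEN arg_cong, of "\<lambda>h. whisk \<u> h x"] O h f by simp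
  have 2: "whisk \<u> h (b \<odot> x) \<star> whisk \<u> (BR ?x) x = whisk \<u> (BR ?b) x \<star> whisk b h x"
    using BR_natural[OF h, THEN arg_cong, of "\<lambda>h. whisk \<u> h x"] O h by simp
  have 3: "whisk b h x \<star> whisk b (COEV ?x) \<u> = whisk (b \<odot> ?b) f \<u> \<star> whisk b (COEV ?b) \<u>"
    using coev[THEN arg_cong, of "\<lambda>h. whisk b h \<u>"] O h f by simp
  have 4: "whisk \<u> (BR ?b) x \<star> whisk (b \<odot> ?b) f \<u> = whisk (?b \<odot> b) f \<u> \<star> whisk \<u> (BR ?b) b"
    using interchange[of "BR ?b" f \<u> \<u> \<u>] O f by simp
  have 5: "whisk \<u> (EV b) x \<star> whisk (?b \<odot> b) f \<u> = f \<star> whisk \<u> (EV b) b"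
    using interchange[of "EV b" f \<u> \<u> \<u>] O f by simp
  show ?thesis
    using O f h
    by (simp add: rot_def inv_twist_def comp_reassoc[OF 1] comp_reassoc[OF 2] 3
        comp_reassoc[OF 4] comp_reassoc[OF 5])
qed

definition twist_arrow :: "('a, 'b) arrow" where
  "twist_arrow = whisk b (EV (dual C b)) \<u> \<star> whisk \<u> (BR b) (dual C b) \<star> whisk b (COEV b) \<u>"

lemma twist_arrow_arr [simp]: "arr twist_arrow" "src twist_arrow = b" "tgt twist_arrow = b"
  by (simp_all add: twist_arrow_def)

text \<open>By \<open>rot_full\<close> the composite is the full rotation of
  \<open>twist_arrow\<close>. There the half-braidings with \<open>dual C b\<close> and
  \<open>b\<close> fuse, evaluation removes the result by naturality and \<open>BR_unit\<close>, and
  zigzags remain. A one-sided inverse is enough, as \<open>inv_twist\<close> turns out to be a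
  scalar.\<close>

lemma twist_arrow_inv_twist: "twist_arrow \<star> inv_twist = ide b"
proof -
  let ?b = "dual C b"
  have 1: "whisk (?b \<odot> b) (COEV b) b \<star> whisk \<u> (BR ?b) b
      = whisk \<u> (BR ?b) (b \<odot> ?b \<odot> b) \<star> whisk (b \<odot> ?b) (COEV b) b"
    using interchange[of "BR ?b" "COEV b" \<u> \<u> b] by simp
  have 2: "whisk ?b (BR b) (?b \<odot> b) \<star> whisk \<u> (BR ?b) (b \<odot> ?b \<odot> b)
      = whisk \<u> (BR (?b \<odot> b)) (?b \<odot> b)"
    using BR_tensor[of ?b b, THEN arg_cong, of "\<lambda>h. whisk \<u> h (?b \<odot> b)"] by simp
  have 3: "whisk \<u> (EV b) b \<star> whisk (?b \<odot> b) (EV ?b) b = whisk \<u> (EV ?b) b \<star> whisk \<u> (EV b) (b \<odot> ?b \<odot> b)"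
    using interchange[of "EV b" "EV ?b" \<u> \<u> b] by simp
  have 4: "whisk \<u> (EV b) (b \<odot> ?b \<odot> b) \<star> whisk \<u> (BR (?b \<odot> b)) (?b \<odot> b)
      = whisk b (EV b) (?b \<odot> b)"
    using BR_natural[of "EV b" "?b \<odot> b" \<u>, symmetric, THEN arg_cong, of "\<lambda>h. whisk \<u> h (?b \<odot> b)"]
    by (simp add: BR_unit)
  have 5: "whisk b (EV b) (?b \<odot> b) \<star> whisk (b \<odot> ?b) (COEV b) b = ide (b \<odot> ?b \<odot> b)"
    using snake_whisk(2)[of b b b] by simp
  have 6: "whisk \<u> (EV ?b) b \<star> whisk b (COEV ?b) \<u> = ide b"
    using snake_whisk(4)[of b \<u> \<u>] by simp
  have "rot b \<u> twist_arrow = ide b"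
    by (simp add: rot_def twist_arrow_def comp_reassoc[OF 1] comp_reassoc[OF 2] comp_reassoc[OF 3]
        comp_reassoc[OF 4] comp_reassoc[OF 5] 6)
  then show ?thesis
    using rot_full[of twist_arrow b] by simp
qed

text \<open>
  Both sides are compared after bending \<open>x\<close> around, as maps from \<open>b\<close> to \<open>x \<odot> b \<odot> dual C x\<close>: the
  full rotation of such a map is precomposition with \<^term>\<open>inv_twist\<close>, and also the composite
  of the three rotations by \<open>x\<close>, \<open>b\<close> and \<open>dual C x\<close>.
\<close>

lemma inv_twist_central:
  assumes O: "x \<in> Ob C"
  shows "BR x \<star> whisk \<u> inv_twist x = whisk x inv_twist \<u> \<star> BR x"
proof -
  let ?x = "dual C x"
  define f where "f = whisk \<u> (BR x) ?x \<star> whisk b (COEV x) \<u>"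
  have f: "arr f" "src f = b" "tgt f = x \<odot> b \<odot> ?x"
    using O by (simp_all add: f_def)
  \<comment> \<open>The half-braidings with \<open>?x\<close> and \<open>x\<close> fuse and are
    removed by evaluation, so this rotation leaves no braiding behind.\<close>
  have D1: "rot x (b \<odot> ?x) f = whisk b (COEV ?x) \<u>"
  proof -
    have 1: "whisk (?x \<odot> b) (COEV x) x \<star> whisk \<u> (BR ?x) x
        = whisk \<u> (BR ?x) (x \<odot> ?x \<odot> x) \<star> whisk (b \<odot> ?x) (COEV x) x"
      using interchange[of "BR ?x" "COEV x" \<u> \<u> x] O by simp
    have 2: "whisk ?x (BR x) (?x \<odot> x) \<star> whisk \<u> (BR ?x) (x \<odot> ?x \<odot> x)
        = whisk \<u> (BR (?x \<odot> x)) (?x \<odot> x)"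
      using BR_tensor[of ?x x, THEN arg_cong, of "\<lambda>h. whisk \<u> h (?x \<odot> x)"] O by simp
    have 4: "whisk \<u> (EV x) (b \<odot> ?x \<odot> x) \<star> whisk \<u> (BR (?x \<odot> x)) (?x \<odot> x)
        = whisk b (EV x) (?x \<odot> x)"
      using BR_natural[of "EV x" "?x \<odot> x" \<u>, symmetric, THEN arg_cong, of "\<lambda>h. whisk \<u> h (?x \<odot> x)"] O
      by (simp add: BR_unit)
    have 5: "whisk b (EV x) (?x \<odot> x) \<star> whisk (b \<odot> ?x) (COEV x) x = ide (b \<odot> ?x \<odot> x)"
      using snake_whisk(2)[of x b x] O by simp
    show ?thesis
      using O by (simp add: rot_def f_def comp_reassoc[OF 1] comp_reassoc[OF 2] comp_reassoc[OF 4]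
          comp_reassoc[OF 5])
  qed
  have D2: "rot b (?x \<odot> x) (whisk b (COEV ?x) \<u>) = whisk \<u> (COEV ?x) b \<star> inv_twist"
  proof -
    let ?b = "dual C b"
    have 1: "whisk \<u> (EV b) (?x \<odot> x \<odot> b) \<star> whisk (?b \<odot> b) (COEV ?x) b
        = whisk \<u> (COEV ?x) b \<star> whisk \<u> (EV b) b"
      using interchange[of "EV b" "COEV ?x" \<u> \<u> b] O by simp
    show ?thesis
      using O by (simp add: rot_def inv_twist_def comp_reassoc[OF 1])
  qed
  have D3: "rot ?x (x \<odot> b) (whisk \<u> (COEV ?x) b \<star> inv_twist) = whisk x inv_twist ?x \<star> f"
  proof -
    have 1: "whisk \<u> (EV ?x) (x \<odot> b \<odot> ?x) \<star> whisk x (COEV ?x) (b \<odot> ?x) = ide (x \<odot> b \<odot> ?x)"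
      using snake_whisk(4)[of x \<u> "b \<odot> ?x"] O by simp
    show ?thesis
      using O by (simp add: rot_def f_def comp_reassoc[OF 1])
  qed
  have "f \<star> inv_twist = rot (x \<odot> b \<odot> ?x) \<u> f"
    using rot_full f by simp
  also have "\<dots> = rot ?x (x \<odot> b) (rot (x \<odot> b) ?x f)"
    using rot_tensor[of "x \<odot> b" ?x \<u> f] O f by simp
  also have "rot (x \<odot> b) ?x f = rot b (?x \<odot> x) (rot x (b \<odot> ?x) f)"
    using rot_tensor[of x b ?x f] O f by simp
  finally have *: "f \<star> inv_twist = whisk x inv_twist ?x \<star> f"
    by (simp add: D1 D2 D3)
  have 1: "whisk (x \<odot> b) (EV x) \<u> \<star> whisk \<u> (BR x) (?x \<odot> x) = BR x \<star> whisk (b \<odot> x) (EV x) \<u>"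
    using interchange[of "BR x" "EV x" \<u> \<u> \<u>] O by simp
  have 2: "whisk (b \<odot> x) (EV x) \<u> \<star> whisk b (COEV x) x = ide (b \<odot> x)"
    using snake_whisk(1)[of x b \<u>] O by simp
  have 3: "whisk (x \<odot> b) (EV x) \<u> \<star> whisk x inv_twist (?x \<odot> x)
      = whisk x inv_twist \<u> \<star> whisk (x \<odot> b) (EV x) \<u>"
    using interchange[of inv_twist "EV x" x \<u> \<u>] O by simp
  \<comment> \<open>Undoing the bend recovers the half-braiding from \<open>f\<close>.\<close>
  have F: "whisk (x \<odot> b) (EV x) \<u> \<star> whisk \<u> f x = BR x"
    using O by (simp add: f_def comp_reassoc[OF 1] 2)
  have 4: "whisk \<u> f x \<star> whisk \<u> inv_twist x = whisk x inv_twist (?x \<odot> x) \<star> whisk \<u> f x"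
    using *[THEN arg_cong, of "\<lambda>h. whisk \<u> h x"] O f by simp
  have "BR x \<star> whisk \<u> inv_twist x = whisk (x \<odot> b) (EV x) \<u> \<star> whisk \<u> f x \<star> whisk \<u> inv_twist x"
    using O f by (simp add: F[symmetric])
  also have "\<dots> = whisk x inv_twist \<u> \<star> whisk (x \<odot> b) (EV x) \<u> \<star> whisk \<u> f x"
    using O f by (simp only: 4) (simp add: comp_reassoc[OF 3])
  finally show ?thesis
    by (simp add: F)
qed

end

section \<open>Schur's lemma in the center\<close>

context strict_pivotal_category
begin

lemma mor_comp_zero:
  assumes "arr g" "arr f" "src g = tgt f" "mor g = 0 \<or> mor f = 0"
  shows "mor (g \<star> f) = 0"
  using assms(4)
proof
  assume "mor g = 0"
  then show ?thesis
    using cmp_smult_left[OF _ _ _ arr_mor[OF assms(2)], of "tgt g" "mor g" 0] arr_mor[OF assms(1)] assms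
    by simp
next
  assume "mor f = 0"
  then show ?thesis
    using cmp_smult_right[OF _ _ _ arr_mor[OF assms(2)], of "tgt g" "mor g" 0] arr_mor[OF assms(1)] assms
    by simp
qed

lemma mor_whisk_zero:
  assumes "arr f" "x \<in> Ob C" "y \<in> Ob C" "mor f = 0"
  shows "mor (whisk x f y) = 0"
proof -
  have "lincat.smult C 0 (mor f) \<boxtimes> \<I> y = lincat.smult C 0 (mor f \<boxtimes> \<I> y)"
    by (rule tensM_smult_left[OF _ _ _ _ arr_mor id_Hom]) (use assms in simp_all)
  moreover have "\<I> x \<boxtimes> lincat.smult C 0 (mor f \<boxtimes> \<I> y) = lincat.smult C 0 (\<I> x \<boxtimes> mor f \<boxtimes> \<I> y)"
    by (rule tensM_smult_right[OF _ _ _ _ id_Hom tens_id_Hom]) (use assms in simp_all)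
  ultimately show ?thesis
    using assms(4) by (simp add: mor_whisk(1))
qed

text \<open>The vanishing of \<open>G \<star> K\<close> is kept as a separate hypothesis, so that
  whiskering only has to transport lifts and their uniqueness.\<close>

definition arrow_kernel :: "('a, 'b) arrow \<Rightarrow> ('a, 'b) arrow \<Rightarrow> bool" where
  "arrow_kernel G K \<longleftrightarrow> arr G \<and> arr K \<and> tgt K = src G \<and>
    (\<forall>h. arr h \<and> tgt h = src G \<and> mor (G \<star> h) = 0 \<longrightarrow>
      (\<exists>m. arr m \<and> src m = src h \<and> tgt m = src K \<and> K \<star> m = h)) \<and>
    (\<forall>m m'. arr m \<and> arr m' \<and> src m = src m' \<and> tgt m = src K \<and> tgt m' = src K \<and> K \<star> m = K \<star> m'
      \<longrightarrow> m = m')"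

text \<open>Tensoring with \<open>x\<close> on the left is right adjoint to tensoring with
  \<open>dual C x\<close> on the left, hence preserves kernels; \<open>bend\<close> and
  \<open>unbend\<close> realise the adjunction.\<close>

lemma whisk_left_kernel:
  assumes K: "arrow_kernel G K" and x: "x \<in> Ob C"
  shows "arrow_kernel (whisk x G \<u>) (whisk x K \<u>)"
proof -
  have G: "arr G" "arr K" "tgt K = src G"
    and lift: "\<And>h. \<lbrakk>arr h; tgt h = src G; mor (G \<star> h) = 0\<rbrakk> \<Longrightarrow>
      \<exists>m. arr m \<and> src m = src h \<and> tgt m = src K \<and> K \<star> m = h"
    and mono: "\<And>m m'. \<lbrakk>arr m; arr m'; src m = src m'; tgt m = src K; tgt m' = src K; K \<star> m = K \<star> m'\<rbrakk>
      \<Longrightarrow> m = m'"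
    using K unfolding arrow_kernel_def by blast+
  let ?x = "dual C x"
  define bend where "bend s h = whisk \<u> (EV x) s \<star> whisk ?x h \<u>" for s h
  define unbend where "unbend w m = whisk x m \<u> \<star> whisk \<u> (COEV x) w" for w m
  have bend_arr: "arr (bend s h)" "src (bend s h) = ?x \<odot> src h" "tgt (bend s h) = s"
    if "arr h" "tgt h = x \<odot> s" "s \<in> Ob C" for s h
    using that x by (simp_all add: bend_def)
  have unbend_bend: "unbend w (bend s h) = h" if h: "arr h" "src h = w" "tgt h = x \<odot> s" and s: "s \<in> Ob C" for s w h
  proof -
    have w: "w \<in> Ob C" using h by auto
    have 1: "whisk (x \<odot> ?x) h \<u> \<star> whisk \<u> (COEV x) w = whisk \<u> (COEV x) (x \<odot> s) \<star> h"
      using interchange[of "COEV x" h \<u> \<u> \<u>] h x s w by simp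
    have 2: "whisk x (EV x) s \<star> whisk \<u> (COEV x) (x \<odot> s) = ide (x \<odot> s)"
      using snake_whisk(1)[of x \<u> s] x s by simp
    show ?thesis
      using h x s w by (simp add: unbend_def bend_def 1 comp_reassoc[OF 2])
  qed
  have bend_comp: "bend t (whisk x f \<u> \<star> m) = f \<star> bend s m"
    if f: "arr f" "src f = s" "tgt f = t" and m: "arr m" "tgt m = x \<odot> s" for f m s t
  proof -
    have st: "s \<in> Ob C" "t \<in> Ob C" using f by auto
    moreover have 1: "whisk \<u> (EV x) t \<star> whisk (?x \<odot> x) f \<u> = f \<star> whisk \<u> (EV x) s"
      using interchange[of "EV x" f \<u> \<u> \<u>] f x st by simp
    ultimately show ?thesis
      using f m x by (simp add: bend_def comp_reassoc[OF 1])
  qed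
  have S: "src G \<in> Ob C" "src K \<in> Ob C" "tgt G \<in> Ob C"
    using G by auto
  have "\<exists>m. arr m \<and> src m = src h \<and> tgt m = x \<odot> src K \<and> whisk x K \<u> \<star> m = h"
    if h: "arr h" "tgt h = x \<odot> src G" and zero: "mor (whisk x G \<u> \<star> h) = 0" for h
  proof -
    have "mor (bend (tgt G) (whisk x G \<u> \<star> h)) = 0"
      unfolding bend_def using h x G S
      by (intro mor_comp_zero[OF _ _ _ disjI2[OF mor_whisk_zero[OF _ _ _ zero]]]) simp_all
    then have "mor (G \<star> bend (src G) h) = 0"
      using bend_comp[OF G(1) refl refl h] by simp
    then obtain m where m: "arr m" "src m = ?x \<odot> src h" "tgt m = src K" "K \<star> m = bend (src G) h"
      using lift[of "bend (src G) h"] bend_arr h S by metis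
    have "whisk x K \<u> \<star> unbend (src h) m = unbend (src h) (K \<star> m)"
      using m(1-3) G x h by (simp add: unbend_def)
    also have "\<dots> = h"
      using m unbend_bend h S by simp
    finally show ?thesis
      using m x h S by (intro exI[of _ "unbend (src h) m"]) (simp add: unbend_def)
  qed
  moreover have "m = m'"
    if m: "arr m" "arr m'" "src m = src m'" "tgt m = x \<odot> src K" "tgt m' = x \<odot> src K"
      and eq: "whisk x K \<u> \<star> m = whisk x K \<u> \<star> m'" for m m'
  proof -
    have "K \<star> bend (src K) m = K \<star> bend (src K) m'"
      using bend_comp[OF G(2) refl G(3) m(1,4)] bend_comp[OF G(2) refl G(3) m(2,5)] eq by simp
    then have "bend (src K) m = bend (src K) m'"
      by (rule mono[rotated 5]) (use m S in \<open>simp_all add: bend_arr\<close>)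
    then show ?thesis
      using unbend_bend[OF m(1) refl m(4) S(2)] unbend_bend[OF m(2) refl m(5) S(2)] m(3) by metis
  qed
  ultimately show ?thesis
    unfolding arrow_kernel_def using G x S by simp
qed

text \<open>The mirror image, with \<open>dual C x\<close> tensored on the right and the other pair
  of duality maps.\<close>

lemma whisk_right_kernel:
  assumes K: "arrow_kernel G K" and x: "x \<in> Ob C"
  shows "arrow_kernel (whisk \<u> G x) (whisk \<u> K x)"
proof -
  have G: "arr G" "arr K" "tgt K = src G"
    and lift: "\<And>h. \<lbrakk>arr h; tgt h = src G; mor (G \<star> h) = 0\<rbrakk> \<Longrightarrow>
      \<exists>m. arr m \<and> src m = src h \<and> tgt m = src K \<and> K \<star> m = h"
    and mono: "\<And>m m'. \<lbrakk>arr m; arr m'; src m = src m'; tgt m = src K; tgt m' = src K; K \<star> m = K \<star> m'\<rbrakk>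
      \<Longrightarrow> m = m'"
    using K unfolding arrow_kernel_def by blast+
  let ?x = "dual C x"
  define bend where "bend s h = whisk s (EV ?x) \<u> \<star> whisk \<u> h ?x" for s h
  define unbend where "unbend w m = whisk \<u> m x \<star> whisk w (COEV ?x) \<u>" for w m
  have bend_arr: "arr (bend s h)" "src (bend s h) = src h \<odot> ?x" "tgt (bend s h) = s"
    if "arr h" "tgt h = s \<odot> x" "s \<in> Ob C" for s h
    using that x by (simp_all add: bend_def)
  have unbend_bend: "unbend w (bend s h) = h" if h: "arr h" "src h = w" "tgt h = s \<odot> x" and s: "s \<in> Ob C" for s w h
  proof -
    have w: "w \<in> Ob C" using h by auto
    have 1: "whisk \<u> h (?x \<odot> x) \<star> whisk w (COEV ?x) \<u> = whisk (s \<odot> x) (COEV ?x) \<u> \<star> h"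
      using interchange[of h "COEV ?x" \<u> \<u> \<u>] h x s w by simp
    have 2: "whisk s (EV ?x) x \<star> whisk (s \<odot> x) (COEV ?x) \<u> = ide (s \<odot> x)"
      using snake_whisk(4)[of x s \<u>] x s by simp
    show ?thesis
      using h x s w by (simp add: unbend_def bend_def 1 comp_reassoc[OF 2])
  qed
  have bend_comp: "bend t (whisk \<u> f x \<star> m) = f \<star> bend s m"
    if f: "arr f" "src f = s" "tgt f = t" and m: "arr m" "tgt m = s \<odot> x" for f m s t
  proof -
    have st: "s \<in> Ob C" "t \<in> Ob C" using f by auto
    moreover have 1: "whisk t (EV ?x) \<u> \<star> whisk \<u> f (x \<odot> ?x) = f \<star> whisk s (EV ?x) \<u>"
      using interchange[of f "EV ?x" \<u> \<u> \<u>] f x st by simp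
    ultimately show ?thesis
      using f m x by (simp add: bend_def comp_reassoc[OF 1])
  qed
  have S: "src G \<in> Ob C" "src K \<in> Ob C" "tgt G \<in> Ob C"
    using G by auto
  have "\<exists>m. arr m \<and> src m = src h \<and> tgt m = src K \<odot> x \<and> whisk \<u> K x \<star> m = h"
    if h: "arr h" "tgt h = src G \<odot> x" and zero: "mor (whisk \<u> G x \<star> h) = 0" for h
  proof -
    have "mor (bend (tgt G) (whisk \<u> G x \<star> h)) = 0"
      unfolding bend_def using h x G S
      by (intro mor_comp_zero[OF _ _ _ disjI2[OF mor_whisk_zero[OF _ _ _ zero]]]) simp_all
    then have "mor (G \<star> bend (src G) h) = 0"
      using bend_comp[OF G(1) refl refl h] by simp
    then obtain m where m: "arr m" "src m = src h \<odot> ?x" "tgt m = src K" "K \<star> m = bend (src G) h"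
      using lift[of "bend (src G) h"] bend_arr h S by metis
    have "whisk \<u> K x \<star> unbend (src h) m = unbend (src h) (K \<star> m)"
      using m(1-3) G x h by (simp add: unbend_def)
    also have "\<dots> = h"
      using m unbend_bend h S by simp
    finally show ?thesis
      using m x h S by (intro exI[of _ "unbend (src h) m"]) (simp add: unbend_def)
  qed
  moreover have "m = m'"
    if m: "arr m" "arr m'" "src m = src m'" "tgt m = src K \<odot> x" "tgt m' = src K \<odot> x"
      and eq: "whisk \<u> K x \<star> m = whisk \<u> K x \<star> m'" for m m'
  proof -
    have "K \<star> bend (src K) m = K \<star> bend (src K) m'"
      using bend_comp[OF G(2) refl G(3) m(1,4)] bend_comp[OF G(2) refl G(3) m(2,5)] eq by simp
    then have "bend (src K) m = bend (src K) m'"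
      by (rule mono[rotated 5]) (use m S in \<open>simp_all add: bend_arr\<close>)
    then show ?thesis
      using unbend_bend[OF m(1) refl m(4) S(2)] unbend_bend[OF m(2) refl m(5) S(2)] m(3) by metis
  qed
  ultimately show ?thesis
    unfolding arrow_kernel_def using G x S by simp
qed

lemma arrow_kernel_lift:
  assumes "arrow_kernel G K" "arr h" "tgt h = src G" "mor (G \<star> h) = 0"
  obtains m where "arr m" "src m = src h" "tgt m = src K" "K \<star> m = h"
  using assms unfolding arrow_kernel_def by blast

lemma arrow_kernel_mono:
  assumes "arrow_kernel G K" "K \<star> m = K \<star> m'"
    "arr m" "arr m'" "src m = src m'" "tgt m = src K" "tgt m' = src K"
  shows "m = m'"
  using assms unfolding arrow_kernel_def by blast

end

context half_braided
begin

text \<open>Centrality of \<open>G\<close> makes \<open>BR x \<star> whisk \<u> K x\<close> vanish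
  under \<open>whisk x G \<u>\<close>, so it lifts through the kernel \<open>whisk x K \<u>\<close>;
  the lift is the half-braiding. Its properties are equations that are checked after composing with
  a whiskered copy of \<open>K\<close>, which can be cancelled.\<close>

lemma kernel_half_braiding:
  assumes G: "arr G" "src G = b" "tgt G = b"
    and central: "\<And>x. x \<in> Ob C \<Longrightarrow> BR x \<star> whisk \<u> G x = whisk x G \<u> \<star> BR x"
    and K: "arrow_kernel G K" "mor (G \<star> K) = 0" and k: "src K = k"
  obtains e' where "half_braiding C k e'"
    "\<And>x. x \<in> Ob C \<Longrightarrow> (\<I> x \<boxtimes> mor K) \<cdot> e' x = e x \<cdot> (mor K \<boxtimes> \<I> x)"
proof -
  have K': "arr K" "src K = k" "tgt K = b" and kO: "k \<in> Ob C"
    using K(1) G k unfolding arrow_kernel_def by auto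
  have "\<exists>m. arr m \<and> src m = k \<odot> x \<and> tgt m = x \<odot> k \<and> whisk x K \<u> \<star> m = BR x \<star> whisk \<u> K x"
    if x: "x \<in> Ob C" for x
  proof -
    have "whisk x G \<u> \<star> BR x \<star> whisk \<u> K x = BR x \<star> whisk \<u> (G \<star> K) x"
      using G K' x by (simp add: comp_reassoc[OF central[OF x, symmetric]])
    moreover have "mor (BR x \<star> whisk \<u> (G \<star> K) x) = 0"
      using G K' x by (intro mor_comp_zero[OF _ _ _ disjI2[OF mor_whisk_zero[OF _ _ _ K(2)]]]) simp_all
    ultimately have zero: "mor (whisk x G \<u> \<star> BR x \<star> whisk \<u> K x) = 0"
      by simp
    have "arr (BR x \<star> whisk \<u> K x)" "tgt (BR x \<star> whisk \<u> K x) = src (whisk x G \<u>)"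
      using G K' x by simp_all
    from arrow_kernel_lift[OF whisk_left_kernel[OF K(1) x] this zero]
    obtain m where m: "arr m" "src m = src (BR x \<star> whisk \<u> K x)" "tgt m = src (whisk x K \<u>)"
      "whisk x K \<u> \<star> m = BR x \<star> whisk \<u> K x" .
    then show ?thesis
      using K' x kO by (intro exI[of _ m]) simp
  qed
  then obtain E where E: "\<And>x. x \<in> Ob C \<Longrightarrow> arr (E x) \<and> src (E x) = k \<odot> x \<and> tgt (E x) = x \<odot> k
      \<and> whisk x K \<u> \<star> E x = BR x \<star> whisk \<u> K x"
    by metis
  have E' [simp]: "arr (E x)" "src (E x) = k \<odot> x" "tgt (E x) = x \<odot> k" if "x \<in> Ob C" for x
    using E[OF that] by auto
  have KE: "whisk x K \<u> \<star> E x = BR x \<star> whisk \<u> K x" if "x \<in> Ob C" for x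
    using E[OF that] by auto
  \<comment> \<open>\<open>half_braiding\<close> demands an extensional family, hence the default
    value outside \<open>Ob C\<close>.\<close>
  define e' where "e' x = (if x \<in> Ob C then mor (E x) else undefined)" for x
  have iso: "Defs.is_iso C (k \<odot> x) (x \<odot> k) (e' x)" if x: "x \<in> Ob C" for x
  proof -
    obtain g where g: "arr g" "src g = x \<odot> b" "tgt g = b \<odot> x"
      "g \<star> BR x = ide (b \<odot> x)" "BR x \<star> g = ide (x \<odot> b)"
      using BR_inverse[OF x] .
    have "whisk \<u> G x = g \<star> BR x \<star> whisk \<u> G x"
      using g G x by (simp add: comp_reassoc[OF g(4)])
    also have "\<dots> = g \<star> whisk x G \<u> \<star> BR x"
      by (simp add: central[OF x])
    finally have eq: "whisk \<u> G x = g \<star> whisk x G \<u> \<star> BR x" .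
    \<comment> \<open>\<open>G\<close> also commutes with the inverse braiding, so the inverse of
      \<open>E x\<close> arises by lifting through \<open>whisk \<u> K x\<close>.\<close>
    have Gg: "whisk \<u> G x \<star> g = g \<star> whisk x G \<u>"
      unfolding eq using g G x by simp
    then have 1: "whisk \<u> G x \<star> g \<star> whisk x K \<u> = g \<star> whisk x (G \<star> K) \<u>"
      using g G K' x by (simp add: comp_reassoc[OF Gg])
    moreover have "mor (g \<star> whisk x (G \<star> K) \<u>) = 0"
      using g G K' x by (intro mor_comp_zero[OF _ _ _ disjI2[OF mor_whisk_zero[OF _ _ _ K(2)]]]) simp_all
    ultimately have "mor (whisk \<u> G x \<star> g \<star> whisk x K \<u>) = 0"
      by simp
    then obtain m where m: "arr m" "src m = x \<odot> k" "tgt m = k \<odot> x" "whisk \<u> K x \<star> m = g \<star> whisk x K \<u>"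
      using arrow_kernel_lift[OF whisk_right_kernel[OF K(1) x], of "g \<star> whisk x K \<u>"] g G K' x kO
      by auto
    have mE: "m \<star> E x = ide (k \<odot> x)"
    proof (rule arrow_kernel_mono[OF whisk_right_kernel[OF K(1) x]])
      have "whisk \<u> K x \<star> m \<star> E x = g \<star> BR x \<star> whisk \<u> K x"
        using m g x K' kO by (simp add: comp_reassoc[OF m(4)] KE[OF x])
      then show "whisk \<u> K x \<star> m \<star> E x = whisk \<u> K x \<star> ide (k \<odot> x)"
        using g x K' kO by (simp add: comp_reassoc[OF g(4)])
    qed (use m x K' kO in simp_all)
    have Em: "E x \<star> m = ide (x \<odot> k)"
    proof (rule arrow_kernel_mono[OF whisk_left_kernel[OF K(1) x]])
      have "whisk x K \<u> \<star> E x \<star> m = BR x \<star> g \<star> whisk x K \<u>"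
        using m g x K' kO by (simp add: comp_reassoc[OF KE[OF x]])
      then show "whisk x K \<u> \<star> E x \<star> m = whisk x K \<u> \<star> ide (x \<odot> k)"
        using g x K' kO by (simp add: comp_reassoc[OF g(5)])
    qed (use m x K' kO in simp_all)
    have "mor m \<in> Hom C (x \<odot> k) (k \<odot> x)" "mor (E x) \<in> Hom C (k \<odot> x) (x \<odot> k)"
      using arr_mor[OF m(1)] arr_mor[OF E'(1)[OF x]] m x by simp_all
    moreover have "mor m \<cdot> mor (E x) = \<I> (k \<odot> x)" "mor (E x) \<cdot> mor m = \<I> (x \<odot> k)"
      using arg_cong[OF mE, of mor] arg_cong[OF Em, of mor] by simp_all
    ultimately show ?thesis
      using x unfolding Defs.is_iso_def by (auto simp: e'_def)
  qed
  have natural: "E y \<star> whisk k f \<u> = whisk \<u> f k \<star> E x" if f: "arr f" "src f = x" "tgt f = y" for f x y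
  proof (rule arrow_kernel_mono[OF whisk_left_kernel[OF K(1), of y]])
    have O: "x \<in> Ob C" "y \<in> Ob C" using f by auto
    have 1: "whisk \<u> K y \<star> whisk k f \<u> = whisk b f \<u> \<star> whisk \<u> K x"
      using interchange[of K f \<u> \<u> \<u>] f K' O kO by simp
    have 2: "whisk y K \<u> \<star> whisk \<u> f k = whisk \<u> f b \<star> whisk x K \<u>"
      using interchange[of f K \<u> \<u> \<u>] f K' O kO by simp
    have "whisk y K \<u> \<star> E y \<star> whisk k f \<u> = whisk \<u> f b \<star> BR x \<star> whisk \<u> K x"
      using f O K' kO by (simp add: comp_reassoc[OF KE] 1 comp_reassoc[OF BR_natural[OF f]])
    then show "whisk y K \<u> \<star> E y \<star> whisk k f \<u> = whisk y K \<u> \<star> whisk \<u> f k \<star> E x"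
      using f O K' kO by (simp add: comp_reassoc[OF 2] KE)
  qed (use f K' kO in auto)
  have tensor: "E (x \<odot> y) = whisk x (E y) \<u> \<star> whisk \<u> (E x) y" if O: "x \<in> Ob C" "y \<in> Ob C" for x y
  proof (rule arrow_kernel_mono[OF whisk_left_kernel[OF K(1), of "x \<odot> y"]])
    have 1: "whisk (x \<odot> y) K \<u> \<star> whisk x (E y) \<u> = whisk x (BR y) \<u> \<star> whisk x K y"
      using KE[OF O(2), THEN arg_cong, of "\<lambda>h. whisk x h \<u>"] O K' kO by simp
    have 2: "whisk x K y \<star> whisk \<u> (E x) y = whisk \<u> (BR x) y \<star> whisk \<u> K (x \<odot> y)"
      using KE[OF O(1), THEN arg_cong, of "\<lambda>h. whisk \<u> h y"] O K' kO by simp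
    show "whisk (x \<odot> y) K \<u> \<star> E (x \<odot> y)
        = whisk (x \<odot> y) K \<u> \<star> whisk x (E y) \<u> \<star> whisk \<u> (E x) y"
      using O K' kO by (simp add: KE BR_tensor comp_reassoc[OF 1] 2)
  qed (use O K' kO in auto)
  show ?thesis
  proof (rule that[of e'])
    show "half_braiding C k e'"
      unfolding half_braiding_def
    proof (intro conjI ballI)
      show "e' \<in> extensional (Ob C)"
        by (simp add: e'_def extensional_def)
      fix x assume x: "x \<in> Ob C"
      show "Defs.is_iso C (k \<odot> x) (x \<odot> k) (e' x)"
        by (rule iso[OF x])
      fix y assume y: "y \<in> Ob C"
      show "e' (x \<odot> y) = (\<I> x \<boxtimes> e' y) \<cdot> (e' x \<boxtimes> \<I> y)"
        using arg_cong[OF tensor[OF x y], of mor] x y by (simp add: e'_def mor_whisk(2,3))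
      fix f assume f: "f \<in> Hom C x y"
      have F: "arr (Arrow x f y)"
        unfolding arr_def using x y f by simp
      show "e' y \<cdot> (\<I> k \<boxtimes> f) = (f \<boxtimes> \<I> k) \<cdot> e' x"
        using arg_cong[OF natural[OF F refl refl], of mor] x y F kO
          mor_whisk(2)[OF F kO] mor_whisk(3)[OF F kO] by (simp add: e'_def)
    qed
    show "(\<I> x \<boxtimes> mor K) \<cdot> e' x = e x \<cdot> (mor K \<boxtimes> \<I> x)" if x: "x \<in> Ob C" for x
      using arg_cong[OF KE[OF x], of mor] x K' by (simp add: e'_def mor_whisk(2,3))
  qed
qed

end

lemma complex_vector_spaceI: "linear_category C \<Longrightarrow> complex_vector_space (lincat.smult C)"
  unfolding complex_vector_space_def linear_category_def by blast

context strict_monoidal_category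
begin

lemma tpow_Ob [simp]: "a \<in> Ob C \<Longrightarrow> tpow C a n \<in> Ob C"
  by (induction n) auto

lemma tpow_add: "a \<in> Ob C \<Longrightarrow> tpow C a (i + j) = tpow C a i \<odot> tpow C a j"
  by (induction i) auto

lemma tpow_mult: "a \<in> Ob C \<Longrightarrow> tpow C (tpow C a i) j = tpow C a (j * i)"
  by (induction j) (auto simp: tpow_add)

end

locale spherical_half_braided = spherical_fusion_category C + half_braided C b e
  for C :: "('a, 'b::ab_group_add, 'c) pivcat_scheme" (structure) and b e +
  assumes simple: "simple_object (drinfeld_center C) (b, e)"
begin

sublocale complex_vector_space "lincat.smult C"
  by (rule complex_vector_spaceI) unfold_locales

lemma center_Ob: "(c, e') \<in> Ob (drinfeld_center C) \<longleftrightarrow> c \<in> Ob C \<and> half_braiding C c e'"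
  by (simp add: drinfeld_center_def)

lemma center_Hom: "f \<in> Hom (drinfeld_center C) (c, e') (c', e'') \<longleftrightarrow> f \<in> Hom C c c' \<and>
    (\<forall>x\<in>Ob C. (\<I> x \<boxtimes> f) \<cdot> e' x = e'' x \<cdot> (f \<boxtimes> \<I> x))"
  by (simp add: drinfeld_center_def)

lemma center_simps: "cmp (drinfeld_center C) = cmp C" "idm (drinfeld_center C) (c, e') = \<I> c"
  by (simp_all add: drinfeld_center_def)

text \<open>\<open>zero_object\<close> asks for Hom sets equal to \<open>{0}\<close>, so 0 has to be
  exhibited as a morphism of the center.\<close>

lemma center_zero_Hom:
  assumes "c \<in> Ob C" "half_braiding C c e'" "c' \<in> Ob C" "half_braiding C c' e''"
  shows "0 \<in> Hom (drinfeld_center C) (c, e') (c', e'')"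
proof -
  interpret c: half_braided C c e' by unfold_locales (use assms in auto)
  interpret c': half_braided C c' e'' by unfold_locales (use assms in auto)
  let ?Z = "Arrow c 0 c'"
  have Z: "arr ?Z"
    unfolding arr_def using assms subspace_0[OF subspace_Hom] by simp
  have "(\<I> x \<boxtimes> 0) \<cdot> e' x = e'' x \<cdot> (0 \<boxtimes> \<I> x)" if x: "x \<in> Ob C" for x
  proof -
    have "mor (whisk x ?Z \<u> \<star> c.BR x) = 0"
      using Z x by (intro mor_comp_zero disjI1 mor_whisk_zero) simp_all
    moreover have "mor (c'.BR x \<star> whisk \<u> ?Z x) = 0"
      using Z x by (intro mor_comp_zero disjI2 mor_whisk_zero) simp_all
    ultimately show ?thesis
      using Z x mor_whisk(2)[OF Z x] mor_whisk(3)[OF Z x] by simp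
  qed
  then show ?thesis
    using arr_mor[OF Z] by (simp add: center_Hom)
qed

text \<open>A vanishing identity would kill every morphism from or to \<open>b\<close>, making
  \<open>(b, e)\<close> a zero object of the center.\<close>

lemma b_nonzero: "\<I> b \<noteq> 0"
proof
  assume zero: "\<I> b = 0"
  have "Hom (drinfeld_center C) (b, e) x = {0} \<and> Hom (drinfeld_center C) x (b, e) = {0}"
    if "x \<in> Ob (drinfeld_center C)" for x
  proof -
    obtain c e' where x': "x = (c, e')"
      by (cases x)
    with that have x: "x = (c, e')" "c \<in> Ob C" "half_braiding C c e'"
      by (simp_all add: center_Ob)
    have "f = 0" if f: "f \<in> Hom C b c" for f
      using cmp_id_right[OF b_Ob x(2) f] cmp_smult_right[OF b_Ob b_Ob x(2) id_Hom[OF b_Ob] f, of 0]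
      by (simp add: zero)
    moreover have "f = 0" if f: "f \<in> Hom C c b" for f
      using cmp_id_left[OF x(2) b_Ob f] cmp_smult_left[OF x(2) b_Ob b_Ob f id_Hom[OF b_Ob], of 0]
      by (simp add: zero)
    ultimately show ?thesis
      using center_zero_Hom[OF b_Ob hb x(2,3)] center_zero_Hom[OF x(2,3) b_Ob hb]
      by (auto simp: x(1) center_Hom)
  qed
  then have "zero_object (drinfeld_center C) (b, e)"
    using simple by (auto simp: zero_object_def simple_object_def)
  then show False
    using simple by (simp add: simple_object_def)
qed

text \<open>The kernel of \<open>G\<close> in \<open>C\<close> carries a half-braiding and becomes a
  subobject in the center. Simplicity leaves two cases: it is zero, excluded by \<open>w\<close>,
  which factors through it, or it is everything, and \<open>G\<close> vanishes. Here
  \<open>w\<close> is an arbitrary morphism of \<open>C\<close>, so that an eigenvector found in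
  \<open>C\<close> can serve.\<close>

lemma center_kernel_of_endomorphism:
  assumes G: "arr G" "src G = b" "tgt G = b"
    and central: "\<And>x. x \<in> Ob C \<Longrightarrow> BR x \<star> whisk \<u> G x = whisk x G \<u> \<star> BR x"
    and w: "w \<in> Hom C b b" "w \<noteq> 0" "mor G \<cdot> w = 0"
  shows "mor G = 0"
proof -
  have mG: "mor G \<in> Hom C b b"
    using arr_mor[OF G(1)] G by simp
  obtain k i where "is_kernel C b b (mor G) k i"
    using kernels[OF b_Ob b_Ob mG] by blast
  then have k: "k \<in> Ob C" and i: "i \<in> Hom C k b" "mor G \<cdot> i = 0"
    and univ: "\<And>x g. \<lbrakk>x \<in> Ob C; g \<in> Hom C x b; mor G \<cdot> g = 0\<rbrakk>
      \<Longrightarrow> \<exists>!h. h \<in> Hom C x k \<and> i \<cdot> h = g"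
    unfolding is_kernel_def by blast+
  have mono: "h = h'" if h: "x \<in> Ob C" "h \<in> Hom C x k" "h' \<in> Hom C x k" "i \<cdot> h = i \<cdot> h'" for x h h'
  proof -
    have "(mor G \<cdot> i) \<cdot> h = 0"
      using cmp_smult_left[OF h(1) k b_Ob h(2) i(1), of 0] by (simp add: i(2))
    then have "mor G \<cdot> (i \<cdot> h) = 0"
      using cmp_assoc[OF h(1) k b_Ob b_Ob h(2) i(1) mG] by simp
    then show ?thesis
      using univ[OF h(1) cmp_Hom[OF h(1) k b_Ob h(2) i(1)]] h by metis
  qed
  define K where "K = Arrow k i b"
  have K: "arr K" "src K = k" "tgt K = b" "mor K = i"
    unfolding arr_def K_def using k i by simp_all
  have kernel: "arrow_kernel G K"
    unfolding arrow_kernel_def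
  proof (intro conjI allI impI)
    fix h assume h: "arr h \<and> tgt h = src G \<and> mor (G \<star> h) = 0"
    then obtain m where m: "m \<in> Hom C (src h) k" "i \<cdot> m = mor h"
      using univ[of "src h" "mor h"] arr_mor[of h] G by auto
    have "arr (Arrow (src h) m k)"
      unfolding arr_def using m h k by simp
    moreover have "K \<star> Arrow (src h) m k = h"
      using h m K G by (intro arrow.expand) simp
    ultimately show "\<exists>m. arr m \<and> src m = src h \<and> tgt m = src K \<and> K \<star> m = h"
      using K by (intro exI[of _ "Arrow (src h) m k"]) simp
  next
    fix m m' assume m: "arr m \<and> arr m' \<and> src m = src m' \<and> tgt m = src K \<and> tgt m' = src K \<and> K \<star> m = K \<star> m'"
    then have "i \<cdot> mor m = i \<cdot> mor m'"
      using K(4) by (metis arrow_proj(3))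
    then have "mor m = mor m'"
      using mono[of "src m" "mor m" "mor m'"] arr_mor[of m] arr_mor[of m'] m K by auto
    then show "m = m'"
      using m by (intro arrow.expand) simp
  qed (use G K in simp_all)
  have "mor (G \<star> K) = 0"
    using K i by simp
  then obtain e' where e': "half_braiding C k e'"
    and Ke: "\<And>x. x \<in> Ob C \<Longrightarrow> (\<I> x \<boxtimes> i) \<cdot> e' x = e x \<cdot> (i \<boxtimes> \<I> x)"
    using kernel_half_braiding[OF G central kernel _ K(2)] K(4) by metis
  have iZ: "i \<in> Hom (drinfeld_center C) (k, e') (b, e)"
    using i Ke by (simp add: center_Hom)
  have "is_mono (drinfeld_center C) (k, e') (b, e) i"
    unfolding is_mono_def using iZ mono by (auto simp: center_simps center_Hom center_Ob)
  then have "zero_object (drinfeld_center C) (k, e') \<or> Defs.is_iso (drinfeld_center C) (k, e') (b, e) i"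
    using simple e' k unfolding simple_object_def by (auto simp: center_Ob)
  then show ?thesis
  proof
    assume "zero_object (drinfeld_center C) (k, e')"
    then have Z: "Hom (drinfeld_center C) (k, e') (k, e') = {0}"
      using e' k unfolding zero_object_def by (auto simp: center_Ob)
    interpret k: half_braided C k e' by unfold_locales (use e' k in auto)
    have "\<I> k \<in> Hom (drinfeld_center C) (k, e') (k, e')"
      unfolding center_Hom
    proof (intro conjI ballI)
      fix x assume x: "x \<in> Ob C"
      show "(\<I> x \<boxtimes> \<I> k) \<cdot> e' x = e' x \<cdot> (\<I> k \<boxtimes> \<I> x)"
        using cmp_id_left[OF _ _ arr_mor[OF k.arr_BR[OF x]]]
          cmp_id_right[OF _ _ arr_mor[OF k.arr_BR[OF x]]] x k
        by (simp add: tensM_id)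
    qed (rule id_Hom[OF k])
    then have "\<I> k = 0"
      using Z by blast
    moreover obtain h where h: "h \<in> Hom C b k" "i \<cdot> h = w"
      using univ[OF b_Ob w(1,3)] by blast
    ultimately have "h = 0"
      using cmp_id_left[OF b_Ob k h(1)] cmp_smult_left[OF b_Ob k k h(1) id_Hom[OF k], of 0] by simp
    then have "w = 0"
      using h cmp_smult_right[OF b_Ob k b_Ob h(1) i(1), of 0] by simp
    with w(2) show ?thesis
      by contradiction
  next
    assume "Defs.is_iso (drinfeld_center C) (k, e') (b, e) i"
    then obtain g where g: "g \<in> Hom C b k" "i \<cdot> g = \<I> b"
      unfolding Defs.is_iso_def by (auto simp: center_simps center_Hom)
    have "mor G = mor G \<cdot> i \<cdot> g"
      using cmp_id_right[OF b_Ob b_Ob mG] g by simp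
    also have "\<dots> = (mor G \<cdot> i) \<cdot> g"
      using cmp_assoc[OF b_Ob k b_Ob b_Ob g(1) i(1) mG] by simp
    also have "\<dots> = 0"
      using cmp_smult_left[OF b_Ob k b_Ob g(1) i(1), of 0] by (simp add: i(2))
    finally show ?thesis .
  qed
qed

text \<open>Left composition with \<open>F\<close> on the finite-dimensional space
  \<open>Hom C b b\<close> has an eigenvector \<open>w\<close>; subtracting the eigenvalue times the
  identity leaves a central endomorphism that kills \<open>w\<close>, hence is zero.\<close>

lemma center_schur:
  assumes F: "arr F" "src F = b" "tgt F = b"
    and central: "\<And>x. x \<in> Ob C \<Longrightarrow> BR x \<star> whisk \<u> F x = whisk x F \<u> \<star> BR x"
  obtains z where "mor F = lincat.smult C z (\<I> b)"
proof -
  let ?V = "Hom C b b" and ?s = "lincat.smult C"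
  have mF: "mor F \<in> ?V"
    using arr_mor[OF F(1)] F by simp
  have V: "subspace ?V"
    by (rule subspace_Hom) simp_all
  obtain B0 where B0: "finite B0" "span B0 = ?V"
    using finite_dim_Hom[OF b_Ob b_Ob] by blast
  have "lin_endo ?V (\<lambda>w. mor F \<cdot> w)"
    unfolding lin_endo_def
    using cmp_Hom[OF b_Ob b_Ob b_Ob _ mF] cmp_add_right[OF b_Ob b_Ob b_Ob _ _ mF]
      cmp_smult_right[OF b_Ob b_Ob b_Ob _ mF] by auto
  then obtain z w where w: "w \<in> ?V" "w \<noteq> 0" "mor F \<cdot> w = ?s z w"
    using eigenvector_exists[OF B0 _ id_Hom[OF b_Ob] b_nonzero] by blast
  have Iz: "?s (- z) (\<I> b) \<in> ?V"
    by (rule subspace_scale[OF V id_Hom[OF b_Ob]])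
  define G where "G = Arrow b (mor F + ?s (- z) (\<I> b)) b"
  have G: "arr G" "src G = b" "tgt G = b"
    unfolding arr_def G_def using subspace_add[OF V mF Iz] by simp_all
  have "BR x \<star> whisk \<u> G x = whisk x G \<u> \<star> BR x" if x: "x \<in> Ob C" for x
  proof -
    have bx: "b \<odot> x \<in> Ob C" "x \<odot> b \<in> Ob C"
      using x by simp_all
    have ex: "e x \<in> Hom C (b \<odot> x) (x \<odot> b)"
      using arr_mor[OF arr_BR[OF x]] by simp
    have 1: "mor G \<boxtimes> \<I> x = (mor F \<boxtimes> \<I> x) + ?s (- z) (\<I> (b \<odot> x))"
      using tensM_add_left[OF b_Ob b_Ob x x mF Iz id_Hom[OF x]]
        tensM_smult_left[OF b_Ob b_Ob x x id_Hom[OF b_Ob] id_Hom[OF x], of "- z"] x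
      by (simp add: G_def tensM_id)
    have 2: "\<I> x \<boxtimes> mor G = (\<I> x \<boxtimes> mor F) + ?s (- z) (\<I> (x \<odot> b))"
      using tensM_add_right[OF x x b_Ob b_Ob id_Hom[OF x] mF Iz]
        tensM_smult_right[OF x x b_Ob b_Ob id_Hom[OF x] id_Hom[OF b_Ob], of "- z"] x
      by (simp add: G_def tensM_id)
    have Fx: "mor F \<boxtimes> \<I> x \<in> Hom C (b \<odot> x) (b \<odot> x)" "\<I> x \<boxtimes> mor F \<in> Hom C (x \<odot> b) (x \<odot> b)"
      using tens_id_Hom[OF F(1) x] id_tens_Hom[OF F(1) x] F by simp_all
    have Ix: "?s (- z) (\<I> (b \<odot> x)) \<in> Hom C (b \<odot> x) (b \<odot> x)" "?s (- z) (\<I> (x \<odot> b)) \<in> Hom C (x \<odot> b) (x \<odot> b)"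
      using bx by (blast intro: subspace_scale subspace_Hom id_Hom)+
    have "e x \<cdot> (mor G \<boxtimes> \<I> x) = (e x \<cdot> (mor F \<boxtimes> \<I> x)) + ?s (- z) (e x)"
      unfolding 1 cmp_add_right[OF bx(1,1,2) Fx(1) Ix(1) ex]
        cmp_smult_right[OF bx(1,1,2) id_Hom[OF bx(1)] ex] cmp_id_right[OF bx ex] by (rule refl)
    also have "e x \<cdot> (mor F \<boxtimes> \<I> x) = (\<I> x \<boxtimes> mor F) \<cdot> e x"
      using arg_cong[OF central[OF x], of mor] F x mor_whisk(2,3)[OF F(1) x] by simp
    also have "((\<I> x \<boxtimes> mor F) \<cdot> e x) + ?s (- z) (e x) = (\<I> x \<boxtimes> mor G) \<cdot> e x"
      unfolding 2 cmp_add_left[OF bx(1,2,2) ex Fx(2) Ix(2)]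
        cmp_smult_left[OF bx(1,2,2) ex id_Hom[OF bx(2)]] cmp_id_left[OF bx ex] by (rule refl)
    finally show ?thesis
      using G x mor_whisk(2,3)[OF G(1) x] by (intro arrow.expand) simp
  qed
  moreover have "mor G \<cdot> w = 0"
  proof -
    have "mor G \<cdot> w = (mor F \<cdot> w) + ?s (- z) w"
      using cmp_add_left[OF b_Ob b_Ob b_Ob w(1) mF Iz]
        cmp_smult_left[OF b_Ob b_Ob b_Ob w(1) id_Hom[OF b_Ob], of "- z"] cmp_id_left[OF b_Ob b_Ob w(1)]
      by (simp add: G_def)
    then show ?thesis
      by (simp add: w(3))
  qed
  ultimately have "mor G = 0"
    using center_kernel_of_endomorphism[OF G _ w(1,2)] by blast
  then have "mor F = ?s z (\<I> b)"
    by (simp add: G_def)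
  then show ?thesis
    by (rule that)
qed

text \<open>The scalar of \<open>inv_twist\<close> is nonzero because it multiplies the twist to the
  identity, which is nonzero. The latter also makes the number described by
  \<open>twist_scalar\<close> unique.\<close>

lemma inv_twist_scalar:
  "twist_scalar C (b, e) \<noteq> 0"
  "mor inv_twist = lincat.smult C (1 / twist_scalar C (b, e)) (\<I> b)"
proof -
  let ?s = "lincat.smult C"
  obtain z where z: "mor inv_twist = ?s z (\<I> b)"
    using center_schur[OF inv_twist_arr inv_twist_central] .
  have mt: "mor twist_arrow \<in> Hom C b b"
    using arr_mor[OF twist_arrow_arr(1)] by simp
  have eq: "?s z (mor twist_arrow) = \<I> b"
    using arg_cong[OF twist_arrow_inv_twist, of mor] z
      cmp_smult_right[OF b_Ob b_Ob b_Ob id_Hom[OF b_Ob] mt, of z] cmp_id_right[OF b_Ob b_Ob mt] by simp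
  have z0: "z \<noteq> 0"
    using eq b_nonzero by auto
  have tw: "mor twist_arrow = ?s (1 / z) (\<I> b)"
    unfolding eq[symmetric] using z0 by simp
  have "twist C (b, e) = mor twist_arrow"
    by (simp add: twist_def twist_arrow_def mor_whisk(2)[of "EV _"] mor_whisk(2)[of "COEV _"] mor_whisk(3)[of "BR _"])
  then have "twist_scalar C (b, e) = 1 / z"
    unfolding twist_scalar_def center_simps using b_nonzero by (simp add: tw)
  then show "twist_scalar C (b, e) \<noteq> 0" "mor inv_twist = ?s (1 / twist_scalar C (b, e)) (\<I> b)"
    using z z0 by simp_all
qed

end

section \<open>Powers of the rotation operator\<close>

context half_braided
begin

definition b_arrow :: "'a \<Rightarrow> 'b \<Rightarrow> ('a, 'b) arrow" where
  "b_arrow x f = Arrow b f x"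

lemma b_arrow_simps [simp]:
  "src (b_arrow x f) = b" "tgt (b_arrow x f) = x" "mor (b_arrow x f) = f"
  by (simp_all add: b_arrow_def)

lemma arr_b_arrow [simp]: "\<lbrakk>x \<in> Ob C; f \<in> Hom C b x\<rbrakk> \<Longrightarrow> arr (b_arrow x f)"
  unfolding arr_def by simp

lemma b_arrow_mor: "\<lbrakk>src F = b; tgt F = x\<rbrakk> \<Longrightarrow> b_arrow x (mor F) = F"
  by (intro arrow.expand) simp

lemma rotation_eq_rot:
  assumes a: "a \<in> Ob C" and f: "f \<in> Hom C b (tpow C a (Suc n))"
  shows "rotation C (b, e) (Suc n) a f = mor (rot a (tpow C a n) (b_arrow (tpow C a (Suc n)) f))"
proof -
  have "tpow C a n \<odot> a = a \<odot> tpow C a n"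
    using tpow_add[OF a, of n 1] a by simp
  then show ?thesis
    using a f mor_whisk(1)[of "dual C a" "b_arrow (a \<odot> tpow C a n) f" a]
    by (simp add: rotation_def rot_def mor_whisk(3)[of "EV _"] mor_whisk(3)[of "BR _"]
        mor_whisk(2)[of "COEV _"])
qed

text \<open>By \<open>rot_tensor\<close>, each further rotation extends the block by one copy of
  \<open>a\<close>. The exponent is \<open>Suc j\<close> with \<open>j < n\<close>, so that the
  block is nonempty and the subtraction exact.\<close>

lemma rotation_funpow:
  assumes a: "a \<in> Ob C" and f: "f \<in> Hom C b (tpow C a n)" and j: "j < n"
  shows "(rotation C (b, e) n a ^^ Suc j) f
    = mor (rot (tpow C a (Suc j)) (tpow C a (n - Suc j)) (b_arrow (tpow C a n) f))"
  using j
proof (induction j)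
  case 0
  then obtain n' where "n = Suc n'"
    by (cases n) auto
  then show ?case
    using rotation_eq_rot[OF a, of f n'] f a by simp
next
  case (Suc j)
  obtain l where "n = Suc (Suc j + l)"
    using less_imp_Suc_add[OF Suc.prems] by blast
  then have n: "n = Suc (Suc (j + l))"
    by simp
  \<comment> \<open>\<open>x\<close> is the block already rotated, \<open>y\<close> what is left
    after the next copy of \<open>a\<close>.\<close>
  define x y where "x = tpow C a (Suc j)" and "y = tpow C a l"
  have O: "x \<in> Ob C" "y \<in> Ob C"
    using a by (simp_all add: x_def y_def)
  have xa: "x \<odot> a = a \<odot> x"
    using tpow_add[OF a, of "Suc j" 1] a by (simp add: x_def)
  have n1: "tpow C a n = x \<odot> a \<odot> y"
    using tpow_add[OF a, of "Suc j" "Suc l"] a by (simp add: n x_def y_def)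
  have yx: "tpow C a (Suc (j + l)) = y \<odot> x"
    using tpow_add[OF a, of l "Suc j"] by (simp add: x_def y_def add.commute)
  define F where "F = b_arrow (tpow C a n) f"
  have F: "arr F" "src F = b" "tgt F = x \<odot> a \<odot> y"
    using f a O n1 by (simp_all add: F_def)
  let ?G = "rot x (a \<odot> y) F"
  have G: "arr ?G" "src ?G = b" "tgt ?G = a \<odot> y \<odot> x"
    using rot_arr[of x "a \<odot> y" F] F O a by simp_all
  have n2: "tpow C a n = a \<odot> y \<odot> x"
    using yx by (simp add: n)
  have "(rotation C (b, e) n a ^^ Suc (Suc j)) f = rotation C (b, e) n a (mor ?G)"
    using Suc by (simp add: n F_def x_def y_def)
  also have "\<dots> = mor (rot a (y \<odot> x) (b_arrow (tpow C a n) (mor ?G)))"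
    using rotation_eq_rot[OF a, of "mor ?G" "Suc (j + l)"] arr_mor[OF G(1)] G n2
    by (simp add: n yx[symmetric])
  also have "b_arrow (tpow C a n) (mor ?G) = ?G"
    by (rule b_arrow_mor) (use G n2 in simp_all)
  also have "rot a (y \<odot> x) ?G = rot (x \<odot> a) y F"
    using rot_tensor[OF O(1) a O(2) F] by simp
  finally show ?case
    unfolding F_def xa by (simp add: n x_def y_def)
qed

text \<open>Both sides rotate the block of the first \<open>g\<close> factors, once as a single
  object and once factor by factor.\<close>

lemma rotation_funpow_tpow:
  assumes a: "a \<in> Ob C" and f: "f \<in> Hom C b (tpow C a n)" and n: "n = m * g" "g > 0" "m > 0"
  shows "rotation C (b, e) m (tpow C a g) f = (rotation C (b, e) n a ^^ g) f"
proof -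
  obtain g' m' where gm: "g = Suc g'" "m = Suc m'"
    using n by (metis gr0_implies_Suc)
  have "n - Suc g' = m' * g" "g' < n"
    using n gm by simp_all
  then show ?thesis
    using rotation_funpow[OF a f, of g'] rotation_eq_rot[of "tpow C a g" f m'] a f n(1) gm(2)
    by (simp add: tpow_mult gm(1)[symmetric] del: tpow.simps(2) funpow.simps(2))
qed

end

context spherical_half_braided
begin

text \<open>After \<open>n\<close> steps the block is the whole target, so \<open>rot_full\<close>
  leaves precomposition with the scalar \<open>inv_twist\<close>.\<close>

lemma rotation_order:
  assumes a: "a \<in> Ob C" and f: "f \<in> Hom C b (tpow C a n)" and n: "n > 0"
  shows "(rotation C (b, e) n a ^^ n) f = lincat.smult C (1 / twist_scalar C (b, e)) f"
proof -
  obtain n' where n': "n = Suc n'"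
    using n by (cases n) auto
  have t: "tpow C a n \<in> Ob C"
    using a by simp
  have "(rotation C (b, e) n a ^^ n) f = mor (rot (tpow C a n) \<u> (b_arrow (tpow C a n) f))"
    using rotation_funpow[OF a f, of n'] n' by simp
  also have "\<dots> = f \<cdot> mor inv_twist"
    using rot_full[of "b_arrow (tpow C a n) f"] t f by simp
  also have "\<dots> = lincat.smult C (1 / twist_scalar C (b, e)) f"
    unfolding inv_twist_scalar(2)
    using cmp_smult_right[OF b_Ob b_Ob t id_Hom[OF b_Ob] f] cmp_id_right[OF b_Ob t f] by simp
  finally show ?thesis .
qed

lemma rotation_lin_endo:
  assumes a: "a \<in> Ob C" and n: "n > 0"
  shows "lin_endo (Hom C b (tpow C a n)) (rotation C (b, e) n a)"
proof -
  obtain n' where n': "n = Suc n'"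
    using n by (cases n) auto
  let ?x = "dual C a" and ?t = "tpow C a n" and ?s = "lincat.smult C"
  have t: "?t \<in> Ob C" and t': "tpow C a n' \<in> Ob C"
    using a by simp_all
  have ta: "?t \<odot> a = a \<odot> ?t"
    using tpow_add[OF a, of n 1] a by simp
  have ta': "tpow C a n' \<odot> a = ?t"
    using tpow_add[OF a, of n' 1] a by (simp add: n')
  define P where "P = whisk \<u> (EV a) ?t"
  define Q where "Q = whisk \<u> (BR ?x) a \<star> whisk b (COEV ?x) \<u>"
  have P: "arr P" "src P = ?x \<odot> ?t \<odot> a" "tgt P = ?t"
    using a t ta by (simp_all add: P_def)
  have Q: "arr Q" "src Q = b" "tgt Q = ?x \<odot> b \<odot> a"
    using a by (simp_all add: Q_def)
  have mP: "mor P \<in> Hom C (?x \<odot> ?t \<odot> a) ?t" and mQ: "mor Q \<in> Hom C b (?x \<odot> b \<odot> a)"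
    using arr_mor[OF P(1)] arr_mor[OF Q(1)] P Q by simp_all
  \<comment> \<open>Only the middle factor depends on \<open>f\<close>, so linearity is inherited
    from tensor product and composition.\<close>
  have rho: "rotation C (b, e) n a f = mor P \<cdot> (\<I> ?x \<boxtimes> f \<boxtimes> \<I> a) \<cdot> mor Q" for f
    using a t by (simp add: rotation_def P_def Q_def mor_whisk(3)[of "EV _"] mor_whisk(3)[of "BR _"]
        mor_whisk(2)[of "COEV _"])
  have O: "?x \<in> Ob C" "b \<odot> a \<in> Ob C" "?t \<odot> a \<in> Ob C" "?x \<odot> b \<odot> a \<in> Ob C" "?x \<odot> ?t \<odot> a \<in> Ob C"
    using a t by simp_all
  have fa: "f \<boxtimes> \<I> a \<in> Hom C (b \<odot> a) (?t \<odot> a)" if "f \<in> Hom C b ?t" for f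
    by (rule tensM_Hom[OF b_Ob t a a that id_Hom[OF a]])
  have xfa: "\<I> ?x \<boxtimes> f \<boxtimes> \<I> a \<in> Hom C (?x \<odot> b \<odot> a) (?x \<odot> ?t \<odot> a)" if "f \<in> Hom C b ?t" for f
    by (rule tensM_Hom[OF O(1,1,2,3) id_Hom[OF O(1)] fa[OF that]])
  have xfaQ: "(\<I> ?x \<boxtimes> f \<boxtimes> \<I> a) \<cdot> mor Q \<in> Hom C b (?x \<odot> ?t \<odot> a)" if "f \<in> Hom C b ?t" for f
    by (rule cmp_Hom[OF b_Ob O(4,5) mQ xfa[OF that]])
  show ?thesis
    unfolding lin_endo_def rho
  proof (intro conjI ballI allI)
    fix f assume f: "f \<in> Hom C b ?t"
    show "mor P \<cdot> (\<I> ?x \<boxtimes> f \<boxtimes> \<I> a) \<cdot> mor Q \<in> Hom C b ?t"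
      by (rule cmp_Hom[OF b_Ob O(5) t xfaQ[OF f] mP])
    fix r
    show "mor P \<cdot> (\<I> ?x \<boxtimes> ?s r f \<boxtimes> \<I> a) \<cdot> mor Q = ?s r (mor P \<cdot> (\<I> ?x \<boxtimes> f \<boxtimes> \<I> a) \<cdot> mor Q)"
      unfolding tensM_smult_left[OF b_Ob t a a f id_Hom[OF a]]
        tensM_smult_right[OF O(1,1,2,3) id_Hom[OF O(1)] fa[OF f]]
        cmp_smult_left[OF b_Ob O(4,5) mQ xfa[OF f]]
        cmp_smult_right[OF b_Ob O(5) t xfaQ[OF f] mP] by (rule refl)
  next
    fix f f' assume f: "f \<in> Hom C b ?t" and f': "f' \<in> Hom C b ?t"
    show "mor P \<cdot> (\<I> ?x \<boxtimes> (f + f') \<boxtimes> \<I> a) \<cdot> mor Q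
        = (mor P \<cdot> (\<I> ?x \<boxtimes> f \<boxtimes> \<I> a) \<cdot> mor Q) + (mor P \<cdot> (\<I> ?x \<boxtimes> f' \<boxtimes> \<I> a) \<cdot> mor Q)"
      unfolding tensM_add_left[OF b_Ob t a a f f' id_Hom[OF a]]
        tensM_add_right[OF O(1,1,2,3) id_Hom[OF O(1)] fa[OF f] fa[OF f']]
        cmp_add_left[OF b_Ob O(4,5) mQ xfa[OF f] xfa[OF f']]
        cmp_add_right[OF b_Ob O(5) t xfaQ[OF f] xfaQ[OF f'] mP] by (rule refl)
  qed
qed

text \<open>Both indicators are traces of powers of the same operator \<open>S\<close>, with
  exponents 1 and \<open>j\<close>, so one eigenbasis evaluates both.\<close>

lemma fs_indicator_galois:
  assumes a: "a \<in> Ob C" and t: "t ^ n = twist_scalar C (b, e)" and k: "1 \<le> k" "k \<le> n - 1"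
    and g: "g = gcd k n"
  shows "t ^ g * fs_indicator C (b, e) (n div g) 1 (tpow C a g) \<in> cyclotomic_field (n div g)"
    and "fs_indicator C (b, e) n (int k) a = t powi (- int k) *
      cyclotomic_aut (k div g) (n div g) (t ^ g * fs_indicator C (b, e) (n div g) 1 (tpow C a g))"
proof -
  define m j where "m = n div g" and "j = k div g"
  have n0: "n > 0" and g0: "g > 0"
    using k g by auto
  have nm: "n = m * g" and kj: "k = j * g"
    by (simp_all add: m_def j_def g)
  have m0: "m > 0"
    using nm n0 by (cases m) auto
  have cop: "coprime j m"
    using n0 unfolding m_def j_def g by (intro div_gcd_coprime) simp
  have t0: "t \<noteq> 0"
    using t inv_twist_scalar(1) n0 by (auto simp: power_0_left)
  let ?V = "Hom C b (tpow C a n)" and ?\<rho> = "rotation C (b, e) n a"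
  define S where "S = ?\<rho> ^^ g"
  have \<rho>: "lin_endo ?V ?\<rho>"
    using rotation_lin_endo a n0 by blast
  have S: "lin_endo ?V S"
    unfolding S_def by (rule lin_endo_funpow[OF \<rho>])
  have Sj: "S ^^ i = ?\<rho> ^^ (i * g)" for i
    by (simp add: S_def funpow_mult mult.commute)
  obtain B0 where B0: "finite B0" "span B0 = ?V"
    using finite_dim_Hom[of b "tpow C a n"] a by auto
  \<comment> \<open>Since \<open>S ^^ m\<close> is the \<open>n\<close>-th power of the rotation, it
    acts by the inverse of the twist scalar, which \<open>t ^ n\<close> compensates.\<close>
  have order: "lincat.smult C ((t ^ g) ^ m) ((S ^^ m) f) = f" if f: "f \<in> ?V" for f
    using rotation_order[OF a f n0] inv_twist_scalar(1) t
    by (simp add: Sj nm[symmetric] power_mult[symmetric] mult.commute[of g])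
  obtain B :: "'b set" and \<mu> where B: "finite B" "\<And>v. v \<in> B \<Longrightarrow> (t ^ g * \<mu> v) ^ m = 1"
    and tr: "\<And>i. trace_on ?V (S ^^ i) = (\<Sum>v\<in>B. \<mu> v ^ i)"
    using trace_funpow_finite_order[OF B0 S m0 order] t0 by (metis power_not_zero)
  have V: "Hom C b (tpow C (tpow C a g) m) = ?V"
    using a by (simp add: tpow_mult nm[symmetric])
  have "fs_indicator C (b, e) m 1 (tpow C a g) = trace_on ?V (rotation C (b, e) m (tpow C a g))"
    by (simp add: fs_indicator_def V int_power_on_def)
  also have "\<dots> = trace_on ?V (S ^^ 1)"
    \<comment> \<open>The two operators are known to agree on \<open>?V\<close> only, which is all
      that the trace sees.\<close>
    by (rule trace_on_cong[OF B0]) (simp add: S_def rotation_funpow_tpow[OF a _ nm g0 m0])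
  finally have nu1: "t ^ g * fs_indicator C (b, e) m 1 (tpow C a g) = (\<Sum>v\<in>B. t ^ g * \<mu> v)"
    by (simp only: tr sum_distrib_left power_one_right)
  have "fs_indicator C (b, e) n (int k) a = trace_on ?V (S ^^ j)"
    by (simp add: fs_indicator_def int_power_on_def Sj kj[symmetric])
  also have "\<dots> = (\<Sum>v\<in>B. t powi (- int k) * (t ^ g * \<mu> v) ^ j)"
  proof -
    have "(t ^ g) ^ j = t ^ k"
      by (simp only: kj power_mult[symmetric] mult.commute[of g])
    then show ?thesis
      using t0 by (simp add: tr power_int_minus power_mult_distrib mult.assoc[symmetric])
  qed
  finally have nuk: "fs_indicator C (b, e) n (int k) a = t powi (- int k) * (\<Sum>v\<in>B. (t ^ g * \<mu> v) ^ j)"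
    by (simp add: sum_distrib_left)
  show "t ^ g * fs_indicator C (b, e) (n div g) 1 (tpow C a g) \<in> cyclotomic_field (n div g)"
    unfolding m_def[symmetric] nu1 by (rule cyclotomic_aut_sum_roots(1)[OF m0 cop B])
  show "fs_indicator C (b, e) n (int k) a = t powi (- int k) *
      cyclotomic_aut (k div g) (n div g) (t ^ g * fs_indicator C (b, e) (n div g) 1 (tpow C a g))"
    unfolding m_def[symmetric] j_def[symmetric] nu1 nuk using cyclotomic_aut_sum_roots(2)[OF m0 cop B] by simp
qed

end

theorem proposition3p7:
  fixes C :: "('o, 'm::ab_group_add) pivcat" and a :: 'o and b :: "'o \<times> ('o \<Rightarrow> 'm)"
    and n k g :: nat and t :: complex
  assumes "spherical_fusion_category C"
    and "a \<in> Ob C"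
    and "simple_object (drinfeld_center C) b"
    and "t ^ n = twist_scalar C b"
    and "1 \<le> k" and "k \<le> n - 1"
    and "g = gcd k n"
  shows "t ^ g * fs_indicator C b (n div g) 1 (tpow C a g) \<in> cyclotomic_field (n div g) \<and>
    fs_indicator C b n (int k) a =
      t powi (- int k) *
        cyclotomic_aut (k div g) (n div g) (t ^ g * fs_indicator C b (n div g) 1 (tpow C a g))"
proof -
  obtain c e where b: "b = (c, e)"
    by (cases b)
  have c: "c \<in> Ob C" "half_braiding C c e"
    using assms(3) by (simp_all add: b simple_object_def drinfeld_center_def)
  interpret spherical_fusion_category C
    by (rule assms(1))
  interpret spherical_half_braided C c e
    by unfold_locales (use c assms(3) in \<open>simp_all add: b\<close>)
  show ?thesis
    using fs_indicator_galois[OF assms(2) _ assms(5-7), of t] assms(4) unfolding b by blast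
qed

end
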